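(* Let $q$ be a (conservative stable) $Q$-function on the nonempty Borel space $S$, let $c\in[0,\infty)$, and let $f$ be a $c$-drift function with respect to $q$. Then $$\mathbb E_x^q[f(X_t)]-f(x)=\int_0^t\mathbb E_x^q\left[\int_Sf(y)q(dy|X_s,s)\right]ds\quad\forall x\in S,\ t\in[0,\infty)$$ holds if and only if $$P_{q^f}(0,x,t,S_\delta)=1\quad\forall x\in S,\ t\ge0,$$ i.e. the Markov pure jump process with transition function $P_{q^f}$ (on the state space $S_\delta$) is nonexplosive.
   Context: $S$ is a nonempty Borel space with Borel $\sigma$-algebra $\mathcal B(S)$; measurability means Borel measurability. A (conservative stable) $Q$-function on $S$ is a Borel-measurable signed kernel $q(dy|x,s)$ on $\mathcal B(S)$ from $S\times[0,\infty)$ such that (1) $0\le q(\Gamma|x,s)<\infty$ whenever $x\notin\Gamma\in\mathcal B(S)$, (2) $q(S|x,s)=0$ for all $(x,s)$, (3) $\sup_{s\ge0}q(S\setminus\{x\}|x,s)<\infty$ for each $x\in S$. Put $\tilde q(\Gamma|x,s):=q(\Gamma\setminus\{x\}|x,s)$ and $q_x(s):=-q(\{x\}|x,s)$. The $q$-transition function is $P_q:=\sum_{n\ge0}P_q^{(n)}$, where for $0\le s\le t<\infty$, $P_q^{(0)}(s,x,t,\Gamma)=\delta_x(\Gamma)e^{-\int_s^tq_x(v)dv}$ and $P_q^{(n+1)}(s,x,t,\Gamma)=\int_s^te^{-\int_s^uq_x(v)dv}\left(\int_SP_q^{(n)}(u,z,t,\Gamma)\tilde q(dz|x,u)\right)du$.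 These constructions apply to a $Q$-function on any Borel space. The Markov pure jump process $(X_t)$ with transition function $P_q$ and initial state $x\in S$ (law $\mathbb P^q_x$, expectation $\mathbb E^q_x$): $x_0=x$, $t_0=0$, and, given the past up to the jump moment $t_n<\infty$ with post-jump state $x_n\in S$, the next pair $(t_{n+1},x_{n+1})$ has conditional law $e^{-\int_{t_n}^tq_{x_n}(v)dv}\tilde q(dy|x_n,t)\,dt$ on $(t_n,\infty)\times S$, the remaining mass being put on $t_{n+1}=\infty$, $x_{n+1}=x_\infty$, where $x_\infty$ is an isolated cemetery point outside the state space; $X_t=x_n$ for $t_n\le t<t_{n+1}$ and $X_t=x_\infty$ for $t\ge t_\infty:=\lim_nt_n$. The process is nonexplosive if $\mathbb P_x^q(t_\infty=\infty)=1$ for every initial state $x$. Functions on $S$ are extended by $0$ at $x_\infty$, so $\mathbb E^q_x[h(X_t)]=\int_Sh(y)P_q(0,x,t,dy)$. A $c$-drift function with respect to $q$ is a $(0,\infty)$-valued measurable function $f$ on $S$ such that for all $x\in S$, $s\ge0$: $\int_Sf(y)\tilde q(dy|x,s)<\infty$ and $\int_Sf(y)q(dy|x,s):=\int_Sf(y)\tilde q(dy|x,s)-q_x(s)f(x)\le cf(x)$. (For such $f$, the positive part of $\int_S f(y)q(dy|X_s,s)$ is integrable, so the right-hand side of the first display is well defined.) The $f$-transformed $Q$-function $q^f$ is the conservative stable $Q$-function on $S_\delta:=S\cup\{\delta\}$, $\delta\notin S$ an isolated point ($\delta\neq x_\infty$), given by $q^f(\Gamma|x,s)=\frac1{f(x)}\int_\Gamma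 f(y)q(dy|x,s)$ for $x\in S$, $\Gamma\in\mathcal B(S)$, $x\notin\Gamma$; $q^f(\{\delta\}|x,s)=c-\frac1{f(x)}\int_Sf(y)q(dy|x,s)$ for $x\in S$; and $q^f(S|\delta,s)=0$ ($\delta$ is absorbing). Hence $q^f_x(s)=c+q_x(s)$ for $x\in S$. *)

theory Defs
  imports "HOL-Probability.Probability"
begin

(* q x s G stands for q(G|x,s).  The values are real: finiteness off the diagonal
   and total mass 0 force every value of the signed measure q(.|x,s) to be finite.  Only x in the state space, s >= 0 and measurable G
   are meaningful. *)
type_synonym 'a rate = "'a \<Rightarrow> real \<Rightarrow> 'a set \<Rightarrow> real"

abbreviation time_space :: "real measure" where
  "time_space \<equiv> restrict_space borel {0..}"

definition signed_kernel :: "'a measure \<Rightarrow> 'a rate \<Rightarrow> bool" where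
  "signed_kernel M q \<longleftrightarrow>
     (\<forall>x\<in>space M. \<forall>s\<ge>0. \<forall>A :: nat \<Rightarrow> 'a set.
        range A \<subseteq> sets M \<longrightarrow> disjoint_family A \<longrightarrow> (\<lambda>i. q x s (A i)) sums q x s (\<Union>i. A i)) \<and>
     (\<forall>\<Gamma>\<in>sets M. (\<lambda>(x, s). q x s \<Gamma>) \<in> borel_measurable (M \<Otimes>\<^sub>M time_space))"

definition Q_function :: "'a measure \<Rightarrow> 'a rate \<Rightarrow> bool" where
  "Q_function M q \<longleftrightarrow> signed_kernel M q \<and>
     (\<forall>x\<in>space M. \<forall>s\<ge>0. \<forall>\<Gamma>\<in>sets M. x \<notin> \<Gamma> \<longrightarrow> 0 \<le> q x s \<Gamma>) \<and>
     (\<forall>x\<in>space M. \<forall>s\<ge>0. q x s (space M) = 0) \<and>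
     (\<forall>x\<in>space M. bdd_above ((\<lambda>s. q x s (space M - {x})) ` {0..}))"

definition off_diag :: "'a measure \<Rightarrow> 'a rate \<Rightarrow> 'a \<Rightarrow> real \<Rightarrow> 'a measure" where
  "off_diag M q x s = measure_of (space M) (sets M) (\<lambda>\<Gamma>. ennreal (q x s (\<Gamma> - {x})))"

definition exit_rate :: "'a rate \<Rightarrow> 'a \<Rightarrow> real \<Rightarrow> real" where
  "exit_rate q x s = - q x s {x}"

definition stay_prob :: "'a rate \<Rightarrow> 'a \<Rightarrow> real \<Rightarrow> real \<Rightarrow> real" where
  "stay_prob q x s t = exp (- (LINT v:{s..t}|lborel. exit_rate q x v))"

primrec trans_term ::
  "'a measure \<Rightarrow> 'a rate \<Rightarrow> nat \<Rightarrow> real \<Rightarrow> 'a \<Rightarrow> real \<Rightarrow> 'a set \<Rightarrow> ennreal" where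
  "trans_term M q 0 s x t \<Gamma> = indicator \<Gamma> x * ennreal (stay_prob q x s t)"
| "trans_term M q (Suc n) s x t \<Gamma> =
     (\<integral>\<^sup>+u\<in>{s..t}. ennreal (stay_prob q x s u) *
        (\<integral>\<^sup>+z. trans_term M q n u z t \<Gamma> \<partial>off_diag M q x u) \<partial>lborel)"

definition trans_fun ::
  "'a measure \<Rightarrow> 'a rate \<Rightarrow> real \<Rightarrow> 'a \<Rightarrow> real \<Rightarrow> 'a set \<Rightarrow> ennreal" where
  "trans_fun M q s x t \<Gamma> = (\<Sum>n. trans_term M q n s x t \<Gamma>)"

(* M together with one further isolated point, None *)
definition adjoin :: "'a measure \<Rightarrow> 'a option measure" where
  "adjoin M = sigma (insert None (Some ` space M))
     {\<Gamma>. \<Gamma> \<subseteq> insert None (Some ` space M) \<and> {y \<in> space M. Some y \<in> \<Gamma>} \<in> sets M}"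

(* Range of the pairs (t_n, x_n): Some (t, x) is a jump at the finite time t into the state x,
   and None is the pair consisting of the time infinity and the cemetery point. *)
abbreviation jump_space :: "'a measure \<Rightarrow> (real \<times> 'a) option measure" where
  "jump_space M \<equiv> adjoin (time_space \<Otimes>\<^sub>M M)"

definition finite_jump_mass ::
  "'a measure \<Rightarrow> 'a rate \<Rightarrow> real \<Rightarrow> 'a \<Rightarrow> (real \<times> 'a) option set \<Rightarrow> ennreal" where
  "finite_jump_mass M q t x \<Gamma> =
     (\<integral>\<^sup>+u\<in>{t<..}. ennreal (stay_prob q x t u) *
        emeasure (off_diag M q x u) {y \<in> space M. Some (u, y) \<in> \<Gamma>} \<partial>lborel)"

primrec next_jump ::
  "'a measure \<Rightarrow> 'a rate \<Rightarrow> (real \<times> 'a) option \<Rightarrow> (real \<times> 'a) option measure" where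
  "next_jump M q None = return (jump_space M) None"
| "next_jump M q (Some p) =
     (case p of (t, x) \<Rightarrow>
        measure_of (space (jump_space M)) (sets (jump_space M))
          (\<lambda>\<Gamma>. finite_jump_mass M q t x \<Gamma> +
            indicator \<Gamma> None * (1 - finite_jump_mass M q t x (space (jump_space M)))))"

primrec jump_kernel ::
  "'a measure \<Rightarrow> 'a rate \<Rightarrow> 'a \<Rightarrow> nat \<Rightarrow> (nat \<Rightarrow> (real \<times> 'a) option) \<Rightarrow> (real \<times> 'a) option measure"
where
  "jump_kernel M q x 0 \<omega> = return (jump_space M) (Some (0, x))"
| "jump_kernel M q x (Suc n) \<omega> = next_jump M q (\<omega> n)"

(* The law P^q_x of the sequence (t_n, x_n), by the Ionescu-Tulcea construction: jump_kernel M q x n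
   is the conditional law of the n-th pair given the preceding ones. *)
definition jump_law ::
  "'a measure \<Rightarrow> 'a rate \<Rightarrow> 'a \<Rightarrow> (nat \<Rightarrow> (real \<times> 'a) option) measure" where
  "jump_law M q x = projective_family.lim UNIV
     (Ionescu_Tulcea.CI (jump_kernel M q x) (\<lambda>_. jump_space M)) (\<lambda>_. jump_space M)"

definition jump_time :: "(nat \<Rightarrow> (real \<times> 'a) option) \<Rightarrow> nat \<Rightarrow> ereal" where
  "jump_time \<omega> n = (case \<omega> n of Some (t, _) \<Rightarrow> ereal t | None \<Rightarrow> \<infinity>)"

(* The jump times increase almost surely, so the supremum is their limit. *)
definition explosion_time :: "(nat \<Rightarrow> (real \<times> 'a) option) \<Rightarrow> ereal" where
  "explosion_time \<omega> = (SUP n. jump_time \<omega> n)"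

(* None is the cemetery point.  Almost surely the index n below is unique whenever t is
   nonnegative and smaller than the explosion time; LEAST only fixes the value on a null set. *)
definition process_at :: "(nat \<Rightarrow> (real \<times> 'a) option) \<Rightarrow> real \<Rightarrow> 'a option" where
  "process_at \<omega> t =
     (if ereal t < explosion_time \<omega>
      then map_option snd (\<omega> (LEAST n. jump_time \<omega> n \<le> ereal t \<and> ereal t < jump_time \<omega> (Suc n)))
      else None)"

definition nonexplosive :: "'a measure \<Rightarrow> 'a rate \<Rightarrow> bool" where
  "nonexplosive M q \<longleftrightarrow>
     (\<forall>x\<in>space M. \<P>(\<omega> in jump_law M q x. explosion_time \<omega> = \<infinity>) = 1)"

(* Integral of the positive part minus integral of the negative part; meaningful if one of them
   is finite. *)
definition ext_integral :: "'b measure \<Rightarrow> ('b \<Rightarrow> ereal) \<Rightarrow> ereal" where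
  "ext_integral N g =
     enn2ereal (\<integral>\<^sup>+\<omega>. e2ennreal (g \<omega>) \<partial>N) - enn2ereal (\<integral>\<^sup>+\<omega>. e2ennreal (- g \<omega>) \<partial>N)"

(* E^q_x[h(X_t)] with h extended by 0 at the cemetery *)
definition expect_at :: "'a measure \<Rightarrow> 'a rate \<Rightarrow> 'a \<Rightarrow> real \<Rightarrow> ('a \<Rightarrow> real) \<Rightarrow> ereal" where
  "expect_at M q x t h =
     ext_integral (jump_law M q x)
       (\<lambda>\<omega>. case process_at \<omega> t of None \<Rightarrow> 0 | Some y \<Rightarrow> ereal (h y))"

(* The integral of f with respect to the signed measure q(.|x,s), split into its off-diagonal
   part and the atom at x. *)
definition q_integral :: "'a measure \<Rightarrow> 'a rate \<Rightarrow> ('a \<Rightarrow> real) \<Rightarrow> 'a \<Rightarrow> real \<Rightarrow> real" where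
  "q_integral M q f x s = (LINT y|off_diag M q x s. f y) - exit_rate q x s * f x"

definition drift_function :: "'a measure \<Rightarrow> 'a rate \<Rightarrow> real \<Rightarrow> ('a \<Rightarrow> real) \<Rightarrow> bool" where
  "drift_function M q c f \<longleftrightarrow>
     f \<in> borel_measurable M \<and> (\<forall>x\<in>space M. 0 < f x) \<and>
     (\<forall>x\<in>space M. \<forall>s\<ge>0. (\<integral>\<^sup>+y. ennreal (f y) \<partial>off_diag M q x s) < \<infinity> \<and>
        q_integral M q f x s \<le> c * f x)"

(* The values q^f(G|x,s) for x not in G; None is delta.  Off the point x, the measures q(.|x,s)
   and off_diag M q x s agree. *)
definition transform_off ::
  "'a measure \<Rightarrow> 'a rate \<Rightarrow> real \<Rightarrow> ('a \<Rightarrow> real) \<Rightarrow> 'a option rate" where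
  "transform_off M q c f x s \<Gamma> =
     (case x of
        None \<Rightarrow> 0
      | Some y \<Rightarrow>
          1 / f y * (LINT z:{z \<in> space M. Some z \<in> \<Gamma>}|off_diag M q y s. f z) +
          (if None \<in> \<Gamma> then c - 1 / f y * q_integral M q f y s else 0))"

(* q^f on adjoin M.  The mass at x itself is the one forced by conservativeness. *)
definition f_transform ::
  "'a measure \<Rightarrow> 'a rate \<Rightarrow> real \<Rightarrow> ('a \<Rightarrow> real) \<Rightarrow> 'a option rate" where
  "f_transform M q c f x s \<Gamma> =
     transform_off M q c f x s (\<Gamma> - {x}) -
     (if x \<in> \<Gamma> then transform_off M q c f x s (space (adjoin M) - {x}) else 0)"

end

(* The n-th summand of the transition function, integrated against a function h of the final state,
   is E[h(x_n); t_n <= t < t_{n+1}], so summing over n gives E[h(X_t)], and nonexplosion means that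
   the total mass is always 1.  For the transformed rates, every path term into S is the
   original one times exp(-c(t-s)) f(y)/f(x), and a path ends in delta by a single jump there at some
   time v, at rate g(y,v) = c - (q f)(y,v)/f(y).  Hence the total mass at time t, multiplied by f(x), is
     exp(-ct) E[f(X_t)] + int_0^t exp(-cv) E[(c f - q f)(X_v,v)] dv <= f(x),
   and integration by parts against exp(-ct) or exp(ct) shows that equality for all t is equivalent to
   Dynkin's formula.  The inequality supplies the integrability that this needs. *)
theory Submission
  imports Defs
begin

section \<open>Measures given by positive functionals\<close>

text \<open>The jump rates are merely measurable in time, so nothing can be differentiated along a
  path: the survival identity rests on a quadratic bound for increments, and integration by parts on
  Fubini over a triangle. The next-jump law and the off-diagonal part of q^f are given as set
  functions built from iterated integrals. They are treated as positive functionals that commute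
  with increasing limits, which yields the measure and its integrals at once. The processes of q on
  S and of q^f on \<open>adjoin M\<close> share one development, \<open>jump_rate\<close>, which
  sees only off-diagonal measures and exit rates. Since the deleted point moves with x, joint
  measurability of \<open>off_diag\<close> takes a countable separating family, supplied by the
  Borel structure of S. Path terms are formed with test functions that may depend on the terminal
  time, because the rate of jumping to delta does. The bound by f(x) is obtained probabilistically:
  the mass of the transformed transition function at time t is the probability that the transformed
  process has not exploded by t. It makes E[f(X_t)] finite for every t, but E[(c f - q f)(X_v,v)]
  finite only for almost every v.\<close>

lemma functional_representation:
  fixes \<Phi> :: "('b \<Rightarrow> ennreal) \<Rightarrow> ennreal"
  assumes cong: "\<And>g h. (\<And>x. x \<in> space N \<Longrightarrow> g x = h x) \<Longrightarrow> \<Phi> g = \<Phi> h"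
    and add: "\<And>g h. g \<in> borel_measurable N \<Longrightarrow> h \<in> borel_measurable N \<Longrightarrow>
      \<Phi> (\<lambda>x. g x + h x) = \<Phi> g + \<Phi> h"
    and cmult: "\<And>c g. g \<in> borel_measurable N \<Longrightarrow> \<Phi> (\<lambda>x. c * g x) = c * \<Phi> g"
    and sup: "\<And>U :: nat \<Rightarrow> 'b \<Rightarrow> ennreal. (\<And>i. U i \<in> borel_measurable N) \<Longrightarrow> incseq U \<Longrightarrow>
      \<Phi> (\<lambda>x. SUP i. U i x) = (SUP i. \<Phi> (U i))"
  shows emeasure_functional_representation: "A \<in> sets N \<Longrightarrow>
      emeasure (measure_of (space N) (sets N) (\<lambda>A. \<Phi> (indicator A))) A = \<Phi> (indicator A)"
    and nn_integral_functional_representation: "g \<in> borel_measurable N \<Longrightarrow>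
      (\<integral>\<^sup>+x. g x \<partial>measure_of (space N) (sets N) (\<lambda>A. \<Phi> (indicator A))) = \<Phi> g"
proof -
  let ?L = "measure_of (space N) (sets N) (\<lambda>A. \<Phi> (indicator A))"
  have sets_L[measurable_cong]: "sets ?L = sets N" and space_L: "space ?L = space N"
    by (simp_all add: sets.space_closed sets.sigma_sets_eq)
  have zero: "\<Phi> (\<lambda>_. 0) = 0"
    using cmult[of "\<lambda>_. 0" 0] by simp
  have sum: "\<Phi> (\<lambda>x. \<Sum>i<n. g i x) = (\<Sum>i<n. \<Phi> (g i))"
    if [measurable]: "\<And>i. g i \<in> borel_measurable N" for g :: "nat \<Rightarrow> 'b \<Rightarrow> ennreal" and n
    by (induction n) (simp_all add: zero add)
  \<comment> \<open>\<open>measure_of\<close> yields the null measure unless its set function is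
    countably additive, so additivity must come before any evaluation. It is \<open>sup\<close>
    applied to the partial sums of indicators.\<close>
  have em: "emeasure ?L A = \<Phi> (indicator A)" if "A \<in> sets N" for A
  proof (rule emeasure_measure_of_sigma[OF sets.sigma_algebra_axioms])
    show "positive (sets N) (\<lambda>A. \<Phi> (indicator A))"
      using zero by (simp add: positive_def indicator_def[abs_def])
    show "countably_additive (sets N) (\<lambda>A. \<Phi> (indicator A))"
    proof (rule countably_additiveI)
      fix A :: "nat \<Rightarrow> 'b set"
      assume A: "range A \<subseteq> sets N" "disjoint_family A" "(\<Union>i. A i) \<in> sets N"
      then have [measurable]: "\<And>i. A i \<in> sets N"
        by auto
      have "\<Phi> (indicator (\<Union>i. A i)) = \<Phi> (\<lambda>x. SUP n. \<Sum>i<n. indicator (A i) x)"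
        by (intro cong) (simp add: suminf_indicator[OF A(2), symmetric] suminf_eq_SUP)
      also have "\<dots> = (SUP n. \<Phi> (\<lambda>x. \<Sum>i<n. indicator (A i) x))"
        by (rule sup) (auto simp: incseq_def le_fun_def intro!: sum_mono2)
      also have "\<dots> = (\<Sum>i. \<Phi> (indicator (A i)))"
        by (simp add: sum suminf_eq_SUP)
      finally show "(\<Sum>i. \<Phi> (indicator (A i))) = \<Phi> (indicator (\<Union>i. A i))" ..
    qed
  qed fact
  show "emeasure ?L A = \<Phi> (indicator A)" if "A \<in> sets N" for A
    by (fact em[OF that])
  assume "g \<in> borel_measurable N"
  then show "(\<integral>\<^sup>+x. g x \<partial>?L) = \<Phi> g"
  proof (induction rule: borel_measurable_induct)
    case (cong f g)
    have "integral\<^sup>N ?L f = integral\<^sup>N ?L g"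
      using cong(3) by (intro nn_integral_cong) (simp add: space_L)
    with cong(3,4) assms(1)[of f g] show ?case
      by simp
  next
    case (set A)
    then show ?case
      using sets_L em by simp
  next
    case (mult u c)
    then show ?case
      by (simp add: nn_integral_cmult cmult measurable_cong_sets[OF sets_L refl])
  next
    case (add u v)
    then show ?case
      by (simp add: nn_integral_add assms(2) measurable_cong_sets[OF sets_L refl])
  next
    case (seq U)
    have "(\<integral>\<^sup>+x. (SUP i. U i x) \<partial>?L) = (SUP i. \<integral>\<^sup>+x. U i x \<partial>?L)"
      using seq by (intro nn_integral_monotone_convergence_SUP)
        (auto simp: measurable_cong_sets[OF sets_L refl])
    also have "\<dots> = \<Phi> (\<lambda>x. SUP i. U i x)"
      using seq by (simp add: sup)
    finally show ?case
      by (simp add: image_comp SUP_apply[abs_def])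
  qed
qed

text \<open>Dividing by the total mass turns a finite kernel into a subprobability kernel, for which
  measurability of integrals is known; the mass is multiplied back afterwards.\<close>

lemma measurable_nn_integral_finite_kernel:
  assumes sets: "\<And>w. w \<in> space W \<Longrightarrow> sets (\<kappa> w) = sets N"
    and meas: "\<And>A. A \<in> sets N \<Longrightarrow> (\<lambda>w. emeasure (\<kappa> w) A) \<in> borel_measurable W"
    and fin: "\<And>w. w \<in> space W \<Longrightarrow> emeasure (\<kappa> w) (space N) < \<infinity>"
    and g[measurable]: "(\<lambda>(w, y). g w y) \<in> borel_measurable (W \<Otimes>\<^sub>M N)"
    and ne: "space N \<noteq> {}"
  shows "(\<lambda>w. \<integral>\<^sup>+y. g w y \<partial>\<kappa> w) \<in> borel_measurable W"
proof -
  define m where "m w = emeasure (\<kappa> w) (space N)" for w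
  have [measurable]: "m \<in> borel_measurable W"
    unfolding m_def by (rule meas) simp
  \<comment> \<open>Where \<open>m w = 0\<close> the factor is infinite, but \<kappa> w is null
    there, so \<open>K w\<close> is null as well and both integrals vanish.\<close>
  define K where "K w = scale_measure (1 / m w) (\<kappa> w)" for w
  have [measurable]: "K \<in> measurable W (subprob_algebra N)"
  proof (rule measurable_subprob_algebra)
    fix w assume w: "w \<in> space W"
    show "sets (K w) = sets N"
      using w by (simp add: K_def sets)
    show "subprob_space (K w)"
    proof -
      have "m w / m w \<le> 1"
        using fin[OF w] by (cases "m w = 0") (auto simp: m_def ennreal_divide_self top.not_eq_extremum)
      then show ?thesis
        using ne sets_eq_imp_space_eq[OF sets[OF w]]
        by (intro subprob_spaceI)
           (auto simp: K_def space_scale_measure m_def ennreal_times_divide mult.commute)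
    qed
  next
    fix A assume [measurable]: "A \<in> sets N"
    note meas[measurable]
    show "(\<lambda>w. emeasure (K w) A) \<in> borel_measurable W"
      unfolding K_def by simp
  qed
  have "(\<lambda>w. m w * (\<integral>\<^sup>+y. g w y \<partial>K w)) \<in> borel_measurable W"
    by (intro borel_measurable_times_ennreal nn_integral_measurable_subprob_algebra2[where N=N] g) measurable
  also have "?this \<longleftrightarrow> ?thesis"
  proof (rule measurable_cong)
    fix w assume w: "w \<in> space W"
    have gw: "g w \<in> borel_measurable (\<kappa> w)"
      using w by (subst measurable_cong_sets[OF sets refl]) auto
    show "m w * (\<integral>\<^sup>+y. g w y \<partial>K w) = (\<integral>\<^sup>+y. g w y \<partial>\<kappa> w)"
    proof (cases "m w = 0")
      case True
      then have "AE y in \<kappa> w. g w y = 0"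
        using sets[OF w] sets_eq_imp_space_eq[OF sets[OF w]]
        by (intro AE_I[where N="space (\<kappa> w)"]) (auto simp: m_def)
      then have "(\<integral>\<^sup>+y. g w y \<partial>\<kappa> w) = 0"
        using nn_integral_0_iff_AE[OF gw] by simp
      with True show ?thesis by simp
    next
      case False
      then have "m w * (1 / m w) = 1"
        using fin[OF w] by (simp add: ennreal_times_divide ennreal_divide_self m_def top.not_eq_extremum)
      then show ?thesis
        using gw by (simp add: K_def nn_integral_scale_measure mult.assoc[symmetric])
    qed
  qed
  finally show ?thesis .
qed

section \<open>Adjoining an isolated point\<close>

lemma space_adjoin: "space (adjoin M) = insert None (Some ` space M)"
  unfolding adjoin_def by (rule space_measure_of) auto

text \<open>The generating family is already a sigma-algebra, so membership is decided by the trace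
  on \<open>M\<close> alone; \<open>None\<close> is measurable on its own.\<close>

lemma sets_adjoin: "sets (adjoin M) =
  {\<Gamma>. \<Gamma> \<subseteq> insert None (Some ` space M) \<and> {y \<in> space M. Some y \<in> \<Gamma>} \<in> sets M}"
proof -
  let ?\<Omega> = "insert None (Some ` space M)"
  let ?A = "{\<Gamma>. \<Gamma> \<subseteq> ?\<Omega> \<and> {y \<in> space M. Some y \<in> \<Gamma>} \<in> sets M}"
  have "sigma_algebra ?\<Omega> ?A"
  proof (unfold sigma_algebra_iff2, intro conjI ballI allI impI)
    fix \<Gamma> assume "\<Gamma> \<in> ?A"
    moreover have "{y \<in> space M. Some y \<in> ?\<Omega> - \<Gamma>} = space M - {y \<in> space M. Some y \<in> \<Gamma>}"
      by auto
    ultimately show "?\<Omega> - \<Gamma> \<in> ?A"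
      by (auto simp: sets.compl_sets)
  next
    fix A :: "nat \<Rightarrow> 'a option set" assume A: "range A \<subseteq> ?A"
    have "{y \<in> space M. Some y \<in> (\<Union>i. A i)} = (\<Union>i. {y \<in> space M. Some y \<in> A i})"
      by auto
    with A show "(\<Union>i. A i) \<in> ?A"
      by (auto intro!: sets.countable_UN)
  qed auto
  then show ?thesis
    unfolding adjoin_def by (rule sigma_algebra.sets_measure_of_eq)
qed

lemma measurable_Some[measurable]: "Some \<in> measurable M (adjoin M)"
proof (rule measurableI)
  fix A assume "A \<in> sets (adjoin M)"
  moreover have "Some -` A \<inter> space M = {y \<in> space M. Some y \<in> A}"
    by auto
  ultimately show "Some -` A \<inter> space M \<in> sets M"
    by (simp add: sets_adjoin)
qed (simp add: space_adjoin)

lemma measurable_adjoinI: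
  assumes "(\<lambda>y. g (Some y)) \<in> measurable M N" and "g None \<in> space N"
  shows "g \<in> measurable (adjoin M) N"
proof (rule measurableI)
  fix A assume "A \<in> sets N"
  from measurable_sets[OF assms(1) this]
  have "{y \<in> space M. Some y \<in> g -` A \<inter> space (adjoin M)} \<in> sets M"
    by (rule back_subst[of "\<lambda>B. B \<in> sets M"]) (auto simp: space_adjoin)
  then show "g -` A \<inter> space (adjoin M) \<in> sets (adjoin M)"
    by (auto simp: sets_adjoin space_adjoin)
qed (use assms in \<open>auto simp: space_adjoin dest: measurable_space\<close>)

lemma measurable_adjoin_pairI:
  assumes some: "(\<lambda>(y, w). g (Some y) w) \<in> measurable (M \<Otimes>\<^sub>M W) N"
    and none: "g None \<in> measurable W N" and "space M \<noteq> {}"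
  shows "(\<lambda>(x, w). g x w) \<in> measurable (adjoin M \<Otimes>\<^sub>M W) N"
proof -
  obtain y0 where y0: "y0 \<in> space M"
    using assms by auto
  \<comment> \<open>A measurable retraction onto \<open>M\<close>. Its arbitrary value at
    \<open>None\<close> is discarded by the case distinction on \<open>fst p = None\<close>
    below.\<close>
  define d where "d x = (case x of None \<Rightarrow> y0 | Some y \<Rightarrow> y)" for x
  have [measurable]: "d \<in> measurable (adjoin M) M"
    by (rule measurable_adjoinI) (auto simp: d_def y0)
  have [measurable]: "Measurable.pred (adjoin M) (\<lambda>x. x = None)"
    by (rule measurable_adjoinI) auto
  have "(\<lambda>p. (\<lambda>(y, w). g (Some y) w) (d (fst p), snd p)) \<in> measurable (adjoin M \<Otimes>\<^sub>M W) N"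
    by (rule measurable_compose[OF _ some]) measurable
  then have "(\<lambda>p. if fst p = None then g None (snd p) else (\<lambda>(y, w). g (Some y) w) (d (fst p), snd p))
      \<in> measurable (adjoin M \<Otimes>\<^sub>M W) N"
    by (rule measurable_If[OF measurable_compose[OF measurable_snd none]]) measurable
  also have "(\<lambda>p. if fst p = None then g None (snd p) else (\<lambda>(y, w). g (Some y) w) (d (fst p), snd p))
      = (\<lambda>(x, w). g x w)"
    by (auto simp: fun_eq_iff d_def split: option.splits)
  finally show ?thesis .
qed

section \<open>Two integral identities on intervals\<close>

lemma set_integrable_bounded_Icc:
  fixes f :: "real \<Rightarrow> real"
  assumes "f \<in> borel_measurable borel" and "\<And>u. \<bar>f u\<bar> \<le> B"
  shows "set_integrable lborel {a..b} f"
  unfolding set_integrable_def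
  by (rule integrableI_bounded_set_indicator[where B=B]) (use assms in \<open>auto simp: emeasure_lborel_Icc_eq\<close>)

text \<open>The difference of the two sides varies by at most \<open>B\<^sup>2 (v - u)\<^sup>2\<close> over \<open>[u, v]\<close>, so it has
  derivative zero although \<open>r\<close> is only measurable.\<close>

lemma nn_integral_survival:
  fixes r :: "real \<Rightarrow> real"
  assumes [measurable]: "r \<in> borel_measurable borel"
    and r0: "\<And>u. 0 \<le> r u" and rB: "\<And>u. r u \<le> B" and "s \<le> t"
  shows "(\<integral>\<^sup>+u\<in>{s..t}. ennreal (exp (- (LINT v:{s..u}|lborel. r v)) * r u) \<partial>lborel) =
    ennreal (1 - exp (- (LINT v:{s..t}|lborel. r v)))"
proof -
  define \<Phi> where "\<Phi> u = (LINT v:{s..u}|lborel. r v)" for u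
  have int: "set_integrable lborel {a..b} r" for a b
    by (rule set_integrable_bounded_Icc[where B=B]) (use r0 rB in \<open>auto simp: abs_of_nonneg\<close>)
  have \<Phi>_split: "\<Phi> v = \<Phi> u + (LINT w:{u..v}|lborel. r w)" if "s \<le> u" "u \<le> v" for u v
  proof -
    have "\<Phi> v = (LINT w:{s..u}|lborel. r w) + (LINT w:{u<..v}|lborel. r w)"
      unfolding \<Phi>_def using that
      by (subst set_integral_Un[symmetric])
         (auto simp: ivl_disj_un intro!: set_integrable_subset[OF int[of s v]])
    also have "(LINT w:{u<..v}|lborel. r w) = (LINT w:{u..v}|lborel. r w)"
      unfolding set_lebesgue_integral_def
      by (intro integral_cong_AE) (auto simp: indicator_def intro!: AE_I[where N="{u}"])
    finally show ?thesis by (simp add: \<Phi>_def)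
  qed
  have int_le: "0 \<le> (LINT w:{u..v}|lborel. r w)" "(LINT w:{u..v}|lborel. r w) \<le> B * (v - u)"
    if "u \<le> v" for u v
  proof -
    have "(LINT w:{u..v}|lborel. r w) \<le> (LINT w:{u..v}|lborel. B)"
      by (rule set_integral_mono) (use int rB in \<open>auto intro!: set_integrable_bounded_Icc\<close>)
    then show "(LINT w:{u..v}|lborel. r w) \<le> B * (v - u)"
      using that by (simp add: set_lebesgue_integral_def mult.commute)
    show "0 \<le> (LINT w:{u..v}|lborel. r w)"
      unfolding set_lebesgue_integral_def by (intro integral_nonneg_AE) (auto simp: r0)
  qed
  have mono: "\<Phi> u \<le> \<Phi> v" if "u \<le> v" for u v
  proof (cases "s \<le> u")
    case True
    then show ?thesis using \<Phi>_split[OF True that] int_le[OF that] by simp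
  next
    case False
    then have "\<Phi> u = 0" by (simp add: \<Phi>_def set_lebesgue_integral_def)
    then show ?thesis using int_le[of s v] by (cases "s \<le> v") (auto simp: \<Phi>_def set_lebesgue_integral_def)
  qed
  have [measurable]: "\<Phi> \<in> borel_measurable borel"
    by (rule borel_measurable_mono) (auto simp: mono_def mono)
  have \<Phi>0: "0 \<le> \<Phi> u" for u
    using int_le(1)[of s u] by (cases "s \<le> u") (auto simp: \<Phi>_def set_lebesgue_integral_def)
  let ?g = "\<lambda>u. exp (- \<Phi> u) * r u"
  have g0: "0 \<le> ?g u" for u
    by (simp add: r0)
  have gB: "?g u \<le> B" for u
    using mult_mono[of "exp (- \<Phi> u)" 1 "r u" B] r0[of u] rB[of u] \<Phi>0[of u] by auto
  have gint: "set_integrable lborel {a..b} ?g" for a b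
    by (rule set_integrable_bounded_Icc[where B=B]) (use g0 gB in \<open>auto simp: abs_of_nonneg\<close>)
  \<comment> \<open>\<open>D s = 1\<close>, so the claim is that \<open>D\<close> is constant on
    \<open>{s..t}\<close>.\<close>
  define D where "D u = (LINT w:{s..u}|lborel. ?g w) + exp (- \<Phi> u)" for u
  have D_step: "\<bar>D v - D u\<bar> \<le> (B * (v - u))\<^sup>2" if uv: "s \<le> u" "u \<le> v" for u v
  proof -
    let ?I = "LINT w:{u..v}|lborel. r w" and ?J = "LINT w:{u..v}|lborel. ?g w"
    have "D v = (LINT w:{s..u}|lborel. ?g w) + (LINT w:{u<..v}|lborel. ?g w) + exp (- \<Phi> v)"
      unfolding D_def using that
      by (subst set_integral_Un[symmetric])
         (auto simp: ivl_disj_un intro!: set_integrable_subset[OF gint[of s v]])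
    also have "(LINT w:{u<..v}|lborel. ?g w) = ?J"
      unfolding set_lebesgue_integral_def
      by (intro integral_cong_AE) (auto simp: indicator_def intro!: AE_I[where N="{u}"])
    finally have Dv: "D v - D u = ?J - (exp (- \<Phi> u) - exp (- \<Phi> v))"
      by (simp add: D_def)
    \<comment> \<open>Both \<open>?J\<close> and the decrease of exp(-\<Phi>) over
      \<open>{u..v}\<close> lie between exp(-\<Phi> v) ?I and exp(-\<Phi> u) ?I: the former because
      \<Phi> is monotone, the latter by 1 + y \<le> exp y. Hence they differ by at most the length
      of that interval, which is of second order in v - u.\<close>
    have "?J \<le> (LINT w:{u..v}|lborel. exp (- \<Phi> u) * r w)"
      by (rule set_integral_mono) (use gint int r0 mono in \<open>auto intro!: mult_right_mono\<close>)
    then have J1: "?J \<le> exp (- \<Phi> u) * ?I" by simp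
    have "(LINT w:{u..v}|lborel. exp (- \<Phi> v) * r w) \<le> ?J"
      by (rule set_integral_mono) (use gint int r0 mono in \<open>auto intro!: mult_right_mono\<close>)
    then have J2: "exp (- \<Phi> v) * ?I \<le> ?J" by simp
    have I: "?I = \<Phi> v - \<Phi> u"
      using \<Phi>_split[OF uv] by simp
    have "1 - ?I \<le> exp (- ?I)"
      using exp_ge_add_one_self[of "- ?I"] by simp
    then have "exp (- \<Phi> u) * (1 - ?I) \<le> exp (- \<Phi> u) * exp (- ?I)"
      by (rule mult_left_mono) simp
    also have "\<dots> = exp (- \<Phi> v)"
      by (simp add: I exp_add[symmetric])
    finally have E1: "exp (- \<Phi> u) - exp (- \<Phi> v) \<le> exp (- \<Phi> u) * ?I"
      by (simp add: algebra_simps)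
    have "exp (- \<Phi> v) * (1 + ?I) \<le> exp (- \<Phi> v) * exp ?I"
      by (rule mult_left_mono) (auto simp: add.commute)
    also have "\<dots> = exp (- \<Phi> u)"
      by (simp add: I exp_add[symmetric])
    finally have E2: "exp (- \<Phi> v) * ?I \<le> exp (- \<Phi> u) - exp (- \<Phi> v)"
      by (simp add: algebra_simps)
    have "\<bar>D v - D u\<bar> \<le> (exp (- \<Phi> u) - exp (- \<Phi> v)) * ?I"
      using J1 J2 E1 E2 by (simp add: Dv abs_le_iff algebra_simps)
    also have "\<dots> \<le> (exp (- \<Phi> u) * ?I) * ?I"
      using E1 int_le(1)[OF uv(2)] by (rule mult_right_mono)
    also have "\<dots> \<le> (1 * ?I) * ?I"
      using int_le(1)[OF uv(2)] \<Phi>0[of u] by (intro mult_right_mono) auto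
    also have "\<dots> \<le> (B * (v - u))\<^sup>2"
      using int_le[OF uv(2)] by (simp add: power2_eq_square mult_mono)
    finally show ?thesis .
  qed
  have "(D has_real_derivative 0) (at u within {s..t})" if "u \<in> {s..t}" for u
    unfolding has_field_derivative_iff
  proof (rule Lim_null_comparison)
    have "norm ((D v - D u) / (v - u)) \<le> B\<^sup>2 * \<bar>v - u\<bar>" if "v \<in> {s..t}" "v \<noteq> u" for v
    proof -
      have "\<bar>D v - D u\<bar> \<le> (B * (v - u))\<^sup>2"
        using D_step[of u v] D_step[of v u] that \<open>u \<in> {s..t}\<close>
        by (cases "u \<le> v") (auto simp: abs_minus_commute power2_commute[of u] power_mult_distrib)
      also have "\<dots> = B\<^sup>2 * \<bar>v - u\<bar> * \<bar>v - u\<bar>"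
        by (simp add: power2_eq_square)
      finally show ?thesis
        using that by (simp add: divide_le_eq)
    qed
    then show "\<forall>\<^sub>F v in at u within {s..t}. norm ((D v - D u) / (v - u)) \<le> B\<^sup>2 * \<bar>v - u\<bar>"
      by (auto simp: eventually_at_filter)
    show "((\<lambda>v. B\<^sup>2 * \<bar>v - u\<bar>) \<longlongrightarrow> 0) (at u within {s..t})"
      by (auto intro!: tendsto_eq_intros)
  qed
  moreover have null: "(LINT w:{s}|lborel. h w) = 0" for h :: "real \<Rightarrow> real"
    unfolding set_lebesgue_integral_def
    by (rule integral_eq_zero_AE, rule AE_I[where N="{s}"]) (auto simp: indicator_def)
  ultimately have "D t = D s"
    using has_field_derivative_zero_constant[of "{s..t}" D] \<open>s \<le> t\<close> by auto
  then have D: "(LINT w:{s..t}|lborel. ?g w) = 1 - exp (- \<Phi> t)"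
    using null by (simp add: D_def \<Phi>_def)
  have "(\<integral>\<^sup>+u\<in>{s..t}. ennreal (?g u) \<partial>lborel) = ennreal (LINT w:{s..t}|lborel. ?g w)"
    unfolding set_lebesgue_integral_def
    by (subst nn_integral_eq_integral[symmetric])
       (use gint[of s t] g0 in \<open>auto simp: set_integrable_def intro!: nn_integral_cong split: split_indicator\<close>)
  then show ?thesis
    unfolding D unfolding \<Phi>_def .
qed

lemma set_integrable_exp_mult:
  fixes u :: "real \<Rightarrow> real"
  assumes "set_integrable lborel {0..t} u"
  shows "set_integrable lborel {0..t} (\<lambda>r. exp (k * r) * u r)"
proof -
  let ?u = "\<lambda>r. indicator {0..t} r * u r"
  have ui: "integrable lborel ?u"
    using assms by (simp add: set_integrable_def)
  then have [measurable]: "?u \<in> borel_measurable borel"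
    using borel_measurable_integrable by fastforce
  have "integrable lborel (\<lambda>r. exp (k * r) * ?u r)"
  proof (rule Bochner_Integration.integrable_bound)
    show "integrable lborel (\<lambda>r. exp (\<bar>k\<bar> * t) * ?u r)"
      using ui by simp
    have "k * r \<le> \<bar>k\<bar> * t" if "0 \<le> r" "r \<le> t" for r
      using mult_mono[of "\<bar>k\<bar>" "\<bar>k\<bar>" r t] mult_right_mono[of k "\<bar>k\<bar>" r] abs_ge_self[of k] that
      by linarith
    then show "AE r in lborel. norm (exp (k * r) * ?u r) \<le> norm (exp (\<bar>k\<bar> * t) * ?u r)"
      by (auto simp: abs_mult indicator_def intro!: mult_right_mono)
  qed measurable
  then show ?thesis
    by (simp add: set_integrable_def mult.left_commute)
qed

text \<open>Since \<open>W\<close> is only the primitive of an integrable function, its integral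
  form is inserted and Fubini is applied on the triangle r \<le> s \<le> t; the inner integral of k
  exp(k s) over [r,t] is exp(k t) - exp(k r). Keeping the factor k on the left avoids division and
  covers k = 0.\<close>

lemma integral_by_parts_exp:
  fixes u :: "real \<Rightarrow> real"
  assumes u: "set_integrable lborel {0..t} u" and "0 \<le> t"
    and W: "\<And>s. 0 \<le> s \<Longrightarrow> s \<le> t \<Longrightarrow> W s = w0 + (LINT r:{0..s}|lborel. u r)"
  shows "(LINT s:{0..t}|lborel. k * exp (k * s) * W s) =
    exp (k * t) * W t - w0 - (LINT s:{0..t}|lborel. exp (k * s) * u s)"
proof -
  have FTC: "(LINT s:{a..b}|lborel. k * exp (k * s)) = exp (k * b) - exp (k * a)" if "a \<le> b" for a b
    unfolding set_lebesgue_integral_def real_scaleR_def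
    by (subst mult.commute, rule integral_FTC_Icc_real[OF that, of "\<lambda>s. exp (k * s)"])
       (auto intro!: derivative_eq_intros continuous_intros)
  let ?u = "\<lambda>r. indicator {0..t} r * u r" and ?e = "\<lambda>s. indicator {0..t} s * (k * exp (k * s))"
  let ?I = "indicator {p :: real \<times> real. snd p \<le> fst p} :: _ \<Rightarrow> real"
  have ui: "integrable lborel ?u"
    using u by (simp add: set_integrable_def)
  have [measurable]: "?u \<in> borel_measurable borel"
    using borel_measurable_integrable[OF ui] by simp
  have ei: "integrable lborel ?e"
    by (rule borel_integrable_atLeastAtMost'[of 0 t "\<lambda>s. k * exp (k * s)",
          unfolded set_integrable_def real_scaleR_def]) (intro continuous_intros)
  have "{p \<in> space (borel \<Otimes>\<^sub>M borel). snd p \<le> (fst p :: real)} \<in> sets (borel \<Otimes>\<^sub>M borel)"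
    by measurable
  then have triangle: "{p. snd p \<le> (fst p :: real)} \<in> sets (borel \<Otimes>\<^sub>M borel)"
    by (simp add: space_pair_measure)
  have eui: "integrable lborel (\<lambda>r. exp (k * r) * ?u r)"
    using set_integrable_exp_mult[OF u, of k] by (simp add: set_integrable_def mult.left_commute)
  have "integrable (lborel \<Otimes>\<^sub>M lborel) (\<lambda>(s, r). ?e s * ?u r)"
  proof (rule lborel_pair.Fubini_integrable)
    show "integrable lborel (\<lambda>s. LINT r|lborel. norm (case (s, r) of (s, r) \<Rightarrow> ?e s * ?u r))"
      using integrable_norm[OF ei] by (simp add: abs_mult)
    show "AE s in lborel. integrable lborel (\<lambda>r. case (s, r) of (s, r) \<Rightarrow> ?e s * ?u r)"
      using ui by simp
  qed measurable
  then have "integrable (lborel \<Otimes>\<^sub>M lborel) (\<lambda>p. ?I p *\<^sub>R (\<lambda>(s, r). ?e s * ?u r) p)"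
    by (rule integrable_mult_indicator[rotated])
       (simp add: triangle)
  also have "(\<lambda>p. ?I p *\<^sub>R (\<lambda>(s, r). ?e s * ?u r) p) = (\<lambda>(s, r). ?I (s, r) * (?e s * ?u r))"
    by auto
  finally have pair: "integrable (lborel \<Otimes>\<^sub>M lborel) (\<lambda>(s, r). ?I (s, r) * (?e s * ?u r))" .
  then have swap: "(LINT r|lborel. LINT s|lborel. ?I (s, r) * (?e s * ?u r)) =
    (LINT s|lborel. LINT r|lborel. ?I (s, r) * (?e s * ?u r))"
    by (rule lborel_pair.Fubini_integral)
  have "(LINT s:{0..t}|lborel. k * exp (k * s) * W s) =
    (LINT s|lborel. w0 * ?e s + (LINT r|lborel. ?I (s, r) * (?e s * ?u r)))"
    unfolding set_lebesgue_integral_def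
  proof (rule Bochner_Integration.integral_cong[OF refl])
    fix s
    show "indicator {0..t} s *\<^sub>R (k * exp (k * s) * W s) =
      w0 * ?e s + (LINT r|lborel. ?I (s, r) * (?e s * ?u r))"
    proof (cases "s \<in> {0..t}")
      case True
      have "(LINT r|lborel. ?I (s, r) * (?e s * ?u r)) =
        (LINT r|lborel. k * exp (k * s) * (indicator {0..s} r *\<^sub>R u r))"
        using True by (intro Bochner_Integration.integral_cong) (auto simp: indicator_def)
      also have "\<dots> = k * exp (k * s) * (LINT r:{0..s}|lborel. u r)"
        by (simp add: set_lebesgue_integral_def)
      finally show ?thesis
        using True W[of s] by (simp only:) (simp add: algebra_simps)
    qed simp
  qed
  also have "\<dots> = w0 * (LINT s|lborel. ?e s) + (LINT s|lborel. LINT r|lborel. ?I (s, r) * (?e s * ?u r))"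
    using ei lborel_pair.integrable_fst'[OF pair] by (subst Bochner_Integration.integral_add) auto
  also have "(LINT s|lborel. ?e s) = exp (k * t) - 1"
    using FTC[OF \<open>0 \<le> t\<close>] unfolding set_lebesgue_integral_def real_scaleR_def by simp
  also have "(LINT s|lborel. LINT r|lborel. ?I (s, r) * (?e s * ?u r)) =
    (LINT r|lborel. exp (k * t) * ?u r - exp (k * r) * ?u r)"
    unfolding swap[symmetric]
  proof (rule Bochner_Integration.integral_cong[OF refl])
    fix r
    show "(LINT s|lborel. ?I (s, r) * (?e s * ?u r)) = exp (k * t) * ?u r - exp (k * r) * ?u r"
    proof (cases "r \<in> {0..t}")
      case True
      have "(LINT s|lborel. ?I (s, r) * (?e s * ?u r)) =
        (LINT s|lborel. (indicator {r..t} s *\<^sub>R (k * exp (k * s))) * u r)"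
        using True by (intro Bochner_Integration.integral_cong) (auto simp: indicator_def)
      also have "\<dots> = (exp (k * t) - exp (k * r)) * u r"
        using FTC[of r t] True unfolding set_lebesgue_integral_def
        by (subst integral_mult_left_zero) auto
      finally show ?thesis
        using True by (simp only:) (simp add: algebra_simps)
    qed simp
  qed
  also have "\<dots> = exp (k * t) * (LINT r|lborel. ?u r) - (LINT r|lborel. exp (k * r) * ?u r)"
    using ui eui by (subst Bochner_Integration.integral_diff) auto
  also have "(LINT r|lborel. exp (k * r) * ?u r) = (LINT s:{0..t}|lborel. exp (k * s) * u s)"
    by (simp add: set_lebesgue_integral_def mult.left_commute)
  also have "(LINT r|lborel. ?u r) = W t - w0"
    using W[of t] \<open>0 \<le> t\<close> by (simp add: set_lebesgue_integral_def)
  finally show ?thesis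
    by (simp add: algebra_simps)
qed

section \<open>Transition functions\<close>

text \<open>The interface of the path construction: the signed kernel is replaced by its
  off-diagonal measures and its exit rate. It is instantiated for \<open>q\<close> and, under the
  prefix \<open>F\<close>, for the transformed rates.\<close>

locale jump_rate =
  fixes M :: "'a measure" and q :: "'a rate"
  assumes space_nonempty: "space M \<noteq> {}"
    and measurable_off_diag: "\<And>\<Gamma>. \<Gamma> \<in> sets M \<Longrightarrow>
      (\<lambda>(x, s). emeasure (off_diag M q x (max 0 s)) \<Gamma>) \<in> borel_measurable (M \<Otimes>\<^sub>M borel)"
    and emeasure_off_diag_space: "\<And>x s. x \<in> space M \<Longrightarrow> 0 \<le> s \<Longrightarrow>
      emeasure (off_diag M q x s) (space M) = ennreal (exit_rate q x s)"
    and exit_rate_nonneg: "\<And>x s. x \<in> space M \<Longrightarrow> 0 \<le> s \<Longrightarrow> 0 \<le> exit_rate q x s"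
    and exit_rate_bounded: "\<And>x. x \<in> space M \<Longrightarrow> \<exists>B. \<forall>s\<ge>0. exit_rate q x s \<le> B"
begin

text \<open>Rates at negative times are meaningless; they are replaced by those at time 0 so that all
  measurability statements can refer to the whole real line.\<close>

abbreviation Q :: "'a \<Rightarrow> real \<Rightarrow> 'a measure" where
  "Q x s \<equiv> off_diag M q x (max 0 s)"

definition rate :: "'a \<Rightarrow> real \<Rightarrow> real" where
  "rate x s = exit_rate q x (max 0 s)"

definition stay :: "'a \<Rightarrow> real \<Rightarrow> real \<Rightarrow> real" where
  "stay x s t = exp (- (LINT v:{s..t}|lborel. rate x v))"

text \<open>\<open>trans_term\<close> with the indicator of a set replaced by a test function
  \<open>H\<close>, evaluated at the terminal time. The time argument of \<open>H\<close> is what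
  later allows \<open>kill y v\<close>, whose rate varies with v, to be integrated along
  paths.\<close>

primrec T :: "nat \<Rightarrow> (real \<Rightarrow> 'a \<Rightarrow> ennreal) \<Rightarrow> real \<Rightarrow> 'a \<Rightarrow> real \<Rightarrow> ennreal" where
  "T 0 H s x t = H t x * ennreal (stay x s t)"
| "T (Suc n) H s x t =
     (\<integral>\<^sup>+u\<in>{s..t}. ennreal (stay x s u) * (\<integral>\<^sup>+z. T n H u z t \<partial>Q x u) \<partial>lborel)"

lemma sets_off_diag[simp, measurable_cong]: "sets (off_diag M q x s) = sets M"
  by (simp add: off_diag_def sets.space_closed sets.sigma_sets_eq)

lemma space_off_diag[simp]: "space (off_diag M q x s) = space M"
  by (rule sets_eq_imp_space_eq) simp

lemma rate_nonneg: "x \<in> space M \<Longrightarrow> 0 \<le> rate x s"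
  by (simp add: rate_def exit_rate_nonneg)

lemma emeasure_Q_space: "x \<in> space M \<Longrightarrow> emeasure (Q x s) (space M) = ennreal (rate x s)"
  by (simp add: rate_def emeasure_off_diag_space)

lemma rate_bounded:
  assumes "x \<in> space M"
  obtains B where "\<And>s. rate x s \<le> B"
proof -
  obtain B where "\<forall>s\<ge>0. exit_rate q x s \<le> B"
    using exit_rate_bounded[OF assms] by auto
  then show ?thesis
    by (intro that[of B]) (simp add: rate_def)
qed

lemma finite_measure_Q: "x \<in> space M \<Longrightarrow> finite_measure (Q x s)"
  by (rule finite_measureI) (simp add: emeasure_Q_space)

lemma measurable_emeasure_Q[measurable (raw)]:
  assumes f: "f \<in> measurable W M" and g: "g \<in> borel_measurable W" and "\<Gamma> \<in> sets M"
  shows "(\<lambda>w. emeasure (Q (f w) (g w)) \<Gamma>) \<in> borel_measurable W"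
  using measurable_compose[OF measurable_Pair[OF f g] measurable_off_diag[OF assms(3)]] by simp

lemma measurable_rate[measurable (raw)]:
  assumes [measurable]: "f \<in> measurable W M" "g \<in> borel_measurable W"
  shows "(\<lambda>w. rate (f w) (g w)) \<in> borel_measurable W"
proof -
  have "(\<lambda>w. enn2real (emeasure (Q (f w) (g w)) (space M))) \<in> borel_measurable W"
    by measurable
  also have "?this \<longleftrightarrow> ?thesis"
    using measurable_space[OF assms(1)]
    by (intro measurable_cong) (simp add: emeasure_Q_space rate_nonneg)
  finally show ?thesis .
qed

lemma measurable_stay[measurable (raw)]:
  assumes [measurable]: "f \<in> measurable W M" "g \<in> borel_measurable W" "h \<in> borel_measurable W"
  shows "(\<lambda>w. stay (f w) (g w) (h w)) \<in> borel_measurable W"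
proof -
  have "(\<lambda>(w, v). if g w \<le> v \<and> v \<le> h w then rate (f w) v else 0) \<in> borel_measurable (W \<Otimes>\<^sub>M lborel)"
    by measurable
  then have "(\<lambda>w. LINT v|lborel. (if g w \<le> v \<and> v \<le> h w then rate (f w) v else 0)) \<in> borel_measurable W"
    by (rule lborel.borel_measurable_lebesgue_integral)
  also have "(\<lambda>w. LINT v|lborel. (if g w \<le> v \<and> v \<le> h w then rate (f w) v else 0)) =
    (\<lambda>w. LINT v:{g w..h w}|lborel. rate (f w) v)"
    unfolding set_lebesgue_integral_def
    by (intro ext Bochner_Integration.integral_cong) (auto simp: indicator_def)
  finally show ?thesis
    unfolding stay_def by measurable
qed

lemma measurable_nn_integral_Q[measurable (raw)]:
  assumes [measurable]: "f \<in> measurable W M" "g \<in> borel_measurable W"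
    and "(\<lambda>(w, y). k w y) \<in> borel_measurable (W \<Otimes>\<^sub>M M)"
  shows "(\<lambda>w. \<integral>\<^sup>+y. k w y \<partial>Q (f w) (g w)) \<in> borel_measurable W"
  using measurable_space[OF assms(1)]
  by (intro measurable_nn_integral_finite_kernel[where N=M])
     (auto simp: emeasure_Q_space space_nonempty assms(3))

lemma measurable_T[measurable (raw)]:
  assumes [measurable]: "f \<in> borel_measurable W" "g \<in> measurable W M" "h \<in> borel_measurable W"
    and H: "(\<lambda>(t, y). H t y) \<in> borel_measurable (borel \<Otimes>\<^sub>M M)"
  shows "(\<lambda>w. T n H (f w) (g w) (h w)) \<in> borel_measurable W"
proof -
  have H'[measurable]: "(\<lambda>w. H (a w) (b w)) \<in> borel_measurable W"
    if "a \<in> borel_measurable W" "b \<in> measurable W M" for a b and W :: "'w measure"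
    using measurable_compose[OF measurable_Pair[OF that] H] by simp
  \<comment> \<open>The recursion integrates over a jump time and a new state, so the induction has
    to carry joint measurability in all three arguments.\<close>
  have *: "(\<lambda>(s, x, t). T n H s x t) \<in> borel_measurable (borel \<Otimes>\<^sub>M M \<Otimes>\<^sub>M borel)"
  proof (induction n)
    case 0
    show ?case
      unfolding T.simps by measurable
  next
    case (Suc n)
    have [measurable]: "(\<lambda>w. T n H (f w) (g w) (h w)) \<in> borel_measurable W"
      if [measurable]: "f \<in> borel_measurable W" "g \<in> measurable W M" "h \<in> borel_measurable W"
      for f g h and W :: "(((real \<times> 'a \<times> real) \<times> real) \<times> 'a) measure"
    proof -
      have "(\<lambda>w. (f w, g w, h w)) \<in> measurable W (borel \<Otimes>\<^sub>M M \<Otimes>\<^sub>M borel)"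
        by measurable
      from measurable_compose[OF this Suc] show ?thesis by simp
    qed
    have "(\<lambda>(p, u). if fst p \<le> u \<and> u \<le> snd (snd p) then
        ennreal (stay (fst (snd p)) (fst p) u) * (\<integral>\<^sup>+z. T n H u z (snd (snd p)) \<partial>Q (fst (snd p)) u) else 0)
      \<in> borel_measurable ((borel \<Otimes>\<^sub>M M \<Otimes>\<^sub>M borel) \<Otimes>\<^sub>M lborel)"
      by measurable
    then have "(\<lambda>p. \<integral>\<^sup>+u. (if fst p \<le> u \<and> u \<le> snd (snd p) then
        ennreal (stay (fst (snd p)) (fst p) u) * (\<integral>\<^sup>+z. T n H u z (snd (snd p)) \<partial>Q (fst (snd p)) u) else 0)
        \<partial>lborel)
      \<in> borel_measurable (borel \<Otimes>\<^sub>M M \<Otimes>\<^sub>M borel)"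
      by (rule lborel.borel_measurable_nn_integral)
    also have "(\<lambda>p. \<integral>\<^sup>+u. (if fst p \<le> u \<and> u \<le> snd (snd p) then
        ennreal (stay (fst (snd p)) (fst p) u) * (\<integral>\<^sup>+z. T n H u z (snd (snd p)) \<partial>Q (fst (snd p)) u) else 0)
        \<partial>lborel) = (\<lambda>(s, x, t). T (Suc n) H s x t)"
      by (auto simp: fun_eq_iff intro!: nn_integral_cong split: split_indicator)
    finally show ?case .
  qed
  have "(\<lambda>w. (f w, g w, h w)) \<in> measurable W (borel \<Otimes>\<^sub>M M \<Otimes>\<^sub>M borel)"
    by measurable
  from measurable_compose[OF this *] show ?thesis
    by simp
qed

lemma stay_prob_eq: "0 \<le> s \<Longrightarrow> stay_prob q x s t = stay x s t"
  unfolding stay_prob_def stay_def set_lebesgue_integral_def rate_def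
  by (intro arg_cong[where f=exp] arg_cong[where f=uminus] Bochner_Integration.integral_cong)
     (auto simp: indicator_def)

lemma trans_term_eq:
  "0 \<le> s \<Longrightarrow> trans_term M q n s x t \<Gamma> = T n (\<lambda>_. indicator \<Gamma>) s x t"
proof (induction n arbitrary: s x)
  case 0
  then show ?case by (simp add: stay_prob_eq)
next
  case (Suc n)
  then show ?case
    by (auto simp: stay_prob_eq max_def intro!: nn_integral_cong split: split_indicator)
qed

lemma T_cong:
  assumes "\<And>y. y \<in> space M \<Longrightarrow> H t y = H' t y" and "x \<in> space M"
  shows "T n H s x t = T n H' s x t"
  using assms(2)
proof (induction n arbitrary: s x)
  case (Suc n)
  then have "(\<integral>\<^sup>+z. T n H u z t \<partial>Q x u) = (\<integral>\<^sup>+z. T n H' u z t \<partial>Q x u)" for u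
    by (intro nn_integral_cong) simp
  then show ?case by simp
qed (simp add: assms(1))

lemma measurable_const_fun: "h \<in> borel_measurable M \<Longrightarrow> (\<lambda>(t::real, y). h y) \<in> borel_measurable (borel \<Otimes>\<^sub>M M)"
  unfolding split_beta' by (rule measurable_compose[OF measurable_snd])

lemma T_add:
  assumes [measurable]: "(\<lambda>(t, y). H t y) \<in> borel_measurable (borel \<Otimes>\<^sub>M M)"
    "(\<lambda>(t, y). H' t y) \<in> borel_measurable (borel \<Otimes>\<^sub>M M)" and "x \<in> space M"
  shows "T n (\<lambda>t y. H t y + H' t y) s x t = T n H s x t + T n H' s x t"
  using assms(3)
proof (induction n arbitrary: s x)
  case (Suc n)
  note [measurable] = Suc.prems
  have [measurable]: "(\<lambda>z. T n H u z t) \<in> borel_measurable M" "(\<lambda>z. T n H' u z t) \<in> borel_measurable M" for u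
    by measurable
  have "(\<integral>\<^sup>+z. T n (\<lambda>t y. H t y + H' t y) u z t \<partial>Q x u) =
      (\<integral>\<^sup>+z. T n H u z t + T n H' u z t \<partial>Q x u)" for u
    using Suc.IH by (intro nn_integral_cong) simp
  then have "(\<integral>\<^sup>+z. T n (\<lambda>t y. H t y + H' t y) u z t \<partial>Q x u) =
      (\<integral>\<^sup>+z. T n H u z t \<partial>Q x u) + (\<integral>\<^sup>+z. T n H' u z t \<partial>Q x u)" for u
    by (simp add: nn_integral_add)
  then have "T (Suc n) (\<lambda>t y. H t y + H' t y) s x t =
    (\<integral>\<^sup>+u. ennreal (stay x s u) * (\<integral>\<^sup>+z. T n H u z t \<partial>Q x u) * indicator {s..t} u +
      ennreal (stay x s u) * (\<integral>\<^sup>+z. T n H' u z t \<partial>Q x u) * indicator {s..t} u \<partial>lborel)"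
    by (simp add: algebra_simps)
  also have "\<dots> = T (Suc n) H s x t + T (Suc n) H' s x t"
    by (subst nn_integral_add) simp_all
  finally show ?case .
qed (simp add: algebra_simps)

lemma T_cmult:
  assumes [measurable]: "(\<lambda>(t, y). H t y) \<in> borel_measurable (borel \<Otimes>\<^sub>M M)" and "x \<in> space M"
  shows "T n (\<lambda>t y. c * H t y) s x t = c * T n H s x t"
  using assms(2)
proof (induction n arbitrary: s x)
  case (Suc n)
  note [measurable] = Suc.prems
  have "(\<integral>\<^sup>+z. T n (\<lambda>t y. c * H t y) u z t \<partial>Q x u) = (\<integral>\<^sup>+z. c * T n H u z t \<partial>Q x u)" for u
    using Suc.IH by (intro nn_integral_cong) simp
  then have "(\<integral>\<^sup>+z. T n (\<lambda>t y. c * H t y) u z t \<partial>Q x u) = c * (\<integral>\<^sup>+z. T n H u z t \<partial>Q x u)" for u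
    by (simp add: nn_integral_cmult)
  then have "T (Suc n) (\<lambda>t y. c * H t y) s x t =
    (\<integral>\<^sup>+u. c * (ennreal (stay x s u) * (\<integral>\<^sup>+z. T n H u z t \<partial>Q x u) * indicator {s..t} u) \<partial>lborel)"
    by (simp add: algebra_simps)
  also have "\<dots> = c * T (Suc n) H s x t"
    by (subst nn_integral_cmult) simp_all
  finally show ?case .
qed (simp add: algebra_simps)

end

section \<open>The law of the jump process\<close>

context jump_rate
begin

text \<open>The waiting-time density integrates to the probability of leaving \<open>x\<close>
  during \<open>{s..t}\<close>; this is the survival identity for the rate of a fixed state.\<close>

lemma nn_integral_stay_rate:
  assumes x: "x \<in> space M" and "s \<le> t"
  shows "(\<integral>\<^sup>+u\<in>{s..t}. ennreal (stay x s u) * ennreal (rate x u) \<partial>lborel) = ennreal (1 - stay x s t)"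
proof -
  note [measurable] = x
  obtain B where "\<And>s. rate x s \<le> B"
    using rate_bounded[OF x] by blast
  then have "(\<integral>\<^sup>+u\<in>{s..t}. ennreal (stay x s u * rate x u) \<partial>lborel) = ennreal (1 - stay x s t)"
    unfolding stay_def by (intro nn_integral_survival[OF _ _ _ \<open>s \<le> t\<close>]) (auto simp: rate_nonneg x)
  then show ?thesis
    by (simp add: ennreal_mult' stay_def)
qed

lemma stay_nonneg: "0 \<le> stay x s t"
  by (simp add: stay_def)

lemma stay_le_1: "x \<in> space M \<Longrightarrow> stay x s t \<le> 1"
  unfolding stay_def set_lebesgue_integral_def
  by (auto simp: rate_nonneg intro!: integral_nonneg_AE)

text \<open>The probability that there is another jump after time \<open>t\<close> from state
  \<open>x\<close>; the remainder goes to \<open>None\<close>.\<close>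

definition mass :: "real \<Rightarrow> 'a \<Rightarrow> ennreal" where
  "mass t x = (\<integral>\<^sup>+u\<in>{t<..}. ennreal (stay x t u) * ennreal (rate x u) \<partial>lborel)"

lemma mass_le_1:
  assumes x: "x \<in> space M"
  shows "mass t x \<le> 1"
proof -
  note [measurable] = x
  let ?k = "\<lambda>u. ennreal (stay x t u) * ennreal (rate x u)"
  \<comment> \<open>The half line is exhausted by the intervals \<open>{t..t + real n}\<close>, on
    each of which the density has mass 1 - \<open>stay\<close> \<le> 1.\<close>
  have "mass t x \<le> (\<integral>\<^sup>+u. (SUP n. ?k u * indicator {t..t + real n} u) \<partial>lborel)"
    unfolding mass_def
  proof (intro nn_integral_mono)
    fix u
    obtain n where "u \<le> t + real n"
      using real_arch_simple[of "u - t"] by (auto simp: algebra_simps)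
    then show "?k u * indicator {t<..} u \<le> (SUP n. ?k u * indicator {t..t + real n} u)"
      by (intro SUP_upper2[of n]) (auto split: split_indicator)
  qed
  also have "\<dots> = (SUP n. \<integral>\<^sup>+u. ?k u * indicator {t..t + real n} u \<partial>lborel)"
    by (intro nn_integral_monotone_convergence_SUP)
       (auto simp: incseq_def le_fun_def split: split_indicator)
  also have "\<dots> \<le> 1"
    by (intro SUP_least) (simp add: nn_integral_stay_rate x stay_nonneg)
  finally show ?thesis .
qed

text \<open>Expectation of \<open>g\<close> at the next pair, given the current pair (t,x). For
  \<open>t\<close> \<ge> 0 the truncation \<open>max 0 u\<close> changes nothing on
  \<open>{t<..}\<close>; it keeps the pair in \<open>jump_space M\<close> for every real
  \<open>u\<close>, as measurability arguments require.\<close>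

definition step :: "((real \<times> 'a) option \<Rightarrow> ennreal) \<Rightarrow> real \<Rightarrow> 'a \<Rightarrow> ennreal" where
  "step g t x = (\<integral>\<^sup>+u\<in>{t<..}. ennreal (stay x t u) * (\<integral>\<^sup>+y. g (Some (max 0 u, y)) \<partial>Q x u) \<partial>lborel) +
    g None * (1 - mass t x)"

lemma measurable_max_time: "f \<in> borel_measurable W \<Longrightarrow> (\<lambda>w. max 0 (f w :: real)) \<in> measurable W time_space"
  by (intro measurable_restrict_space2) auto

lemma measurable_Some_time[measurable (raw)]:
  assumes g: "g \<in> borel_measurable (jump_space M)"
    and f: "f \<in> borel_measurable W" and h: "h \<in> measurable W M"
  shows "(\<lambda>w. g (Some (max 0 (f w), h w))) \<in> borel_measurable W"
  by (intro measurable_compose[OF _ g] measurable_compose[OF _ measurable_Some] measurable_Pair h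
      measurable_max_time f)

lemma measurable_step[measurable (raw)]:
  assumes [measurable]: "g \<in> borel_measurable (jump_space M)" "f \<in> borel_measurable W" "h \<in> measurable W M"
  shows "(\<lambda>w. step g (f w) (h w)) \<in> borel_measurable W"
proof -
  have [measurable]: "(\<lambda>w. mass (f w) (h w)) \<in> borel_measurable W"
  proof -
    have "(\<lambda>w. \<integral>\<^sup>+u. (if f w < u then ennreal (stay (h w) (f w) u) * ennreal (rate (h w) u) else 0) \<partial>lborel)
      \<in> borel_measurable W"
      by measurable
    also have "(\<lambda>w. \<integral>\<^sup>+u. (if f w < u then ennreal (stay (h w) (f w) u) * ennreal (rate (h w) u) else 0) \<partial>lborel) =
      (\<lambda>w. mass (f w) (h w))"
      unfolding mass_def by (intro ext nn_integral_cong) (auto split: split_indicator)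
    finally show ?thesis .
  qed
  have [measurable]: "(\<lambda>w. \<integral>\<^sup>+u\<in>{f w<..}. ennreal (stay (h w) (f w) u) *
      (\<integral>\<^sup>+y. g (Some (max 0 u, y)) \<partial>Q (h w) u) \<partial>lborel) \<in> borel_measurable W"
  proof -
    have "(\<lambda>w. \<integral>\<^sup>+u. (if f w < u then ennreal (stay (h w) (f w) u) *
        (\<integral>\<^sup>+y. g (Some (max 0 u, y)) \<partial>Q (h w) u) else 0) \<partial>lborel)
      \<in> borel_measurable W"
      by measurable
    also have "(\<lambda>w. \<integral>\<^sup>+u. (if f w < u then ennreal (stay (h w) (f w) u) *
        (\<integral>\<^sup>+y. g (Some (max 0 u, y)) \<partial>Q (h w) u) else 0) \<partial>lborel) =
      (\<lambda>w. \<integral>\<^sup>+u\<in>{f w<..}. ennreal (stay (h w) (f w) u) *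
      (\<integral>\<^sup>+y. g (Some (max 0 u, y)) \<partial>Q (h w) u) \<partial>lborel)"
      by (intro ext nn_integral_cong) (auto split: split_indicator)
    finally show ?thesis .
  qed
  show ?thesis
    unfolding step_def by measurable
qed

lemma space_jump_space: "space (jump_space M) = insert None (Some ` ({0..} \<times> space M))"
  by (simp add: space_adjoin space_pair_measure)

lemma finite_jump_mass_eq:
  assumes "0 \<le> t" and x: "x \<in> space M" and [measurable]: "\<Gamma> \<in> sets (jump_space M)"
  shows "finite_jump_mass M q t x \<Gamma> =
    (\<integral>\<^sup>+u\<in>{t<..}. ennreal (stay x t u) * (\<integral>\<^sup>+y. indicator \<Gamma> (Some (max 0 u, y)) \<partial>Q x u) \<partial>lborel)"
  unfolding finite_jump_mass_def
proof (intro nn_integral_cong)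
  fix u
  have "(\<integral>\<^sup>+y. indicator \<Gamma> (Some (max 0 u, y)) \<partial>Q x u) = emeasure (Q x u) {y \<in> space M. Some (u, y) \<in> \<Gamma>}"
    if "t < u"
  proof -
    have "(\<lambda>y. indicator \<Gamma> (Some (max 0 u, y)) :: ennreal) \<in> borel_measurable M"
      by measurable
    then have "(\<lambda>y. indicator \<Gamma> (Some (max 0 u, y)) :: ennreal) -` {1} \<inter> space M \<in> sets M"
      by (rule measurable_sets) simp
    also have "(\<lambda>y. indicator \<Gamma> (Some (max 0 u, y)) :: ennreal) -` {1} \<inter> space M =
      {y \<in> space M. Some (u, y) \<in> \<Gamma>}"
      using that \<open>0 \<le> t\<close> by (auto simp: indicator_def max_def split: if_splits)
    finally have [measurable]: "{y \<in> space M. Some (u, y) \<in> \<Gamma>} \<in> sets M" .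
    have "(\<integral>\<^sup>+y. indicator \<Gamma> (Some (max 0 u, y)) \<partial>Q x u) =
      (\<integral>\<^sup>+y. indicator {y \<in> space M. Some (u, y) \<in> \<Gamma>} y \<partial>Q x u)"
      using that \<open>0 \<le> t\<close> by (intro nn_integral_cong) (auto simp: indicator_def max_def)
    then show ?thesis
      by simp
  qed
  then show "ennreal (stay_prob q x t u) * emeasure (off_diag M q x u) {y \<in> space M. Some (u, y) \<in> \<Gamma>} *
      indicator {t<..} u =
    ennreal (stay x t u) * (\<integral>\<^sup>+y. indicator \<Gamma> (Some (max 0 u, y)) \<partial>Q x u) * indicator {t<..} u"
    using \<open>0 \<le> t\<close> by (auto simp: stay_prob_eq max_def split: split_indicator)
qed

lemma finite_jump_mass_space:
  assumes "0 \<le> t" and x: "x \<in> space M"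
  shows "finite_jump_mass M q t x (space (jump_space M)) = mass t x"
  unfolding finite_jump_mass_def mass_def
proof (intro nn_integral_cong)
  fix u
  have "{y \<in> space M. Some (u, y) \<in> space (jump_space M)} = space M" if "0 \<le> u"
    using that by (auto simp: space_jump_space)
  then show "ennreal (stay_prob q x t u) *
      emeasure (off_diag M q x u) {y \<in> space M. Some (u, y) \<in> space (jump_space M)} * indicator {t<..} u =
    ennreal (stay x t u) * ennreal (rate x u) * indicator {t<..} u"
    using assms by (auto simp: stay_prob_eq emeasure_off_diag_space rate_def split: split_indicator)
qed

lemma next_jump_Some_eq:
  assumes "0 \<le> t" and x: "x \<in> space M"
  shows "next_jump M q (Some (t, x)) =
    measure_of (space (jump_space M)) (sets (jump_space M)) (\<lambda>\<Gamma>. step (indicator \<Gamma>) t x)"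
  unfolding next_jump.simps prod.case
proof (rule measure_of_eq[OF sets.space_closed])
  fix \<Gamma> assume "\<Gamma> \<in> sigma_sets (space (jump_space M)) (sets (jump_space M))"
  then have "\<Gamma> \<in> sets (jump_space M)"
    by (simp add: sets.sigma_sets_eq)
  then show "finite_jump_mass M q t x \<Gamma> + indicator \<Gamma> None *
      (1 - finite_jump_mass M q t x (space (jump_space M))) = step (indicator \<Gamma>) t x"
    unfolding step_def finite_jump_mass_space[OF assms]
    by (simp add: finite_jump_mass_eq[OF assms])
qed

text \<open>The functional \<open>step\<close> satisfies the four conditions of
  \<open>functional_representation\<close>. For increasing limits, monotone convergence is applied
  first to the integral over states and then to the one over jump times.\<close>

lemma
  assumes "0 \<le> t" and x: "x \<in> space M"
  shows emeasure_next_jump_Some: "\<Gamma> \<in> sets (jump_space M) \<Longrightarrow>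
      emeasure (next_jump M q (Some (t, x))) \<Gamma> = step (indicator \<Gamma>) t x"
    and nn_integral_next_jump_Some: "g \<in> borel_measurable (jump_space M) \<Longrightarrow>
      (\<integral>\<^sup>+p. g p \<partial>next_jump M q (Some (t, x))) = step g t x"
proof -
  note [measurable] = x
  have 1: "step g t x = step h t x" if "\<And>p. p \<in> space (jump_space M) \<Longrightarrow> g p = h p" for g h
    unfolding step_def using that
    by (intro arg_cong2[where f="(+)"] arg_cong2[where f="(*)"] nn_integral_cong refl)
       (auto simp: space_jump_space)
  have 2: "step (\<lambda>p. g p + h p) t x = step g t x + step h t x"
    if [measurable]: "g \<in> borel_measurable (jump_space M)" "h \<in> borel_measurable (jump_space M)" for g h
    unfolding step_def by (simp add: nn_integral_add algebra_simps)
  have 3: "step (\<lambda>p. c * g p) t x = c * step g t x"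
    if [measurable]: "g \<in> borel_measurable (jump_space M)" for c g
    unfolding step_def by (simp add: nn_integral_cmult algebra_simps)
  have 4: "step (\<lambda>p. SUP i. U i p) t x = (SUP i. step (U i) t x)"
    if [measurable]: "\<And>i. U i \<in> borel_measurable (jump_space M)" and "incseq U"
    for U :: "nat \<Rightarrow> (real \<times> 'a) option \<Rightarrow> ennreal"
  proof -
    let ?k = "\<lambda>i u. ennreal (stay x t u) * (\<integral>\<^sup>+y. U i (Some (max 0 u, y)) \<partial>Q x u) * indicator {t<..} u"
    have mono: "U i p \<le> U j p" if "i \<le> j" for i j p
      using that \<open>incseq U\<close> by (auto simp: incseq_def le_fun_def)
    have "step (\<lambda>p. SUP i. U i p) t x = (\<integral>\<^sup>+u. (SUP i. ?k i u) \<partial>lborel) + (SUP i. U i None * (1 - mass t x))"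
      unfolding step_def
      by (intro arg_cong2[where f="(+)"] nn_integral_cong)
         (simp_all add: nn_integral_monotone_convergence_SUP incseq_def le_fun_def mono
           SUP_mult_left_ennreal SUP_mult_right_ennreal)
    also have "(\<integral>\<^sup>+u. (SUP i. ?k i u) \<partial>lborel) = (SUP i. \<integral>\<^sup>+u. ?k i u \<partial>lborel)"
      by (intro nn_integral_monotone_convergence_SUP)
         (auto simp: incseq_def le_fun_def intro!: mult_right_mono mult_left_mono nn_integral_mono mono)
    also have "\<dots> + (SUP i. U i None * (1 - mass t x)) = (SUP i. step (U i) t x)"
      unfolding step_def
      by (intro ennreal_SUP_add[symmetric])
         (auto simp: incseq_def intro!: nn_integral_mono mult_right_mono mult_left_mono mono)
    finally show ?thesis .
  qed
  note rep = functional_representation[of "jump_space M" "\<lambda>g. step g t x", OF 1 2 3 4,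
      folded next_jump_Some_eq[OF assms]]
  show "emeasure (next_jump M q (Some (t, x))) \<Gamma> = step (indicator \<Gamma>) t x"
    if "\<Gamma> \<in> sets (jump_space M)"
    by (rule rep(1)) (use that in auto)
  show "(\<integral>\<^sup>+p. g p \<partial>next_jump M q (Some (t, x))) = step g t x" if "g \<in> borel_measurable (jump_space M)"
    by (rule rep(2)) (use that in auto)
qed

lemma sets_next_jump[simp]: "sets (next_jump M q p) = sets (jump_space M)"
  by (cases p) (auto simp: sets.space_closed sets.sigma_sets_eq)

lemma space_next_jump[simp]: "space (next_jump M q p) = space (jump_space M)"
  by (rule sets_eq_imp_space_eq) simp

lemma prob_space_next_jump:
  assumes "p \<in> space (jump_space M)"
  shows "prob_space (next_jump M q p)"
proof (cases p)
  case None
  then show ?thesis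
    by (simp add: prob_space_return space_jump_space)
next
  case (Some a)
  with assms obtain t x where tx: "p = Some (t, x)" "0 \<le> t" "x \<in> space M"
    by (auto simp: space_jump_space)
  have "emeasure (next_jump M q p) (space (jump_space M)) =
    finite_jump_mass M q t x (space (jump_space M)) + (1 - mass t x)"
    unfolding tx(1) emeasure_next_jump_Some[OF tx(2,3) sets.top] step_def
      finite_jump_mass_eq[OF tx(2,3) sets.top]
    by (simp add: space_jump_space)
  \<comment> \<open>Subtraction in \<open>ennreal\<close> is truncated at 0, so the two masses add
    up to 1 only because of \<open>mass_le_1\<close>.\<close>
  also have "\<dots> = 1"
    using mass_le_1[OF tx(3), of t] tx
    by (simp add: finite_jump_mass_space add_diff_inverse_ennreal)
  finally show ?thesis
    by (intro prob_spaceI) simp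
qed

lemma measurable_next_jump: "next_jump M q \<in> measurable (jump_space M) (subprob_algebra (jump_space M))"
proof (rule measurable_subprob_algebra)
  fix \<Gamma> assume [measurable]: "\<Gamma> \<in> sets (jump_space M)"
  show "(\<lambda>p. emeasure (next_jump M q p) \<Gamma>) \<in> borel_measurable (jump_space M)"
  proof (rule measurable_adjoinI)
    have "(\<lambda>p. step (indicator \<Gamma>) (fst p) (snd p)) \<in> borel_measurable (time_space \<Otimes>\<^sub>M M)"
      by (rule measurable_step) (auto intro!: measurable_compose[OF measurable_fst] measurable_restrict_space1)
    also have "?this \<longleftrightarrow> (\<lambda>p. emeasure (next_jump M q (Some p)) \<Gamma>) \<in> borel_measurable (time_space \<Otimes>\<^sub>M M)"
      by (rule measurable_cong) (auto simp: space_pair_measure emeasure_next_jump_Some simp del: next_jump.simps)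
    finally show "(\<lambda>p. emeasure (next_jump M q (Some p)) \<Gamma>) \<in> borel_measurable (time_space \<Otimes>\<^sub>M M)" .
  qed simp
qed (auto intro: prob_space_imp_subprob_space prob_space_next_jump)

end

section \<open>Trajectories and one-step expectations\<close>

definition jtime :: "(real \<times> 'a) option \<Rightarrow> ereal" where
  "jtime p = (case p of Some (t, _) \<Rightarrow> ereal t | None \<Rightarrow> \<infinity>)"

lemma jtime_simps[simp]: "jtime None = \<infinity>" "jtime (Some (t, y)) = ereal t"
  by (simp_all add: jtime_def)

lemma jump_time_eq: "jump_time \<omega> n = jtime (\<omega> n)"
  by (simp add: jump_time_def jtime_def)

lemma measurable_jtime[measurable]: "jtime \<in> borel_measurable (jump_space M)"
proof (rule measurable_adjoinI)
  have "fst \<in> borel_measurable (time_space \<Otimes>\<^sub>M M)"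
    by (rule measurable_compose[OF measurable_fst]) (auto intro: measurable_restrict_space1)
  then have "(\<lambda>p. ereal (fst p)) \<in> borel_measurable (time_space \<Otimes>\<^sub>M M)"
    by measurable
  then show "(\<lambda>p. jtime (Some p)) \<in> borel_measurable (time_space \<Otimes>\<^sub>M M)"
    by (simp add: split_beta' jtime_def)
qed simp

lemma suminf_single:
  fixes g :: "nat \<Rightarrow> ennreal"
  assumes "\<And>n. n \<noteq> m \<Longrightarrow> g n = 0"
  shows "(\<Sum>n. g n) = g m"
  using suminf_finite[of "{m}" g] assms by auto

text \<open>For nondecreasing jump times the \<open>LEAST\<close> in \<open>process_at\<close> is a
  genuine unique choice. The case \<open>dead\<close> also records that no interval between
  successive jumps contains \<open>t\<close>, so a sum over all n is then empty, in agreement with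
  the value 0 at the cemetery.\<close>

lemma process_at_cases:
  assumes mono: "\<And>n. jump_time \<omega> n \<le> jump_time \<omega> (Suc n)" and "jump_time \<omega> 0 \<le> ereal t"
  obtains (alive) m s y where "ereal t < explosion_time \<omega>" "\<omega> m = Some (s, y)" "s \<le> t"
      "process_at \<omega> t = Some y" "\<And>n. jump_time \<omega> n \<le> t \<and> t < jump_time \<omega> (Suc n) \<longleftrightarrow> n = m"
    | (dead) "\<not> ereal t < explosion_time \<omega>" "process_at \<omega> t = None"
      "\<And>n. \<not> ereal t < jump_time \<omega> (Suc n)"
proof (cases "ereal t < explosion_time \<omega>")
  case True
  have inc: "jump_time \<omega> i \<le> jump_time \<omega> j" if "i \<le> j" for i j
    using mono that by (rule lift_Suc_mono_le)
  \<comment> \<open>The first jump beyond \<open>t\<close>. It is not the jump 0, which has happened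
    by time \<open>t\<close>, so \<open>N = Suc m\<close> and \<open>m\<close> is the current
    index.\<close>
  define N where "N = (LEAST n. ereal t < jump_time \<omega> n)"
  from True have ex: "\<exists>n. ereal t < jump_time \<omega> n"
    by (auto simp: explosion_time_def less_SUP_iff)
  then have N: "ereal t < jump_time \<omega> N"
    unfolding N_def by (rule LeastI_ex)
  have N': "jump_time \<omega> n \<le> ereal t" if "n < N" for n
    using not_less_Least[OF that[unfolded N_def]] by simp
  obtain m where m: "N = Suc m"
    using N assms(2) by (cases N) auto
  have iff: "jump_time \<omega> n \<le> t \<and> t < jump_time \<omega> (Suc n) \<longleftrightarrow> n = m" for n
  proof
    assume "jump_time \<omega> n \<le> t \<and> t < jump_time \<omega> (Suc n)"
    then have "\<not> Suc n < N" "\<not> N \<le> n"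
      using N' inc[of N n] N by (auto simp: not_le[symmetric])
    with m show "n = m" by simp
  qed (use N N' m in auto)
  then have "(LEAST n. jump_time \<omega> n \<le> ereal t \<and> ereal t < jump_time \<omega> (Suc n)) = m"
    unfolding iff by (intro Least_equality) auto
  moreover obtain s y where sy: "\<omega> m = Some (s, y)" "s \<le> t"
    using iff[of m] by (auto simp: jump_time_def split: option.splits)
  ultimately have "process_at \<omega> t = Some y"
    using True by (simp add: process_at_def)
  with True sy iff show thesis
    by (intro alive)
next
  case False
  then have "\<not> ereal t < jump_time \<omega> (Suc n)" for n
    by (auto simp: explosion_time_def less_SUP_iff)
  with False show thesis
    by (intro dead) (auto simp: process_at_def)
qed

context jump_rate
begin

text \<open>Expected value of \<open>H\<close> at time \<open>t\<close> over the paths that continue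
  from the pair \<open>p\<close> with exactly \<open>n\<close> more jumps up to time
  \<open>t\<close>. One step of the chain therefore turns index \<open>n\<close> into
  \<open>Suc n\<close>.\<close>

definition at_jump :: "nat \<Rightarrow> (real \<Rightarrow> 'a \<Rightarrow> ennreal) \<Rightarrow> real \<Rightarrow> (real \<times> 'a) option \<Rightarrow> ennreal" where
  "at_jump n H t p = (case p of None \<Rightarrow> 0 | Some (s, y) \<Rightarrow> if s \<le> t then T n H s y t else 0)"

lemma at_jump_simps[simp]: "at_jump n H t None = 0"
  "at_jump n H t (Some (s, y)) = (if s \<le> t then T n H s y t else 0)"
  by (simp_all add: at_jump_def)

lemma measurable_from_time: "fst \<in> borel_measurable (time_space \<Otimes>\<^sub>M N)"
  by (rule measurable_compose[OF measurable_fst]) (auto intro: measurable_restrict_space1)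

lemma measurable_at_jump:
  assumes [measurable]: "(\<lambda>(t, y). H t y) \<in> borel_measurable (borel \<Otimes>\<^sub>M M)"
  shows "at_jump n H t \<in> borel_measurable (jump_space M)"
proof (rule measurable_adjoinI)
  note measurable_from_time[measurable]
  have "(\<lambda>p. if fst p \<le> t then T n H (fst p) (snd p) t else 0) \<in> borel_measurable (time_space \<Otimes>\<^sub>M M)"
    by measurable
  then show "(\<lambda>p. at_jump n H t (Some p)) \<in> borel_measurable (time_space \<Otimes>\<^sub>M M)"
    by (simp add: split_beta' at_jump_def)
qed simp

lemma step_at_jump:
  assumes "0 \<le> s"
  shows "step (at_jump n H t) s x = (if s \<le> t then T (Suc n) H s x t else 0)"
proof (cases "s \<le> t")
  case True
  have "step (at_jump n H t) s x = (\<integral>\<^sup>+u\<in>{s..t}. ennreal (stay x s u) * (\<integral>\<^sup>+z. T n H u z t \<partial>Q x u) \<partial>lborel)"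
    unfolding step_def at_jump_simps mult_zero_left add_0_right
    \<comment> \<open>The jump law lives on the open half line beyond \<open>s\<close>, whereas
      \<open>T\<close> integrates over the closed interval; they differ by the null set
      \<open>{s}\<close>.\<close>
    by (intro nn_integral_cong_AE AE_I[where N="{s}"])
       (use assms in \<open>auto simp: indicator_def max_def split: if_splits\<close>)
  with True show ?thesis by simp
next
  case False
  have "step (at_jump n H t) s x = nn_integral lborel (\<lambda>_ :: real. 0)"
    unfolding step_def at_jump_simps mult_zero_left add_0_right
    by (intro nn_integral_cong) (use False assms in \<open>auto simp: indicator_def max_def\<close>)
  with False show ?thesis by simp
qed

lemma nn_integral_next_jump_None:
  assumes "g \<in> borel_measurable (jump_space M)"
  shows "(\<integral>\<^sup>+p. g p \<partial>next_jump M q None) = g None"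
  using assms by (simp add: nn_integral_return space_jump_space)

lemma nn_integral_next_jump_at_jump:
  assumes "p \<in> space (jump_space M)" and H: "(\<lambda>(t, y). H t y) \<in> borel_measurable (borel \<Otimes>\<^sub>M M)"
  shows "(\<integral>\<^sup>+p'. at_jump n H t p' \<partial>next_jump M q p) = at_jump (Suc n) H t p"
  using assms(1)
  by (cases p)
     (auto simp: space_jump_space nn_integral_next_jump_None nn_integral_next_jump_Some step_at_jump
        measurable_at_jump[OF H] simp del: T.simps next_jump.simps)

text \<open>No jump up to \<open>t\<close> means a finite jump later, of mass \<open>?R\<close>, or
  no further jump at all, of mass 1 - \<open>mass s x\<close>. Splitting \<open>mass s x\<close> at
  \<open>t\<close> makes \<open>?R\<close> cancel.\<close>

lemma step_survive:
  assumes "0 \<le> s" "s \<le> t" and x: "x \<in> space M"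
  shows "step (indicator {p. ereal t < jtime p}) s x = ennreal (stay x s t)"
proof -
  note [measurable] = x
  let ?k = "\<lambda>u. ennreal (stay x s u) * ennreal (rate x u)"
  let ?R = "\<integral>\<^sup>+u\<in>{t<..}. ?k u \<partial>lborel"
  have "mass s x = (\<integral>\<^sup>+u. ?k u * indicator {s..t} u + ?k u * indicator {t<..} u \<partial>lborel)"
    unfolding mass_def
    by (intro nn_integral_cong_AE AE_I[where N="{s}"])
       (use assms in \<open>auto simp: indicator_def split: if_splits\<close>)
  also have "\<dots> = ennreal (1 - stay x s t) + ?R"
    by (subst nn_integral_add) (simp_all add: nn_integral_stay_rate assms)
  finally have mass: "mass s x = ennreal (1 - stay x s t) + ?R" .
  have "(\<integral>\<^sup>+u\<in>{s<..}. ennreal (stay x s u) *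
      (\<integral>\<^sup>+y. indicator {p. ereal t < jtime p} (Some (max 0 u, y)) \<partial>Q x u) \<partial>lborel) = ?R"
  proof (intro nn_integral_cong)
    fix u
    have "indicator {p. ereal t < jtime p} (Some (max 0 u, y)) = (indicator {t<..} u :: ennreal)" for y :: 'a
      using assms by (auto simp: indicator_def max_def)
    then show "ennreal (stay x s u) * (\<integral>\<^sup>+y. indicator {p. ereal t < jtime p} (Some (max 0 u, y)) \<partial>Q x u) *
        indicator {s<..} u = ?k u * indicator {t<..} u"
      using assms by (auto simp: emeasure_Q_space split: split_indicator)
  qed
  then have "step (indicator {p. ereal t < jtime p}) s x = ?R + (1 - (ennreal (1 - stay x s t) + ?R))"
    by (simp add: step_def mass)
  \<comment> \<open>Finiteness of \<open>?R\<close> and the bound of the total by 1 make the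
    cancellation valid for the truncated subtraction.\<close>
  moreover have "?R \<noteq> top"
    using mass_le_1[OF x, of s] unfolding mass by (auto simp: top_unique)
  then obtain R where R: "?R = ennreal R" "0 \<le> R"
    by (cases ?R) auto
  moreover have "ennreal (1 - stay x s t) + ?R \<le> 1"
    using mass_le_1[OF x, of s] unfolding mass .
  then have "1 - stay x s t + R \<le> 1"
    using R stay_le_1[OF x, of s t] by (simp flip: ennreal_plus)
  ultimately show ?thesis
    using stay_le_1[OF x, of s t]
    by (simp add: ennreal_minus flip: ennreal_plus ennreal_1)
qed

text \<open>The half of the event t_n \<le> t < t_{n+1} that the n-th pair decides; the other half
  is an indicator of the next pair.\<close>

definition alive_at :: "(real \<Rightarrow> 'a \<Rightarrow> ennreal) \<Rightarrow> real \<Rightarrow> (real \<times> 'a) option \<Rightarrow> ennreal" where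
  "alive_at H t p = (case p of None \<Rightarrow> 0 | Some (s, y) \<Rightarrow> if s \<le> t then H t y else 0)"

lemma measurable_alive_at:
  assumes [measurable]: "(\<lambda>(t, y). H t y) \<in> borel_measurable (borel \<Otimes>\<^sub>M M)"
  shows "alive_at H t \<in> borel_measurable (jump_space M)"
proof (rule measurable_adjoinI)
  note measurable_from_time[measurable]
  have "(\<lambda>w. H t (snd w)) \<in> borel_measurable (time_space \<Otimes>\<^sub>M M)"
    using measurable_compose[OF measurable_Pair[OF measurable_const[of t] measurable_snd] assms] by simp
  then have "(\<lambda>p. if fst p \<le> t then H t (snd p) else 0) \<in> borel_measurable (time_space \<Otimes>\<^sub>M M)"
    by measurable
  then show "(\<lambda>p. alive_at H t (Some p)) \<in> borel_measurable (time_space \<Otimes>\<^sub>M M)"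
    by (simp add: split_beta' alive_at_def)
qed (simp add: alive_at_def)

lemma nn_integral_next_jump_alive:
  assumes p: "p \<in> space (jump_space M)"
  shows "(\<integral>\<^sup>+p'. alive_at H t p * indicator {p. ereal t < jtime p} p' \<partial>next_jump M q p) = at_jump 0 H t p"
proof -
  have "{p \<in> space (jump_space M). ereal t < jtime p} \<in> sets (jump_space M)"
    by measurable
  then have [measurable]: "(\<lambda>p. indicator {p. ereal t < jtime p} p :: ennreal) \<in> borel_measurable (jump_space M)"
    by (subst measurable_cong[of _ _ "indicator {p \<in> space (jump_space M). ereal t < jtime p}"])
       (auto simp: indicator_def)
  have "(\<integral>\<^sup>+p'. alive_at H t p * indicator {p. ereal t < jtime p} p' \<partial>next_jump M q p) =
    alive_at H t p * (\<integral>\<^sup>+p'. indicator {p. ereal t < jtime p} p' \<partial>next_jump M q p)"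
    by (rule nn_integral_cmult) (simp add: measurable_cong_sets[OF sets_next_jump refl])
  also have "\<dots> = at_jump 0 H t p"
  proof (cases p)
    case (Some a)
    with p obtain s y where sy: "p = Some (s, y)" "0 \<le> s" "y \<in> space M"
      by (auto simp: space_jump_space)
    then have "(\<integral>\<^sup>+p'. indicator {p. ereal t < jtime p} p' \<partial>next_jump M q p) =
      step (indicator {p. ereal t < jtime p}) s y"
      by (simp only:) (intro nn_integral_next_jump_Some, measurable)
    then show ?thesis
      using sy by (simp add: alive_at_def step_survive)
  qed (simp add: alive_at_def)
  finally show ?thesis .
qed

text \<open>The density is supported on times beyond the current one, and \<open>None\<close>
  carries time infinity. This makes the jump times almost surely nondecreasing.\<close>

lemma nn_integral_next_jump_back:
  assumes p: "p \<in> space (jump_space M)"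
  shows "(\<integral>\<^sup>+p'. indicator {p'. jtime p' < jtime p} p' \<partial>next_jump M q p) = 0"
proof -
  have "{p' \<in> space (jump_space M). jtime p' < jtime p} \<in> sets (jump_space M)"
    by measurable
  then have m: "(\<lambda>p'. indicator {p'. jtime p' < jtime p} p' :: ennreal) \<in> borel_measurable (jump_space M)"
    by (subst measurable_cong[of _ _ "indicator {p' \<in> space (jump_space M). jtime p' < jtime p}"])
       (auto simp: indicator_def)
  show ?thesis
  proof (cases p)
    case None
    with m show ?thesis by (simp add: nn_integral_next_jump_None del: next_jump.simps)
  next
    case (Some a)
    with p obtain s y where sy: "p = Some (s, y)" "0 \<le> s" "y \<in> space M"
      by (auto simp: space_jump_space)
    have "(\<integral>\<^sup>+p'. indicator {p'. jtime p' < jtime p} p' \<partial>next_jump M q p) =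
      step (indicator {p'. jtime p' < jtime p}) s y"
      using m sy by (simp only:) (intro nn_integral_next_jump_Some)
    also have "\<dots> = nn_integral lborel (\<lambda>_ :: real. 0) + 0"
      unfolding step_def
    proof (intro arg_cong2[where f="(+)"] nn_integral_cong)
      fix u
      have "(\<integral>\<^sup>+z. indicator {p'. jtime p' < jtime p} (Some (max 0 u, z)) \<partial>Q y u) = 0" if "s < u"
        using that sy by (simp add: max_def)
      then show "ennreal (stay y s u) *
          (\<integral>\<^sup>+z. indicator {p'. jtime p' < jtime p} (Some (max 0 u, z)) \<partial>Q y u) * indicator {s<..} u = 0"
        by (simp split: split_indicator)
    qed (simp add: sy)
    finally show ?thesis by simp
  qed
qed

end

section \<open>Expectations under the law of the jump sequence\<close>

locale jump_process = jump_rate +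
  fixes x :: 'a
  assumes start: "x \<in> space M"
begin

abbreviation law where "law \<equiv> jump_law M q x"

sublocale IT: Ionescu_Tulcea "jump_kernel M q x" "\<lambda>_. jump_space M"
proof (rule Ionescu_Tulcea.intro)
  have s: "Some (0, x) \<in> space (jump_space M)"
    using start by (simp add: space_jump_space)
  show "jump_kernel M q x i \<in> measurable (PiM {0..<i} (\<lambda>_. jump_space M)) (subprob_algebra (jump_space M))" for i
  proof (cases i)
    case 0
    have "return (jump_space M) (Some (0, x)) \<in> space (subprob_algebra (jump_space M))"
      using s by (rule measurable_space[OF return_measurable])
    then have "(\<lambda>_. return (jump_space M) (Some (0, x))) \<in>
        measurable (PiM {0..<i} (\<lambda>_. jump_space M)) (subprob_algebra (jump_space M))"
      by simp
    then show ?thesis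
      by (simp add: 0 jump_kernel.simps(1)[abs_def])
  next
    case (Suc n)
    have "(\<lambda>\<omega>. next_jump M q (\<omega> n)) \<in> measurable (PiM {0..<Suc n} (\<lambda>_. jump_space M)) (subprob_algebra (jump_space M))"
      by (rule measurable_compose[OF _ measurable_next_jump]) (rule measurable_component_singleton, simp)
    then show ?thesis
      by (simp add: Suc jump_kernel.simps(2)[abs_def])
  qed
  show "prob_space (jump_kernel M q x i \<omega>)" if "\<omega> \<in> space (PiM {0..<i} (\<lambda>_. jump_space M))" for i \<omega>
  proof (cases i)
    case 0
    then show ?thesis using s by (simp add: prob_space_return)
  next
    case (Suc n)
    with that have "\<omega> n \<in> space (jump_space M)"
      by (auto simp: space_PiM PiE_iff)
    then show ?thesis
      by (simp add: Suc prob_space_next_jump)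
  qed
qed

lemma law_eq: "law = IT.PF.lim"
  by (simp add: jump_law_def)

lemma sets_law[measurable_cong]: "sets law = sets (PiM UNIV (\<lambda>_. jump_space M))"
  by (simp add: law_eq)

lemma space_law: "space law = space (PiM UNIV (\<lambda>_. jump_space M))"
  by (simp add: law_eq)

lemma component_in_space: "\<omega> \<in> space law \<Longrightarrow> \<omega> n \<in> space (jump_space M)"
  by (auto simp: space_law space_PiM)

lemma measurable_component_law[measurable]: "(\<lambda>\<omega>. \<omega> n) \<in> measurable law (jump_space M)"
  by (simp add: measurable_cong_sets[OF sets_law refl])

text \<open>Reduces expectations of the first \<open>n\<close> pairs to the finite composition
  \<open>IT.C 0 n\<close>, whose recursive structure can be unfolded one kernel at a time.\<close>

lemma nn_integral_law:
  assumes F: "F \<in> borel_measurable (PiM {0..<n} (\<lambda>_. jump_space M))"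
  shows "(\<integral>\<^sup>+\<omega>. F (restrict \<omega> {0..<n}) \<partial>law) = (\<integral>\<^sup>+\<omega>. F \<omega> \<partial>IT.C 0 n (\<lambda>_. undefined))"
proof -
  \<comment> \<open>The marginal \<open>IT.CI\<close> for a finite index set is a restriction of
    such a composition; for an initial segment the restriction is trivial.\<close>
  have C: "IT.CI {0..<n} = IT.C 0 n (\<lambda>_. undefined)"
  proof (rule measure_eqI)
    show s: "sets (IT.CI {0..<n}) = sets (IT.C 0 n (\<lambda>_. undefined))"
      by (simp add: IT.CI_def IT.sets_C space_PiM)
    fix A assume "A \<in> sets (IT.CI {0..<n})"
    then have A: "A \<in> sets (PiM {0..<n} (\<lambda>_. jump_space M))"
      by (simp add: IT.CI_def)
    then show "emeasure (IT.CI {0..<n}) A = emeasure (IT.C 0 n (\<lambda>_. undefined)) A"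
      using sets.sets_into_space[OF A]
      by (simp add: IT.emeasure_CI[OF subset_refl A] prod_emb_id[of A "{0..<n}"] space_PiM)
  qed
  have "(\<integral>\<^sup>+\<omega>. F (restrict \<omega> {0..<n}) \<partial>law) =
    (\<integral>\<^sup>+\<omega>. F \<omega> \<partial>distr law (PiM {0..<n} (\<lambda>_. jump_space M)) (\<lambda>\<omega>. restrict \<omega> {0..<n}))"
    by (rule nn_integral_distr[symmetric])
       (simp_all only: measurable_cong_sets[OF sets_law refl] measurable_restrict_subset subset_UNIV
         measurable_distr_eq1 F)
  also have "distr law (PiM {0..<n} (\<lambda>_. jump_space M)) (\<lambda>\<omega>. restrict \<omega> {0..<n}) = IT.C 0 n (\<lambda>_. undefined)"
    by (simp add: law_eq IT.distr_lim C)
  finally show ?thesis .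
qed

lemma undefined_in_space: "(\<lambda>_. undefined) \<in> space (PiM {0..<0::nat} (\<lambda>_. jump_space M))"
  by (simp add: space_PiM)

text \<open>The tower property: the last kernel of the composition is integrated first,
  conditionally on the preceding \<open>n\<close> pairs.\<close>

lemma nn_integral_law_Suc:
  assumes F: "F \<in> borel_measurable (PiM {0..<Suc n} (\<lambda>_. jump_space M))"
  shows "(\<integral>\<^sup>+\<omega>. F (restrict \<omega> {0..<Suc n}) \<partial>law) =
    (\<integral>\<^sup>+\<omega>. (\<integral>\<^sup>+p. F (fun_upd (restrict \<omega> {0..<n}) n p) \<partial>jump_kernel M q x n (restrict \<omega> {0..<n})) \<partial>law)"
proof -
  have "(\<integral>\<^sup>+\<omega>. F (restrict \<omega> {0..<Suc n}) \<partial>law) = (\<integral>\<^sup>+\<omega>. F \<omega> \<partial>IT.C 0 (Suc n) (\<lambda>_. undefined))"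
    using F by (rule nn_integral_law)
  also have "\<dots> = (\<integral>\<^sup>+\<omega>. (\<integral>\<^sup>+\<omega>'. F \<omega>' \<partial>IT.eP n \<omega>) \<partial>IT.C 0 n (\<lambda>_. undefined))"
    unfolding IT.C.simps add_0
    by (rule nn_integral_bind[OF F])
       (simp add: measurable_cong_sets[OF IT.sets_C[OF undefined_in_space] refl] IT.measurable_eP)
  also have "\<dots> = (\<integral>\<^sup>+\<omega>. (\<integral>\<^sup>+\<omega>'. F \<omega>' \<partial>IT.eP n (restrict \<omega> {0..<n})) \<partial>law)"
    by (rule nn_integral_law[symmetric])
       (rule measurable_compose[OF IT.measurable_eP nn_integral_measurable_subprob_algebra[OF F]])
  also have "\<dots> = (\<integral>\<^sup>+\<omega>. (\<integral>\<^sup>+p. F (fun_upd (restrict \<omega> {0..<n}) n p) \<partial>jump_kernel M q x n (restrict \<omega> {0..<n})) \<partial>law)"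
    by (intro nn_integral_cong IT.nn_integral_eP[OF _ F])
       (auto simp: space_law space_PiM)
  finally show ?thesis .
qed

lemma prob_space_law: "prob_space law"
proof (rule prob_spaceI)
  have "emeasure law (space law) = (\<integral>\<^sup>+\<omega>. 1 \<partial>law)"
    by simp
  also have "\<dots> = (\<integral>\<^sup>+\<omega>. 1 \<partial>IT.C 0 0 (\<lambda>_. undefined))"
    by (rule nn_integral_law[of "\<lambda>_. 1" 0]) simp
  also have "\<dots> = 1"
    using prob_space.emeasure_space_1[OF IT.prob_space_C[OF undefined_in_space, of 0]] by simp
  finally show "emeasure law (space law) = 1" .
qed

lemma nn_integral_law_0:
  assumes g: "g \<in> borel_measurable (jump_space M)"
  shows "(\<integral>\<^sup>+\<omega>. g (\<omega> 0) \<partial>law) = g (Some (0, x))"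
proof -
  interpret prob_space law by (fact prob_space_law)
  have "(\<integral>\<^sup>+\<omega>. g (\<omega> 0) \<partial>law) = (\<integral>\<^sup>+\<omega>. g (restrict \<omega> {0..<Suc 0} 0) \<partial>law)"
    by simp
  also have "\<dots> = (\<integral>\<^sup>+\<omega>. g (Some (0, x)) \<partial>law)"
  proof (subst nn_integral_law_Suc[of "\<lambda>\<omega>. g (\<omega> 0)"])
    show "(\<lambda>\<omega>. g (\<omega> 0)) \<in> borel_measurable (PiM {0..<Suc 0} (\<lambda>_. jump_space M))"
      by (rule measurable_compose[OF _ g]) (rule measurable_component_singleton, simp)
  qed (use g start in \<open>simp add: nn_integral_return space_jump_space\<close>)
  also have "\<dots> = g (Some (0, x))"
    by (simp add: emeasure_space_1)
  finally show ?thesis .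
qed

text \<open>The Markov property: \<open>jump_kernel\<close> at index \<open>Suc n\<close> looks only
  at the n-th pair.\<close>

lemma nn_integral_law_step:
  assumes G: "(\<lambda>(p, p'). G p p') \<in> borel_measurable (jump_space M \<Otimes>\<^sub>M jump_space M)"
  shows "(\<integral>\<^sup>+\<omega>. G (\<omega> n) (\<omega> (Suc n)) \<partial>law) = (\<integral>\<^sup>+\<omega>. (\<integral>\<^sup>+p'. G (\<omega> n) p' \<partial>next_jump M q (\<omega> n)) \<partial>law)"
proof -
  have "(\<lambda>\<omega>. G (\<omega> n) (\<omega> (Suc n))) \<in> borel_measurable (PiM {0..<Suc (Suc n)} (\<lambda>_. jump_space M))"
  proof -
    have "(\<lambda>\<omega>. (\<omega> n, \<omega> (Suc n))) \<in> measurable (PiM {0..<Suc (Suc n)} (\<lambda>_. jump_space M))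
        (jump_space M \<Otimes>\<^sub>M jump_space M)"
      by (intro measurable_Pair measurable_component_singleton) auto
    from measurable_compose[OF this G] show ?thesis
      by simp
  qed
  from nn_integral_law_Suc[OF this] show ?thesis
    by simp
qed

text \<open>The law is unfolded from its last jump, while \<open>T\<close> is defined by its first
  jump. The remaining number \<open>m\<close> mediates: each step removes one jump from the law and
  hands it to \<open>T\<close>, so \<open>m\<close> must be arbitrary in the induction.\<close>

lemma nn_integral_law_at_jump:
  assumes H: "(\<lambda>(t, y). H t y) \<in> borel_measurable (borel \<Otimes>\<^sub>M M)" and "0 \<le> t"
  shows "(\<integral>\<^sup>+\<omega>. at_jump m H t (\<omega> n) \<partial>law) = T (n + m) H 0 x t"
proof (induction n arbitrary: m)
  case 0
  show ?case
    using \<open>0 \<le> t\<close> by (subst nn_integral_law_0) (simp_all add: measurable_at_jump[OF H])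
next
  case (Suc n)
  have "(\<integral>\<^sup>+\<omega>. at_jump m H t (\<omega> (Suc n)) \<partial>law) =
    (\<integral>\<^sup>+\<omega>. (\<integral>\<^sup>+p'. at_jump m H t p' \<partial>next_jump M q (\<omega> n)) \<partial>law)"
    using measurable_compose[OF measurable_snd measurable_at_jump[OF H]]
    by (intro nn_integral_law_step) (simp add: split_beta')
  also have "\<dots> = (\<integral>\<^sup>+\<omega>. at_jump (Suc m) H t (\<omega> n) \<partial>law)"
    by (intro nn_integral_cong nn_integral_next_jump_at_jump[OF component_in_space H])
  also have "\<dots> = T (Suc n + m) H 0 x t"
    by (simp add: Suc.IH del: T.simps)
  finally show ?case .
qed

lemma AE_law_times: "AE \<omega> in law. jump_time \<omega> 0 = 0 \<and> (\<forall>n. jump_time \<omega> n \<le> jump_time \<omega> (Suc n))"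
proof -
  have 1: "(\<lambda>p. indicator {p. jtime p \<noteq> 0} p :: ennreal) \<in> borel_measurable (jump_space M)"
  proof -
    have "{p \<in> space (jump_space M). jtime p \<noteq> 0} \<in> sets (jump_space M)"
      by measurable
    then show ?thesis
      by (subst measurable_cong[of _ _ "indicator {p \<in> space (jump_space M). jtime p \<noteq> 0}"])
         (auto simp: indicator_def)
  qed
  have 2: "(\<lambda>(p, p'). indicator {p'. jtime p' < jtime p} p' :: ennreal)
    \<in> borel_measurable (jump_space M \<Otimes>\<^sub>M jump_space M)"
  proof -
    have "{w \<in> space (jump_space M \<Otimes>\<^sub>M jump_space M). jtime (snd w) < jtime (fst w)}
        \<in> sets (jump_space M \<Otimes>\<^sub>M jump_space M)"
      by measurable
    then show ?thesis
      by (subst measurable_cong[of _ _ "indicator {w \<in> space (jump_space M \<Otimes>\<^sub>M jump_space M). jtime (snd w) < jtime (fst w)}"])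
         (auto simp: indicator_def)
  qed
  have "(\<integral>\<^sup>+\<omega>. indicator {p. jtime p \<noteq> 0} (\<omega> 0) \<partial>law) = 0"
    by (subst nn_integral_law_0[OF 1]) simp
  then have "AE \<omega> in law. indicator {p. jtime p \<noteq> 0} (\<omega> 0) = (0 :: ennreal)"
    using measurable_compose[OF measurable_component_law 1] by (subst (asm) nn_integral_0_iff_AE) auto
  moreover have "AE \<omega> in law. indicator {p'. jtime p' < jtime (\<omega> n)} (\<omega> (Suc n)) = (0 :: ennreal)" for n
  proof -
    have "(\<integral>\<^sup>+\<omega>. indicator {p'. jtime p' < jtime (\<omega> n)} (\<omega> (Suc n)) \<partial>law) =
      (\<integral>\<^sup>+\<omega>. (\<integral>\<^sup>+p'. indicator {p'. jtime p' < jtime (\<omega> n)} p' \<partial>next_jump M q (\<omega> n)) \<partial>law)"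
      by (rule nn_integral_law_step[OF 2])
    also have "\<dots> = (\<integral>\<^sup>+\<omega>. 0 \<partial>law)"
      by (intro nn_integral_cong nn_integral_next_jump_back component_in_space)
    finally have "(\<integral>\<^sup>+\<omega>. indicator {p'. jtime p' < jtime (\<omega> n)} (\<omega> (Suc n)) \<partial>law) = (0 :: ennreal)"
      by simp
    moreover have "(\<lambda>\<omega>. indicator {p'. jtime p' < jtime (\<omega> n)} (\<omega> (Suc n)) :: ennreal) \<in> borel_measurable law"
      using measurable_compose[OF measurable_Pair[OF measurable_component_law measurable_component_law] 2] by simp
    ultimately show ?thesis
      by (subst (asm) nn_integral_0_iff_AE)
  qed
  then have "AE \<omega> in law. \<forall>n. indicator {p'. jtime p' < jtime (\<omega> n)} (\<omega> (Suc n)) = (0 :: ennreal)"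
    by (simp add: AE_all_countable)
  ultimately show ?thesis
    by eventually_elim (auto simp: jump_time_eq indicator_def not_less split: if_splits)
qed

lemma nn_integral_process_at:
  assumes h: "h \<in> borel_measurable M" and "0 \<le> t"
  shows "(\<integral>\<^sup>+\<omega>. (case process_at \<omega> t of None \<Rightarrow> 0 | Some y \<Rightarrow> h y) \<partial>law) = (\<Sum>n. T n (\<lambda>_. h) 0 x t)"
proof -
  note H = measurable_const_fun[OF h]
  \<comment> \<open>The event t_n \<le> t < t_{n+1} as a function of two consecutive pairs.
    Integrating out the second one leaves \<open>at_jump 0\<close>, to which
    \<open>nn_integral_law_at_jump\<close> applies; on almost every trajectory at most one n
    contributes.\<close>
  let ?G = "\<lambda>p p'. alive_at (\<lambda>_. h) t p * indicator {p. ereal t < jtime p} p'"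
  have G: "(\<lambda>(p, p'). ?G p p') \<in> borel_measurable (jump_space M \<Otimes>\<^sub>M jump_space M)"
  proof -
    have "{p \<in> space (jump_space M). ereal t < jtime p} \<in> sets (jump_space M)"
      by measurable
    then have [measurable]: "(\<lambda>p. indicator {p. ereal t < jtime p} p :: ennreal) \<in> borel_measurable (jump_space M)"
      by (subst measurable_cong[of _ _ "indicator {p \<in> space (jump_space M). ereal t < jtime p}"])
         (auto simp: indicator_def)
    note measurable_alive_at[OF H, measurable]
    show ?thesis
      by measurable
  qed
  have "AE \<omega> in law. (case process_at \<omega> t of None \<Rightarrow> 0 | Some y \<Rightarrow> h y) = (\<Sum>n. ?G (\<omega> n) (\<omega> (Suc n)))"
    using AE_law_times
  proof eventually_elim
    case (elim \<omega>)
    then have "jump_time \<omega> n \<le> jump_time \<omega> (Suc n)" "jump_time \<omega> 0 \<le> ereal t" for n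
      using \<open>0 \<le> t\<close> by auto
    then show ?case
    proof (cases rule: process_at_cases)
      case (alive m s y)
      have "?G (\<omega> n) (\<omega> (Suc n)) = 0" if "n \<noteq> m" for n
        using alive(5)[of n] that
        by (auto simp: alive_at_def jump_time_eq indicator_def split: option.splits)
      then have "(\<Sum>n. ?G (\<omega> n) (\<omega> (Suc n))) = ?G (\<omega> m) (\<omega> (Suc m))"
        by (rule suminf_single)
      then show ?thesis
        using alive(5)[of m] by (simp add: alive(2,3,4) alive_at_def jump_time_eq)
    next
      case dead
      then have "(\<Sum>n. ?G (\<omega> n) (\<omega> (Suc n))) = (\<Sum>n. 0)"
        by (intro suminf_cong) (simp add: jump_time_eq)
      with dead(2) show ?thesis
        by simp
    qed
  qed
  then have "(\<integral>\<^sup>+\<omega>. (case process_at \<omega> t of None \<Rightarrow> 0 | Some y \<Rightarrow> h y) \<partial>law) =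
    (\<integral>\<^sup>+\<omega>. (\<Sum>n. ?G (\<omega> n) (\<omega> (Suc n))) \<partial>law)"
    by (rule nn_integral_cong_AE)
  also have "\<dots> = (\<Sum>n. \<integral>\<^sup>+\<omega>. ?G (\<omega> n) (\<omega> (Suc n)) \<partial>law)"
    using measurable_compose[OF measurable_Pair[OF measurable_component_law measurable_component_law] G]
    by (intro nn_integral_suminf) simp
  also have "\<dots> = (\<Sum>n. T n (\<lambda>_. h) 0 x t)"
  proof (intro suminf_cong)
    fix n
    have "(\<integral>\<^sup>+\<omega>. ?G (\<omega> n) (\<omega> (Suc n)) \<partial>law) = (\<integral>\<^sup>+\<omega>. (\<integral>\<^sup>+p'. ?G (\<omega> n) p' \<partial>next_jump M q (\<omega> n)) \<partial>law)"
      by (rule nn_integral_law_step[OF G])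
    also have "\<dots> = (\<integral>\<^sup>+\<omega>. at_jump 0 (\<lambda>_. h) t (\<omega> n) \<partial>law)"
      by (intro nn_integral_cong nn_integral_next_jump_alive component_in_space)
    also have "\<dots> = T n (\<lambda>_. h) 0 x t"
      by (simp add: nn_integral_law_at_jump[OF H \<open>0 \<le> t\<close>] del: T.simps)
    finally show "(\<integral>\<^sup>+\<omega>. ?G (\<omega> n) (\<omega> (Suc n)) \<partial>law) = T n (\<lambda>_. h) 0 x t" .
  qed
  finally show ?thesis .
qed

lemma measurable_explosion_time[measurable]: "explosion_time \<in> borel_measurable law"
proof -
  have "(\<lambda>\<omega>. SUP n. jtime (\<omega> n)) \<in> borel_measurable law"
    by measurable
  then show ?thesis
    by (simp add: explosion_time_def[abs_def] jump_time_eq)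
qed

lemma AE_process_at_space:
  assumes "0 \<le> t"
  shows "AE \<omega> in law. (process_at \<omega> t \<noteq> None \<longleftrightarrow> ereal t < explosion_time \<omega>) \<and>
    (\<forall>y. process_at \<omega> t = Some y \<longrightarrow> y \<in> space M)"
  using AE_law_times AE_space
proof eventually_elim
  case (elim \<omega>)
  then have "jump_time \<omega> n \<le> jump_time \<omega> (Suc n)" "jump_time \<omega> 0 \<le> ereal t" for n
    using \<open>0 \<le> t\<close> by auto
  then show ?case
  proof (cases rule: process_at_cases)
    case (alive m s y)
    then show ?thesis
      using component_in_space[OF elim(2), of m] by (auto simp: space_jump_space)
  qed auto
qed

lemma emeasure_before_explosion:
  assumes "0 \<le> t"
  shows "emeasure law {\<omega> \<in> space law. ereal t < explosion_time \<omega>} = (\<Sum>n. T n (\<lambda>_ _. 1) 0 x t)"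
proof -
  have "emeasure law {\<omega> \<in> space law. ereal t < explosion_time \<omega>} =
    (\<integral>\<^sup>+\<omega>. indicator {\<omega> \<in> space law. ereal t < explosion_time \<omega>} \<omega> \<partial>law)"
    by (rule nn_integral_indicator[symmetric]) measurable
  also have "\<dots> = (\<integral>\<^sup>+\<omega>. (case process_at \<omega> t of None \<Rightarrow> 0 | Some y \<Rightarrow> 1) \<partial>law)"
    using AE_process_at_space[OF assms] AE_space
    by (intro nn_integral_cong_AE, eventually_elim) (auto simp: indicator_def split: option.splits)
  also have "\<dots> = (\<Sum>n. T n (\<lambda>_ _. 1) 0 x t)"
    using assms by (rule nn_integral_process_at[rotated]) simp
  finally show ?thesis .
qed

text \<open>The sum is the probability of no explosion by time \<open>t\<close>. For the transformed
  rates this is the a priori bound behind all integrability.\<close>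

lemma sum_T_1_le: "0 \<le> t \<Longrightarrow> (\<Sum>n. T n (\<lambda>_ _. 1) 0 x t) \<le> 1"
  using prob_space.measure_le_1[OF prob_space_law, of "{\<omega> \<in> space law. ereal t < explosion_time \<omega>}"]
  by (simp add: emeasure_before_explosion)

lemma prob_no_explosion_iff:
  "\<P>(\<omega> in law. explosion_time \<omega> = \<infinity>) = 1 \<longleftrightarrow> (\<forall>t\<ge>0. (\<Sum>n. T n (\<lambda>_ _. 1) 0 x t) = 1)"
proof -
  interpret prob_space law by (fact prob_space_law)
  have AE_iff: "(AE \<omega> in law. ereal t < explosion_time \<omega>) \<longleftrightarrow> (\<Sum>n. T n (\<lambda>_ _. 1) 0 x t) = 1" if "0 \<le> t" for t
  proof -
    have "{\<omega> \<in> space law. ereal t < explosion_time \<omega>} \<in> events"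
      by measurable
    then have "(AE \<omega> in law. ereal t < explosion_time \<omega>) \<longleftrightarrow> emeasure law {\<omega> \<in> space law. ereal t < explosion_time \<omega>} = 1"
      using AE_iff_emeasure_eq_1 by simp
    then show ?thesis
      by (simp add: emeasure_before_explosion[OF that])
  qed
  have "{\<omega> \<in> space law. explosion_time \<omega> = \<infinity>} \<in> events"
    by measurable
  then have "\<P>(\<omega> in law. explosion_time \<omega> = \<infinity>) = 1 \<longleftrightarrow> (AE \<omega> in law. explosion_time \<omega> = \<infinity>)"
    using prob_Collect_eq_1 by simp
  also have "\<dots> \<longleftrightarrow> (\<forall>t\<ge>0. AE \<omega> in law. ereal t < explosion_time \<omega>)"
  proof (intro iffI allI impI)
    fix t :: real assume "AE \<omega> in law. explosion_time \<omega> = \<infinity>"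
    then show "AE \<omega> in law. ereal t < explosion_time \<omega>"
      by eventually_elim simp
  next
    assume "\<forall>t\<ge>0. AE \<omega> in law. ereal t < explosion_time \<omega>"
    \<comment> \<open>Integer times suffice, which keeps the intersection of almost sure events
      countable.\<close>
    then have "AE \<omega> in law. \<forall>n. ereal (real n) < explosion_time \<omega>"
      by (simp add: AE_all_countable)
    then show "AE \<omega> in law. explosion_time \<omega> = \<infinity>"
    proof eventually_elim
      case (elim \<omega>)
      then show ?case
        by (intro ereal_top) (metis ereal_less_eq(3) less_imp_le order_trans real_arch_simple)
    qed
  qed
  finally show ?thesis
    by (simp add: AE_iff)
qed

end

section \<open>Q-functions on Borel spaces\<close>

text \<open>The kernel is measurable in (x,s) for a fixed set, but \<open>off_diag\<close> evaluates
  it on a set that varies with x. The separating sequence approximates the moving singleton by sets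
  taking finitely many values.\<close>

locale separated_Q_function =
  fixes M :: "'a measure" and q :: "'a rate" and B :: "nat \<Rightarrow> 'a set"
  assumes Q: "Q_function M q" and B_sets[measurable]: "\<And>n. B n \<in> sets M"
    and separating: "\<And>x y. x \<in> space M \<Longrightarrow> y \<in> space M \<Longrightarrow> x \<noteq> y \<Longrightarrow> \<exists>n. x \<in> B n \<and> y \<notin> B n"
    and nonempty: "space M \<noteq> {}"
begin

text \<open>The member containing x of the partition of the space generated by \<open>B 0\<close>,
  ..., \<open>B (n - 1)\<close>. These shrink to \<open>{x}\<close> because the sequence separates
  points.\<close>

primrec cell :: "nat \<Rightarrow> 'a \<Rightarrow> 'a set" where
  "cell 0 x = space M"
| "cell (Suc n) x = (if x \<in> B n then B n else space M - B n) \<inter> cell n x"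

lemma cell_sets[measurable]: "cell n x \<in> sets M"
  by (induction n) auto

lemma cell_antimono: "m \<le> n \<Longrightarrow> cell n x \<subseteq> cell m x"
  by (induction n rule: dec_induct) auto

lemma cell_self: "x \<in> space M \<Longrightarrow> x \<in> cell n x"
  by (induction n) auto

lemma Inter_cell: "x \<in> space M \<Longrightarrow> (\<Inter>n. cell n x) = {x}"
proof (intro equalityI subsetI)
  fix y assume x: "x \<in> space M" and y: "y \<in> (\<Inter>n. cell n x)"
  have "y \<in> space M"
    using y cell.simps(1) by blast
  have "y = x"
  proof (rule ccontr)
    assume "y \<noteq> x"
    then obtain n where n: "x \<in> B n" "y \<notin> B n"
      using separating[OF x \<open>y \<in> space M\<close>] by auto
    have "y \<in> cell (Suc n) x"
      using y by blast
    with n show False by simp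
  qed
  then show "y \<in> {x}" by simp
qed (auto simp: cell_self)

lemma singleton_sets: "x \<in> space M \<Longrightarrow> {x} \<in> sets M"
  using sets.countable_INT[of "\<lambda>n. cell n x" UNIV M] by (simp add: Inter_cell image_subset_iff)

lemma q_sums: "x \<in> space M \<Longrightarrow> 0 \<le> s \<Longrightarrow> range A \<subseteq> sets M \<Longrightarrow> disjoint_family A \<Longrightarrow>
    (\<lambda>i. q x s (A i)) sums q x s (\<Union>i. A i)"
  using Q by (simp add: Q_function_def signed_kernel_def)

lemma q_empty: "x \<in> space M \<Longrightarrow> 0 \<le> s \<Longrightarrow> q x s {} = 0"
  using q_sums[of x s "\<lambda>_. {}"] by (auto simp: disjoint_family_on_def sums_iff summable_const_iff)

lemma q_Un:
  assumes "x \<in> space M" "0 \<le> s" "A \<in> sets M" "C \<in> sets M" "A \<inter> C = {}"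
  shows "q x s (A \<union> C) = q x s A + q x s C"
proof -
  have "(\<lambda>i. q x s (binaryset A C i)) sums q x s (\<Union>i. binaryset A C i)"
    using assms by (intro q_sums) (auto simp: range_binaryset_eq disjoint_family_on_def binaryset_def)
  then have "(\<lambda>i. q x s (binaryset A C i)) sums q x s (A \<union> C)"
    by (simp add: UN_binaryset_eq)
  moreover have "(\<lambda>i. q x s (binaryset A C i)) sums (q x s A + q x s C)"
    using assms by (intro binaryset_sums) (simp add: q_empty)
  ultimately show ?thesis
    by (rule sums_unique2)
qed

lemma q_Diff:
  assumes "x \<in> space M" "0 \<le> s" "A \<in> sets M" "C \<in> sets M"
  shows "q x s (A - C) = q x s A - q x s (A \<inter> C)"
proof -
  have "q x s ((A - C) \<union> (A \<inter> C)) = q x s (A - C) + q x s (A \<inter> C)"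
    using assms by (intro q_Un) auto
  also have "(A - C) \<union> (A \<inter> C) = A" by auto
  finally show ?thesis by simp
qed

lemma q_nonneg: "x \<in> space M \<Longrightarrow> 0 \<le> s \<Longrightarrow> A \<in> sets M \<Longrightarrow> x \<notin> A \<Longrightarrow> 0 \<le> q x s A"
  using Q by (simp add: Q_function_def)

lemma emeasure_off_diag:
  assumes "x \<in> space M" "0 \<le> s" "\<Gamma> \<in> sets M"
  shows "emeasure (off_diag M q x s) \<Gamma> = ennreal (q x s (\<Gamma> - {x}))"
  unfolding off_diag_def
proof (rule emeasure_measure_of_sigma[OF sets.sigma_algebra_axioms])
  have d: "A - {x} \<in> sets M" if "A \<in> sets M" for A
    using singleton_sets[OF assms(1)] that by auto
  show "positive (sets M) (\<lambda>\<Gamma>. ennreal (q x s (\<Gamma> - {x})))"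
    using assms by (simp add: positive_def q_empty)
  show "countably_additive (sets M) (\<lambda>\<Gamma>. ennreal (q x s (\<Gamma> - {x})))"
  proof (rule countably_additiveI)
    fix A :: "nat \<Rightarrow> 'a set" assume A: "range A \<subseteq> sets M" "disjoint_family A"
    have "(\<lambda>i. q x s (A i - {x})) sums q x s (\<Union>i. A i - {x})"
      using A assms d by (intro q_sums) (auto simp: disjoint_family_on_def)
    also have "(\<Union>i. A i - {x}) = (\<Union>i. A i) - {x}"
      by auto
    finally show "(\<Sum>i. ennreal (q x s (A i - {x}))) = ennreal (q x s ((\<Union>i. A i) - {x}))"
      using A assms d by (intro suminf_ennreal_eq) (auto intro!: q_nonneg)
  qed
qed fact

lemma exit_rate_eq: "x \<in> space M \<Longrightarrow> 0 \<le> s \<Longrightarrow> exit_rate q x s = q x s (space M - {x})"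
  using Q q_Diff[of x s "space M" "{x}"] singleton_sets[of x]
  by (simp add: exit_rate_def Q_function_def)

lemma measurable_q[measurable]: "\<Gamma> \<in> sets M \<Longrightarrow> (\<lambda>w. q (fst w) (snd w) \<Gamma>) \<in> borel_measurable (M \<Otimes>\<^sub>M time_space)"
  using Q by (simp add: Q_function_def signed_kernel_def split_beta')

text \<open>Whether x lies in \<open>B n\<close> decides if \<open>C\<close> is replaced by its part
  inside or outside \<open>B n\<close>. The moving set thus loses one level at a time, which is why
  \<open>C\<close> is arbitrary in the induction.\<close>

lemma measurable_q_Int_cell:
  "C \<in> sets M \<Longrightarrow> (\<lambda>w. q (fst w) (snd w) (C \<inter> cell n (fst w))) \<in> borel_measurable (M \<Otimes>\<^sub>M time_space)"
proof (induction n arbitrary: C)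
  case 0
  then show ?case
    using sets.Int_space_eq2[OF 0] by simp
next
  case (Suc n)
  have "(\<lambda>w. if fst w \<in> B n then q (fst w) (snd w) ((C \<inter> B n) \<inter> cell n (fst w))
      else q (fst w) (snd w) ((C - B n) \<inter> cell n (fst w))) \<in> borel_measurable (M \<Otimes>\<^sub>M time_space)"
    using Suc.prems by (intro measurable_If Suc.IH) auto
  also have "(\<lambda>w. if fst w \<in> B n then q (fst w) (snd w) ((C \<inter> B n) \<inter> cell n (fst w))
      else q (fst w) (snd w) ((C - B n) \<inter> cell n (fst w))) = (\<lambda>w. q (fst w) (snd w) (C \<inter> cell (Suc n) (fst w)))"
  proof
    fix w :: "'a \<times> real"
    have "(C - B n) \<inter> cell n (fst w) = C \<inter> ((space M - B n) \<inter> cell n (fst w))"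
      using sets.sets_into_space[OF Suc.prems] by auto
    then show "(if fst w \<in> B n then q (fst w) (snd w) ((C \<inter> B n) \<inter> cell n (fst w))
      else q (fst w) (snd w) ((C - B n) \<inter> cell n (fst w))) = q (fst w) (snd w) (C \<inter> cell (Suc n) (fst w))"
      by (simp add: Int_assoc)
  qed
  finally show ?case .
qed

text \<open>The sets \<Gamma> - \<open>cell n x\<close> avoid x and increase to \<Gamma> - {x}, so
  continuity from below gives the off-diagonal mass as a limit of measurable differences.\<close>

lemma measurable_emeasure_off_diag:
  assumes \<Gamma>: "\<Gamma> \<in> sets M"
  shows "(\<lambda>w. emeasure (off_diag M q (fst w) (snd w)) \<Gamma>) \<in> borel_measurable (M \<Otimes>\<^sub>M time_space)"
proof (rule borel_measurable_LIMSEQ_order)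
  show "(\<lambda>w. ennreal (q (fst w) (snd w) \<Gamma> - q (fst w) (snd w) (\<Gamma> \<inter> cell n (fst w))))
    \<in> borel_measurable (M \<Otimes>\<^sub>M time_space)" for n
    using \<Gamma> measurable_q_Int_cell[OF \<Gamma>] by measurable
  fix w assume "w \<in> space (M \<Otimes>\<^sub>M time_space)"
  then obtain x s where w: "w = (x, s)" "x \<in> space M" "0 \<le> s"
    by (auto simp: space_pair_measure)
  have "off_diag M q x s (\<Gamma> - cell n x) = ennreal (q x s \<Gamma> - q x s (\<Gamma> \<inter> cell n x))" for n
  proof -
    have "\<Gamma> - cell n x - {x} = \<Gamma> - cell n x"
      using cell_self[OF w(2)] by auto
    then show ?thesis
      using \<Gamma> w by (simp add: emeasure_off_diag q_Diff)
  qed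
  moreover have "(\<lambda>n. off_diag M q x s (\<Gamma> - cell n x)) \<longlonglongrightarrow> off_diag M q x s (\<Union>n. \<Gamma> - cell n x)"
    using \<Gamma> cell_antimono
    by (intro Lim_emeasure_incseq)
       (auto simp: off_diag_def sets.space_closed sets.sigma_sets_eq incseq_def)
  moreover have "(\<Union>n. \<Gamma> - cell n x) = \<Gamma> - {x}"
    using Inter_cell[OF w(2)] by blast
  moreover have "off_diag M q x s (\<Gamma> - {x}) = off_diag M q x s \<Gamma>"
    using \<Gamma> w singleton_sets by (simp add: emeasure_off_diag)
  ultimately show "(\<lambda>n. ennreal (q (fst w) (snd w) \<Gamma> - q (fst w) (snd w) (\<Gamma> \<inter> cell n (fst w))))
      \<longlonglongrightarrow> emeasure (off_diag M q (fst w) (snd w)) \<Gamma>"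
    using w by simp
qed

sublocale jump_rate M q
proof
  show "(\<lambda>(x, s). emeasure (off_diag M q x (max 0 s)) \<Gamma>) \<in> borel_measurable (M \<Otimes>\<^sub>M borel)"
    if "\<Gamma> \<in> sets M" for \<Gamma>
  proof -
    have "(\<lambda>w. (fst w, max 0 (snd w))) \<in> measurable (M \<Otimes>\<^sub>M borel) (M \<Otimes>\<^sub>M time_space)"
      by (intro measurable_Pair measurable_fst measurable_restrict_space2) auto
    from measurable_compose[OF this measurable_emeasure_off_diag[OF that]] show ?thesis
      by (simp add: split_beta')
  qed
  show "emeasure (off_diag M q x s) (space M) = ennreal (exit_rate q x s)" if "x \<in> space M" "0 \<le> s" for x s
    using that by (simp add: emeasure_off_diag exit_rate_eq)
  show "0 \<le> exit_rate q x s" if "x \<in> space M" "0 \<le> s" for x s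
    using that singleton_sets[of x] by (auto simp: exit_rate_eq intro!: q_nonneg)
  show "\<exists>b. \<forall>s\<ge>0. exit_rate q x s \<le> b" if "x \<in> space M" for x
  proof -
    have "bdd_above ((\<lambda>s. q x s (space M - {x})) ` {0..})"
      using Q that by (simp add: Q_function_def)
    then show ?thesis
      using that by (auto simp: bdd_above_def exit_rate_eq)
  qed
qed (fact nonempty)

lemma off_diag_self: "x \<in> space M \<Longrightarrow> 0 \<le> s \<Longrightarrow> emeasure (off_diag M q x s) {x} = 0"
  by (simp add: emeasure_off_diag singleton_sets q_empty)

end

text \<open>A countable base of the Polish topology, cut down to \<open>S\<close>, separates the
  points of \<open>S\<close>.\<close>

lemma separated_Q_function_restrict_borel:
  fixes S :: "'a::polish_space set"
  assumes "S \<noteq> {}" "S \<in> sets borel" "Q_function (restrict_space borel S) q"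
  shows "\<exists>B. separated_Q_function (restrict_space borel S) q B"
proof -
  obtain \<B> :: "'a set set" where \<B>: "countable \<B>" "topological_basis \<B>"
    using ex_countable_basis by auto
  \<comment> \<open>Only for a nonempty base are all values of \<open>from_nat_into\<close> basic
    open sets.\<close>
  have ne: "\<B> \<noteq> {}"
    using topological_basisE[OF \<B>(2) open_UNIV UNIV_I] by blast
  define B where "B n = from_nat_into \<B> n \<inter> S" for n
  have "separated_Q_function (restrict_space borel S) q B"
  proof
    show "B n \<in> sets (restrict_space borel S)" for n
    proof -
      have "open (from_nat_into \<B> n)"
        using topological_basis_open[OF \<B>(2) from_nat_into[OF ne]] .
      then show ?thesis
        using assms(2) by (auto simp: B_def sets_restrict_space)
    qed
    show "\<exists>n. x \<in> B n \<and> y \<notin> B n"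
      if "x \<in> space (restrict_space borel S)" "x \<noteq> y" for x y
    proof -
      obtain U where "open U" "x \<in> U" "y \<notin> U"
        using t1_space[OF \<open>x \<noteq> y\<close>] by auto
      then obtain V where "V \<in> \<B>" "x \<in> V" "V \<subseteq> U"
        using topological_basisE[OF \<B>(2)] by metis
      then show ?thesis
        using from_nat_into_surj[OF \<B>(1) \<open>V \<in> \<B>\<close>] that \<open>y \<notin> U\<close>
        by (auto simp: B_def space_restrict_space)
    qed
  qed (use assms in \<open>auto simp: space_restrict_space\<close>)
  then show ?thesis by blast
qed

section \<open>The transformed Q-function\<close>

text \<open>The two facts about singletons make removal of x invisible to integrals over
  \<open>off_diag M q x s\<close>, so the rates q^f out of \<open>Some x\<close> become plain
  integrals of f.\<close>

locale drift_setting = jump_rate +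
  fixes c :: real and f :: "'a \<Rightarrow> real"
  assumes singleton_sets: "\<And>x. x \<in> space M \<Longrightarrow> {x} \<in> sets M"
    and off_diag_self: "\<And>x s. x \<in> space M \<Longrightarrow> 0 \<le> s \<Longrightarrow> emeasure (off_diag M q x s) {x} = 0"
    and drift: "drift_function M q c f" and c_nonneg: "0 \<le> c"
begin

abbreviation qf :: "'a option rate" where "qf \<equiv> f_transform M q c f"

lemma measurable_f[measurable]: "f \<in> borel_measurable M"
  and f_pos: "x \<in> space M \<Longrightarrow> 0 < f x"
  and f_finite: "x \<in> space M \<Longrightarrow> 0 \<le> s \<Longrightarrow> (\<integral>\<^sup>+y. ennreal (f y) \<partial>off_diag M q x s) < \<infinity>"
  and q_integral_le: "x \<in> space M \<Longrightarrow> 0 \<le> s \<Longrightarrow> q_integral M q f x s \<le> c * f x"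
  using drift by (auto simp: drift_function_def)

lemma f_nonneg: "x \<in> space M \<Longrightarrow> 0 \<le> f x"
  using f_pos[of x] by simp

lemma measurable_off_diag_cong: "measurable (off_diag M q x s) N = measurable M N"
  by (rule measurable_cong_sets) simp_all

lemma integrable_f: "x \<in> space M \<Longrightarrow> 0 \<le> s \<Longrightarrow> integrable (off_diag M q x s) f"
  using f_finite[of x s]
  by (intro integrableI_nonneg) (auto simp: measurable_off_diag_cong intro!: AE_I2 f_nonneg)

lemma nn_integral_f:
  assumes "x \<in> space M" "0 \<le> s"
  shows "(\<integral>\<^sup>+y. ennreal (f y) \<partial>off_diag M q x s) = ennreal (LINT y|off_diag M q x s. f y)"
  using integrable_f[OF assms] by (intro nn_integral_eq_integral) (auto intro!: AE_I2 f_nonneg)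

lemma integral_f_nonneg: "x \<in> space M \<Longrightarrow> 0 \<le> (LINT y|off_diag M q x s. f y)"
  by (intro integral_nonneg_AE AE_I2) (auto intro: f_nonneg)

text \<open>f(y) times the rate of jumping from y to delta. The factor f(y) is kept because it
  cancels against the weights f(y)/f(x) of the transformed paths.\<close>

definition kill :: "'a \<Rightarrow> real \<Rightarrow> real" where
  "kill y s = c * f y - q_integral M q f y (max 0 s)"

lemma kill_nonneg: "y \<in> space M \<Longrightarrow> 0 \<le> kill y s"
  by (simp add: kill_def q_integral_le)

lemma measurable_q_integral[measurable (raw)]:
  assumes [measurable]: "a \<in> measurable W M" "b \<in> borel_measurable W"
  shows "(\<lambda>w. q_integral M q f (a w) (max 0 (b w))) \<in> borel_measurable W"
proof -
  have "(\<lambda>w. enn2real (\<integral>\<^sup>+y. ennreal (f y) \<partial>Q (a w) (b w)) - rate (a w) (b w) * f (a w)) \<in> borel_measurable W"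
    by measurable
  also have "?this \<longleftrightarrow> ?thesis"
    using measurable_space[OF assms(1)]
    by (intro measurable_cong) (simp add: q_integral_def nn_integral_f integral_f_nonneg rate_def)
  finally show ?thesis .
qed

lemma measurable_kill[measurable (raw)]:
  assumes [measurable]: "a \<in> measurable W M" "b \<in> borel_measurable W"
  shows "(\<lambda>w. kill (a w) (b w)) \<in> borel_measurable W"
  unfolding kill_def by measurable

text \<open>The integral of \<open>g\<close> against the off-diagonal part of q^f at
  \<open>Some x\<close>, written as a functional so that \<open>functional_representation\<close>
  applies.\<close>

definition trans_integral :: "'a \<Rightarrow> real \<Rightarrow> ('a option \<Rightarrow> ennreal) \<Rightarrow> ennreal" where
  "trans_integral x s g = ennreal (1 / f x) * (\<integral>\<^sup>+z. ennreal (f z) * g (Some z) \<partial>Q x s) +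
    ennreal (kill x s / f x) * g None"

lemma measurable_comp_Some: "g \<in> measurable (adjoin M) N \<Longrightarrow> (\<lambda>z. g (Some z)) \<in> measurable M N"
  by (rule measurable_compose[OF measurable_Some])

lemma transform_off_eq:
  assumes x: "x \<in> space M" and s: "0 \<le> s" and \<Gamma>: "\<Gamma> \<in> sets (adjoin M)"
  shows "ennreal (transform_off M q c f (Some x) s (\<Gamma> - {Some x})) = trans_integral x s (indicator \<Gamma>)"
proof -
  let ?A = "{z \<in> space M. Some z \<in> \<Gamma>}" and ?A' = "{z \<in> space M. Some z \<in> \<Gamma> - {Some x}}"
  have [measurable]: "?A \<in> sets M"
    using \<Gamma> by (simp add: sets_adjoin)
  have A': "?A' = ?A - {x}" by auto
  have [measurable]: "?A' \<in> sets M"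
    unfolding A' using singleton_sets[OF x] by measurable
  have AE: "AE z in off_diag M q x s. z \<noteq> x"
    using singleton_sets[OF x] off_diag_self[OF x s] by (intro AE_I[where N="{x}"]) auto
  have "integrable (off_diag M q x s) (\<lambda>z. indicator ?A' z *\<^sub>R f z)"
    by (rule integrable_mult_indicator[OF _ integrable_f[OF x s]]) (simp only: sets_off_diag, measurable)
  then have "ennreal (LINT z:?A'|off_diag M q x s. f z) = (\<integral>\<^sup>+z. ennreal (indicator ?A' z * f z) \<partial>off_diag M q x s)"
    unfolding set_lebesgue_integral_def real_scaleR_def
    by (rule nn_integral_eq_integral[symmetric]) (auto intro!: AE_I2 mult_nonneg_nonneg f_nonneg)
  also have "\<dots> = (\<integral>\<^sup>+z. ennreal (f z) * indicator \<Gamma> (Some z) \<partial>off_diag M q x s)"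
    using AE AE_space by (intro nn_integral_cong_AE, eventually_elim) (auto simp: indicator_def)
  finally have 1: "ennreal (LINT z:?A'|off_diag M q x s. f z) =
    (\<integral>\<^sup>+z. ennreal (f z) * indicator \<Gamma> (Some z) \<partial>off_diag M q x s)" .
  have nn: "0 \<le> (LINT z:?A'|off_diag M q x s. f z)"
    unfolding set_lebesgue_integral_def
    by (intro integral_nonneg_AE AE_I2) (auto intro!: mult_nonneg_nonneg f_nonneg)
  have k: "c - 1 / f x * q_integral M q f x s = kill x s / f x"
    using f_pos[OF x] s by (simp add: kill_def field_simps)
  have "ennreal (1 / f x * (LINT z:?A'|off_diag M q x s. f z)) =
      ennreal (1 / f x) * (\<integral>\<^sup>+z. ennreal (f z) * indicator \<Gamma> (Some z) \<partial>off_diag M q x s)"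
    unfolding 1[symmetric] using f_nonneg[OF x] by (intro ennreal_mult') simp
  moreover have "ennreal (if None \<in> \<Gamma> then kill x s / f x else 0) =
      ennreal (kill x s / f x) * indicator \<Gamma> None"
    by simp
  moreover have "transform_off M q c f (Some x) s (\<Gamma> - {Some x}) =
    1 / f x * (LINT z:?A'|off_diag M q x s. f z) + (if None \<in> \<Gamma> then kill x s / f x else 0)"
    by (simp add: transform_off_def k[simplified])
  moreover have "ennreal (1 / f x * (LINT z:?A'|off_diag M q x s. f z) + (if None \<in> \<Gamma> then kill x s / f x else 0)) =
    ennreal (1 / f x * (LINT z:?A'|off_diag M q x s. f z)) + ennreal (if None \<in> \<Gamma> then kill x s / f x else 0)"
    using f_nonneg[OF x] nn kill_nonneg[OF x, of s] by (intro ennreal_plus) (auto intro!: mult_nonneg_nonneg divide_nonneg_nonneg)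
  ultimately show ?thesis
    using s by (simp only: trans_integral_def max_absorb2)
qed

lemma off_diag_transform_Some:
  assumes x: "x \<in> space M" and s: "0 \<le> s"
  shows "off_diag (adjoin M) qf (Some x) s =
    measure_of (space (adjoin M)) (sets (adjoin M)) (\<lambda>\<Gamma>. trans_integral x s (indicator \<Gamma>))"
  unfolding off_diag_def
proof (rule measure_of_eq[OF sets.space_closed])
  fix \<Gamma> assume "\<Gamma> \<in> sigma_sets (space (adjoin M)) (sets (adjoin M))"
  then have "\<Gamma> \<in> sets (adjoin M)"
    by (simp add: sets.sigma_sets_eq)
  then show "ennreal (qf (Some x) s (\<Gamma> - {Some x})) = trans_integral x s (indicator \<Gamma>)"
    using transform_off_eq[OF assms] by (simp add: f_transform_def)
qed

lemma
  assumes x: "x \<in> space M" and s: "0 \<le> s"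
  shows emeasure_transform_Some: "\<Gamma> \<in> sets (adjoin M) \<Longrightarrow>
      emeasure (off_diag (adjoin M) qf (Some x) s) \<Gamma> = trans_integral x s (indicator \<Gamma>)"
    and nn_integral_transform_Some: "g \<in> borel_measurable (adjoin M) \<Longrightarrow>
      (\<integral>\<^sup>+z. g z \<partial>off_diag (adjoin M) qf (Some x) s) = trans_integral x s g"
proof -
  have 1: "trans_integral x s g = trans_integral x s h" if "\<And>p. p \<in> space (adjoin M) \<Longrightarrow> g p = h p" for g h
    unfolding trans_integral_def using that
    by (intro arg_cong2[where f="(+)"] arg_cong2[where f="(*)"] nn_integral_cong refl)
       (auto simp: space_adjoin)
  have 2: "trans_integral x s (\<lambda>p. g p + h p) = trans_integral x s g + trans_integral x s h"
    if "g \<in> borel_measurable (adjoin M)" "h \<in> borel_measurable (adjoin M)" for g h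
    using that[THEN measurable_comp_Some] unfolding trans_integral_def
    by (simp add: nn_integral_add measurable_off_diag_cong algebra_simps)
  have 3: "trans_integral x s (\<lambda>p. k * g p) = k * trans_integral x s g"
    if "g \<in> borel_measurable (adjoin M)" for k g
    using measurable_comp_Some[OF that] unfolding trans_integral_def
    by (simp add: nn_integral_cmult measurable_off_diag_cong algebra_simps)
  have 4: "trans_integral x s (\<lambda>p. SUP i. U i p) = (SUP i. trans_integral x s (U i))"
    if U: "\<And>i. U i \<in> borel_measurable (adjoin M)" and inc: "incseq U" for U :: "nat \<Rightarrow> _"
  proof -
    have mono: "U i p \<le> U j p" if "i \<le> j" for i j p
      using that inc by (auto simp: incseq_def le_fun_def)
    have "trans_integral x s (\<lambda>p. SUP i. U i p) =
      (SUP i. ennreal (1 / f x) * (\<integral>\<^sup>+z. ennreal (f z) * U i (Some z) \<partial>Q x s)) +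
      (SUP i. ennreal (kill x s / f x) * U i None)"
      using U[THEN measurable_comp_Some] unfolding trans_integral_def
      by (simp add: SUP_mult_left_ennreal nn_integral_monotone_convergence_SUP measurable_off_diag_cong
          incseq_def le_fun_def mono mult_left_mono)
    also have "\<dots> = (SUP i. trans_integral x s (U i))"
      unfolding trans_integral_def
      by (intro ennreal_SUP_add[symmetric])
         (auto simp: incseq_def intro!: nn_integral_mono mult_left_mono mono)
    finally show ?thesis .
  qed
  note rep = functional_representation[of "adjoin M" "trans_integral x s", OF 1 2 3 4,
      folded off_diag_transform_Some[OF assms]]
  show "emeasure (off_diag (adjoin M) qf (Some x) s) \<Gamma> = trans_integral x s (indicator \<Gamma>)"
    if "\<Gamma> \<in> sets (adjoin M)"
    by (rule rep(1)) (use that in auto)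
  show "(\<integral>\<^sup>+z. g z \<partial>off_diag (adjoin M) qf (Some x) s) = trans_integral x s g"
    if "g \<in> borel_measurable (adjoin M)"
    by (rule rep(2)) (use that in auto)
qed

lemma emeasure_transform_None: "emeasure (off_diag (adjoin M) qf None s) \<Gamma> = 0"
proof -
  have "off_diag (adjoin M) qf None s = null_measure (adjoin M)"
    by (rule measure_eqI)
       (simp_all add: off_diag_def f_transform_def transform_off_def emeasure_measure_of_conv
         sets.space_closed sets.sigma_sets_eq)
  then show ?thesis by simp
qed

text \<open>The f-weighted mass moved within S cancels against the same integral inside the rate to
  delta; what survives of \<open>q_integral\<close> is its diagonal term.\<close>

lemma exit_rate_transform_Some:
  assumes "x \<in> space M" "0 \<le> s"
  shows "exit_rate qf (Some x) s = c + exit_rate q x s"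
proof -
  have "{z \<in> space M. Some z \<in> space (adjoin M) - {Some x}} = space M - {x}"
    by (auto simp: space_adjoin)
  moreover have "(LINT z:space M - {x}|off_diag M q x s. f z) = (LINT z|off_diag M q x s. f z)"
  proof -
    have "AE z in off_diag M q x s. z \<noteq> x"
      using singleton_sets off_diag_self assms by (intro AE_I[where N="{x}"]) auto
    then have "AE z in off_diag M q x s. indicator (space M - {x}) z *\<^sub>R f z = f z"
      using AE_space by eventually_elim simp
    then show ?thesis
      unfolding set_lebesgue_integral_def using singleton_sets[OF assms(1)]
      by (intro integral_cong_AE) (auto simp: measurable_off_diag_cong)
  qed
  ultimately show ?thesis
    using f_pos[OF assms(1)]
    by (simp add: exit_rate_def f_transform_def transform_off_def q_integral_def set_lebesgue_integral_def
        space_adjoin field_simps)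
qed

lemma exit_rate_transform_None: "exit_rate qf None s = 0"
  by (simp add: exit_rate_def f_transform_def transform_off_def)

lemma kill_eq: "x \<in> space M \<Longrightarrow> 0 \<le> s \<Longrightarrow>
    (LINT y|off_diag M q x s. f y) + kill x s = (c + exit_rate q x s) * f x"
  by (simp add: kill_def q_integral_def algebra_simps)

text \<open>Makes all results on paths and jump laws available for q^f. Measurability reduces to the
  Some-part, because delta emits nothing.\<close>

sublocale F: jump_rate "adjoin M" qf
proof
  show "space (adjoin M) \<noteq> {}"
    by (simp add: space_adjoin)
  show "(\<lambda>(x, s). emeasure (off_diag (adjoin M) qf x (max 0 s)) \<Gamma>) \<in> borel_measurable (adjoin M \<Otimes>\<^sub>M borel)"
    if \<Gamma>: "\<Gamma> \<in> sets (adjoin M)" for \<Gamma>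
  proof (rule measurable_adjoin_pairI)
    have [measurable]: "(\<lambda>z. indicator \<Gamma> (Some z) :: ennreal) \<in> borel_measurable M"
      using \<Gamma> by (intro measurable_comp_Some) simp
    have "(\<lambda>w. trans_integral (fst w) (max 0 (snd w)) (indicator \<Gamma>)) \<in> borel_measurable (M \<Otimes>\<^sub>M borel)"
      unfolding trans_integral_def by measurable
    also have "?this \<longleftrightarrow> (\<lambda>(y, s). emeasure (off_diag (adjoin M) qf (Some y) (max 0 s)) \<Gamma>) \<in> borel_measurable (M \<Otimes>\<^sub>M borel)"
      by (rule measurable_cong) (auto simp: space_pair_measure emeasure_transform_Some \<Gamma>)
    finally show "(\<lambda>(y, s). emeasure (off_diag (adjoin M) qf (Some y) (max 0 s)) \<Gamma>) \<in> borel_measurable (M \<Otimes>\<^sub>M borel)" .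
  qed (simp_all add: emeasure_transform_None space_nonempty)
  fix p assume p: "p \<in> space (adjoin M)"
  show "emeasure (off_diag (adjoin M) qf p s) (space (adjoin M)) = ennreal (exit_rate qf p s)" if "0 \<le> s" for s
  proof (cases p)
    case (Some x)
    with p have x: "x \<in> space M" by (auto simp: space_adjoin)
    have "emeasure (off_diag (adjoin M) qf p s) (space (adjoin M)) =
      ennreal (1 / f x) * (\<integral>\<^sup>+z. ennreal (f z) \<partial>off_diag M q x s) + ennreal (kill x s / f x)"
    proof -
      have "(\<integral>\<^sup>+z. ennreal (f z) * indicator (space (adjoin M)) (Some z) \<partial>off_diag M q x s) =
        (\<integral>\<^sup>+z. ennreal (f z) \<partial>off_diag M q x s)"
        by (intro nn_integral_cong) (simp add: space_adjoin)
      moreover have "indicator (space (adjoin M)) None = (1 :: ennreal)"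
        by (simp add: space_adjoin)
      ultimately show ?thesis
        unfolding Some emeasure_transform_Some[OF x that sets.top] trans_integral_def
        using that by simp
    qed
    also have "\<dots> = ennreal ((LINT y|off_diag M q x s. f y) / f x + kill x s / f x)"
      using f_pos[OF x] integral_f_nonneg[OF x, of s] kill_nonneg[OF x, of s] x that
      by (simp add: nn_integral_f ennreal_mult'[symmetric] ennreal_plus[symmetric] del: ennreal_plus)
    also have "\<dots> = ennreal (exit_rate qf p s)"
      using kill_eq[OF x that] f_pos[OF x] Some x that
      by (simp add: exit_rate_transform_Some add_divide_distrib[symmetric])
    finally show ?thesis .
  qed (simp add: emeasure_transform_None exit_rate_transform_None)
  show "0 \<le> exit_rate qf p s" if "0 \<le> s" for s
    using p that c_nonneg
    by (auto simp: space_adjoin exit_rate_transform_Some exit_rate_transform_None exit_rate_nonneg)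
  show "\<exists>B. \<forall>s\<ge>0. exit_rate qf p s \<le> B"
    using p
  proof (cases p)
    case (Some x)
    with p have x: "x \<in> space M" by (auto simp: space_adjoin)
    obtain B where "\<forall>s\<ge>0. exit_rate q x s \<le> B"
      using exit_rate_bounded[OF x] by auto
    then show ?thesis
      using Some x by (intro exI[of _ "c + B"]) (simp add: exit_rate_transform_Some)
  qed (auto simp: exit_rate_transform_None)
qed

section \<open>Transformed paths that stay in S\<close>

lemma F_stay_Some:
  assumes x: "x \<in> space M" and "s \<le> t"
  shows "F.stay (Some x) s t = exp (- c * (t - s)) * stay x s t"
proof -
  note [measurable] = x
  obtain B where "\<And>s. rate x s \<le> B"
    using rate_bounded[OF x] by blast
  then have "set_integrable lborel {s..t} (rate x)"
    by (intro set_integrable_bounded_Icc[where B=B]) (auto simp: abs_of_nonneg rate_nonneg x)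
  moreover have "F.rate (Some x) v = c + rate x v" for v
    by (simp add: F.rate_def rate_def exit_rate_transform_Some x)
  ultimately have "(LINT v:{s..t}|lborel. F.rate (Some x) v) = c * (t - s) + (LINT v:{s..t}|lborel. rate x v)"
    using \<open>s \<le> t\<close> set_integral_add(2)[of lborel "{s..t}" "\<lambda>_. c" "rate x"]
      set_integrable_bounded_Icc[of "\<lambda>_. c" "\<bar>c\<bar>" s t]
    by (simp add: set_integral_const)
  then show ?thesis
    by (simp add: F.stay_def stay_def exp_add[symmetric] algebra_simps)
qed

lemma F_stay_None: "F.stay None s t = 1"
  by (simp add: F.stay_def F.rate_def exit_rate_transform_None set_lebesgue_integral_def)

text \<open>Delta is absorbing, so from there only the term without jumps is nonzero.\<close>

lemma F_T_None: "F.T n H s None t = (if n = 0 then H t None else 0)"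
proof (cases n)
  case (Suc m)
  have "(\<integral>\<^sup>+z. F.T m H u z t \<partial>F.Q None u) = 0" for u
  proof -
    have "AE z in F.Q None u. F.T m H u z t = 0"
      by (intro AE_I[where N="space (adjoin M)"]) (auto simp: emeasure_transform_None)
    then have "(\<integral>\<^sup>+z. F.T m H u z t \<partial>F.Q None u) = (\<integral>\<^sup>+z. 0 \<partial>F.Q None u)"
      by (rule nn_integral_cong_AE)
    then show ?thesis by simp
  qed
  then show ?thesis
    by (simp add: Suc)
qed (simp add: F_stay_None)

lemma measurable_fun_adjoin: "(\<lambda>(t :: real, p). if p = None then a else b :: ennreal) \<in> borel_measurable (borel \<Otimes>\<^sub>M adjoin M)"
proof -
  have [measurable]: "Measurable.pred (adjoin M) (\<lambda>p. p = None)"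
    by (rule measurable_adjoinI) auto
  show ?thesis
    by measurable
qed

lemma F_step:
  assumes x: "x \<in> space M" and H: "(\<lambda>(t, y). H t y) \<in> borel_measurable (borel \<Otimes>\<^sub>M adjoin M)"
  shows "(\<integral>\<^sup>+z. F.T n H u z t \<partial>F.Q (Some x) u) =
    ennreal (1 / f x) * (\<integral>\<^sup>+z. ennreal (f z) * F.T n H u (Some z) t \<partial>Q x u) +
    ennreal (kill x u / f x) * F.T n H u None t"
proof -
  have "(\<lambda>z. F.T n H u z t) \<in> borel_measurable (adjoin M)"
    by (rule F.measurable_T[OF _ _ _ H]) auto
  then have "(\<integral>\<^sup>+z. F.T n H u z t \<partial>F.Q (Some x) u) = trans_integral x (max 0 u) (\<lambda>z. F.T n H u z t)"
    by (rule nn_integral_transform_Some[OF x max.cobounded1])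
  then show ?thesis
    by (simp only: trans_integral_def kill_def max.left_idem)
qed

text \<open>Along a path the jump weights f(z)/f(x) telescope, and the extra holding factors
  multiply to exp(-c(t-s)) over the whole interval. The induction follows the first jump, where a
  path into delta contributes 0 by \<open>F_T_None\<close>.\<close>

lemma F_T_alive:
  assumes "x \<in> space M" and "s \<le> t"
  shows "F.T n (\<lambda>_ p. if p = None then 0 else 1) s (Some x) t =
    ennreal (exp (- c * (t - s)) / f x) * T n (\<lambda>_ y. ennreal (f y)) s x t"
  using assms
proof (induction n arbitrary: s x)
  case 0
  then show ?case
    using f_pos[of x] stay_nonneg[of x s t]
    by (simp add: F_stay_Some ennreal_mult'[symmetric] mult.assoc[symmetric])
next
  case (Suc n)
  note x = \<open>x \<in> space M\<close>
  let ?H = "\<lambda>(_ :: real) p. if p = None then 0 else 1 :: ennreal" and ?h = "\<lambda>(_ :: real) y. ennreal (f y)"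
  note [measurable] = x measurable_const_fun[of "\<lambda>y. ennreal (f y)"]
  have "ennreal (F.stay (Some x) s u) * (\<integral>\<^sup>+z. F.T n ?H u z t \<partial>F.Q (Some x) u) * indicator {s..t} u =
      ennreal (exp (- c * (t - s)) / f x) *
      (ennreal (stay x s u) * (\<integral>\<^sup>+z. T n ?h u z t \<partial>Q x u) * indicator {s..t} u)" for u
  proof (cases "u \<in> {s..t}")
    case True
    have "(\<integral>\<^sup>+z. F.T n ?H u z t \<partial>F.Q (Some x) u) =
      ennreal (1 / f x) * (\<integral>\<^sup>+z. ennreal (f z) * F.T n ?H u (Some z) t \<partial>Q x u)"
      by (simp add: F_step[OF x measurable_fun_adjoin] F_T_None)
    also have "(\<integral>\<^sup>+z. ennreal (f z) * F.T n ?H u (Some z) t \<partial>Q x u) =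
      (\<integral>\<^sup>+z. ennreal (exp (- c * (t - u))) * T n ?h u z t \<partial>Q x u)"
    proof (intro nn_integral_cong)
      fix z assume "z \<in> space (Q x u)"
      then have "z \<in> space M" by simp
      then show "ennreal (f z) * F.T n ?H u (Some z) t = ennreal (exp (- c * (t - u))) * T n ?h u z t"
        using True Suc.IH[of z u] f_pos[of z]
        by (simp add: mult.assoc[symmetric] ennreal_mult'[symmetric])
    qed
    also have "\<dots> = ennreal (exp (- c * (t - u))) * (\<integral>\<^sup>+z. T n ?h u z t \<partial>Q x u)"
      by (rule nn_integral_cmult) (simp add: measurable_off_diag_cong)
    finally have "ennreal (F.stay (Some x) s u) * (\<integral>\<^sup>+z. F.T n ?H u z t \<partial>F.Q (Some x) u) =
      ennreal (exp (- c * (u - s)) * stay x s u) * (ennreal (1 / f x) * (ennreal (exp (- c * (t - u))) *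
        (\<integral>\<^sup>+z. T n ?h u z t \<partial>Q x u)))"
      using True by (simp add: F_stay_Some[OF x])
    also have "\<dots> = ennreal (exp (- c * (u - s)) * stay x s u * (1 / f x) * exp (- c * (t - u))) *
        (\<integral>\<^sup>+z. T n ?h u z t \<partial>Q x u)"
      using f_pos[OF x] stay_nonneg[of x s u] by (simp add: mult.assoc[symmetric] ennreal_mult'[symmetric])
    also have "exp (- c * (u - s)) * stay x s u * (1 / f x) * exp (- c * (t - u)) =
        exp (- c * (t - s)) / f x * stay x s u"
    proof -
      have "exp (- c * (u - s)) * exp (- c * (t - u)) = exp (- c * (t - s))"
        by (simp add: exp_add[symmetric] algebra_simps)
      then show ?thesis by (simp add: field_simps)
    qed
    also have "ennreal (exp (- c * (t - s)) / f x * stay x s u) =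
        ennreal (exp (- c * (t - s)) / f x) * ennreal (stay x s u)"
      using f_nonneg[OF x] stay_nonneg by (intro ennreal_mult) auto
    finally show ?thesis
      using True by (simp only: mult.assoc indicator_simps mult_1_right)
  qed simp
  then have "F.T (Suc n) ?H s (Some x) t = (\<integral>\<^sup>+u. ennreal (exp (- c * (t - s)) / f x) *
      (ennreal (stay x s u) * (\<integral>\<^sup>+z. T n ?h u z t \<partial>Q x u) * indicator {s..t} u) \<partial>lborel)"
    by simp
  also have "\<dots> = ennreal (exp (- c * (t - s)) / f x) * T (Suc n) ?h s x t"
    by (subst nn_integral_cmult) simp_all
  finally show ?case .
qed

end

context jump_rate
begin

lemma T_mono:
  assumes "\<And>y. y \<in> space M \<Longrightarrow> H t y \<le> H' t y" and "x \<in> space M"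
  shows "T n H s x t \<le> T n H' s x t"
  using assms(2)
proof (induction n arbitrary: s x)
  case (Suc n)
  then show ?case
    by (auto intro!: nn_integral_mono mult_right_mono mult_left_mono)
qed (auto intro!: mult_right_mono assms(1))

lemma T_zero: "T n (\<lambda>_ _. 0) s x t = 0"
  by (induction n arbitrary: s x) simp_all

end

context jump_process
begin

lemma expect_at_eq:
  assumes [measurable]: "h \<in> borel_measurable M" and "0 \<le> t"
  shows "expect_at M q x t h =
    enn2ereal (\<Sum>n. T n (\<lambda>_ y. ennreal (h y)) 0 x t) - enn2ereal (\<Sum>n. T n (\<lambda>_ y. ennreal (- h y)) 0 x t)"
proof -
  have pos: "e2ennreal (case p of None \<Rightarrow> 0 | Some y \<Rightarrow> ereal (h y)) = (case p of None \<Rightarrow> 0 | Some y \<Rightarrow> ennreal (h y))"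
    and neg: "e2ennreal (- (case p of None \<Rightarrow> 0 | Some y \<Rightarrow> ereal (h y))) = (case p of None \<Rightarrow> 0 | Some y \<Rightarrow> ennreal (- h y))"
    for p :: "'a option"
    by (cases p; simp add: e2ennreal_neg)+
  show ?thesis
    unfolding expect_at_def ext_integral_def pos neg
    by (subst (1 2) nn_integral_process_at) (use \<open>0 \<le> t\<close> in simp_all)
qed

end

section \<open>Transformed paths absorbed in delta\<close>

context drift_setting
begin

text \<open>Here \<open>v\<close> is the time of the last jump, the one into delta, preceded by
  \<open>n\<close> jumps within S; hence the shift of the index. As \<open>T\<close> unfolds at the
  first jump, at time \<open>u\<close>, Tonelli is used to move the integral over \<open>v\<close>
  outside those over states and over \<open>u\<close>, on the triangle s \<le> u \<le> v \<le>
  t.\<close>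

lemma F_T_killed:
  assumes "x \<in> space M"
  shows "F.T (Suc n) (\<lambda>_ p. if p = None then 1 else 0) s (Some x) t =
    (\<integral>\<^sup>+v\<in>{s..t}. ennreal (exp (- c * (v - s)) / f x) * T n (\<lambda>v y. ennreal (kill y v)) s x v \<partial>lborel)"
  using assms
proof (induction n arbitrary: s x)
  case 0
  note x = \<open>x \<in> space M\<close>
  have "ennreal (F.stay (Some x) s u) * (ennreal (kill x u / f x) * 1) * indicator {s..t} u =
      ennreal (exp (- c * (u - s)) / f x) * (ennreal (kill x u) * ennreal (stay x s u)) * indicator {s..t} u" for u
    using f_nonneg[OF x] kill_nonneg[OF x, of u] stay_nonneg[of x s u]
    by (auto simp: F_stay_Some[OF x] ennreal_mult'[symmetric] ac_simps split: split_indicator)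
  moreover have "F.T (Suc 0) (\<lambda>_ p. if p = None then 1 else 0) s (Some x) t =
    (\<integral>\<^sup>+u\<in>{s..t}. ennreal (F.stay (Some x) s u) * (ennreal (kill x u / f x) * 1) \<partial>lborel)"
    unfolding F.T.simps(2)[of 0]
    by (subst F_step[OF x measurable_fun_adjoin]) (simp add: F_stay_None)
  ultimately show ?case
    by simp
next
  case (Suc n)
  note x = \<open>x \<in> space M\<close>
  let ?H = "\<lambda>(_ :: real) p. if p = None then 1 else 0 :: ennreal" and ?G = "\<lambda>v y. ennreal (kill y v)"
  have G: "(\<lambda>(v, y). ?G v y) \<in> borel_measurable (borel \<Otimes>\<^sub>M M)"
    by measurable
  note [measurable] = x
  have m[measurable]: "(\<lambda>w. T n ?G (a w) (b w) (d w)) \<in> borel_measurable W"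
    if "a \<in> borel_measurable W" "b \<in> measurable W M" "d \<in> borel_measurable W" for a b d and W :: "'w measure"
    using measurable_T[OF that G] .
  let ?K = "\<lambda>u v. ennreal (exp (- c * (v - s)) / f x) * ennreal (stay x s u)"
  have inner: "ennreal (F.stay (Some x) s u) * (\<integral>\<^sup>+z. F.T (Suc n) ?H u z t \<partial>F.Q (Some x) u) * indicator {s..t} u =
      (\<integral>\<^sup>+v. ?K u v * indicator {s..v} u * indicator {s..t} v * (\<integral>\<^sup>+z. T n ?G u z v \<partial>Q x u) \<partial>lborel)" for u
  proof (cases "u \<in> {s..t}")
    case True
    \<comment> \<open>Tonelli between the new state \<open>z\<close> and the absorption time
      \<open>v\<close> requires sigma-finiteness of the jump measure.\<close>
    interpret Qu: finite_measure "Q x u"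
      by (rule finite_measure_Q[OF x])
    interpret QL: pair_sigma_finite "Q x u" lborel
      by standard
    have "(\<integral>\<^sup>+z. F.T (Suc n) ?H u z t \<partial>F.Q (Some x) u) =
      ennreal (1 / f x) * (\<integral>\<^sup>+z. ennreal (f z) * F.T (Suc n) ?H u (Some z) t \<partial>Q x u)"
      by (subst F_step[OF x measurable_fun_adjoin], subst F_T_None) simp
    also have "(\<integral>\<^sup>+z. ennreal (f z) * F.T (Suc n) ?H u (Some z) t \<partial>Q x u) =
      (\<integral>\<^sup>+z. (\<integral>\<^sup>+v. ennreal (exp (- c * (v - u))) * indicator {u..t} v * T n ?G u z v \<partial>lborel) \<partial>Q x u)"
    proof (intro nn_integral_cong)
      fix z assume "z \<in> space (Q x u)"
      then have z[measurable]: "z \<in> space M" by simp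
      have "ennreal (f z) * F.T (Suc n) ?H u (Some z) t =
        (\<integral>\<^sup>+v. ennreal (f z) * (ennreal (exp (- c * (v - u)) / f z) * T n ?G u z v * indicator {u..t} v) \<partial>lborel)"
        unfolding Suc.IH[OF z] by (rule nn_integral_cmult[symmetric]) measurable
      also have "\<dots> = (\<integral>\<^sup>+v. ennreal (exp (- c * (v - u))) * indicator {u..t} v * T n ?G u z v \<partial>lborel)"
      proof (intro nn_integral_cong)
        fix v
        have eq: "ennreal (f z) * ennreal (exp (- c * (v - u)) / f z) = ennreal (exp (- c * (v - u)))"
          using f_pos[OF z] by (simp add: ennreal_mult'[symmetric])
        show "ennreal (f z) * (ennreal (exp (- c * (v - u)) / f z) * T n ?G u z v * indicator {u..t} v) =
          ennreal (exp (- c * (v - u))) * indicator {u..t} v * T n ?G u z v"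
          unfolding eq[symmetric] by (simp only: mult_ac)
      qed
      finally show "ennreal (f z) * F.T (Suc n) ?H u (Some z) t =
        (\<integral>\<^sup>+v. ennreal (exp (- c * (v - u))) * indicator {u..t} v * T n ?G u z v \<partial>lborel)" .
    qed
    also have "\<dots> = (\<integral>\<^sup>+v. (\<integral>\<^sup>+z. ennreal (exp (- c * (v - u))) * indicator {u..t} v * T n ?G u z v \<partial>Q x u) \<partial>lborel)"
      by (rule QL.Fubini'[symmetric]) measurable
    also have "\<dots> = (\<integral>\<^sup>+v. ennreal (exp (- c * (v - u))) * indicator {u..t} v * (\<integral>\<^sup>+z. T n ?G u z v \<partial>Q x u) \<partial>lborel)"
      by (intro nn_integral_cong nn_integral_cmult) (simp add: measurable_off_diag_cong)
    finally have "ennreal (F.stay (Some x) s u) * (\<integral>\<^sup>+z. F.T (Suc n) ?H u z t \<partial>F.Q (Some x) u) =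
      (ennreal (exp (- c * (u - s)) * stay x s u) * ennreal (1 / f x)) *
      (\<integral>\<^sup>+v. ennreal (exp (- c * (v - u))) * indicator {u..t} v * (\<integral>\<^sup>+z. T n ?G u z v \<partial>Q x u) \<partial>lborel)"
      using True by (simp only: F_stay_Some[OF x] mult.assoc atLeastAtMost_iff)
    also have "\<dots> = (\<integral>\<^sup>+v. (ennreal (exp (- c * (u - s)) * stay x s u) * ennreal (1 / f x)) *
      (ennreal (exp (- c * (v - u))) * indicator {u..t} v * (\<integral>\<^sup>+z. T n ?G u z v \<partial>Q x u)) \<partial>lborel)"
      by (rule nn_integral_cmult[symmetric]) measurable
    also have "\<dots> = (\<integral>\<^sup>+v. ?K u v * indicator {s..v} u * indicator {s..t} v * (\<integral>\<^sup>+z. T n ?G u z v \<partial>Q x u) \<partial>lborel)"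
    proof (intro nn_integral_cong)
      fix v
      have "exp (- c * (u - s)) * exp (- c * (v - u)) = exp (- c * (v - s))"
        by (simp add: exp_add[symmetric] algebra_simps)
      then have "exp (- c * (u - s)) * stay x s u * (1 / f x) * exp (- c * (v - u)) = exp (- c * (v - s)) / f x * stay x s u"
        by (simp add: field_simps)
      then have e: "ennreal (exp (- c * (u - s)) * stay x s u) * ennreal (1 / f x) * ennreal (exp (- c * (v - u))) = ?K u v"
        using f_nonneg[OF x] stay_nonneg[of x s u] by (simp only: ennreal_mult'[symmetric] mult_nonneg_nonneg
          exp_ge_zero divide_nonneg_nonneg zero_le_one)
      \<comment> \<open>The same triangle seen from \<open>v\<close>: after the exchange,
        \<open>u\<close> ranges over \<open>{s..v}\<close>, exactly the domain in the recursion of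
        \<open>T\<close> up to time \<open>v\<close>.\<close>
      have i: "indicator {u..t} v = (indicator {s..v} u * indicator {s..t} v :: ennreal)"
        using True by (auto simp: indicator_def)
      show "(ennreal (exp (- c * (u - s)) * stay x s u) * ennreal (1 / f x)) *
          (ennreal (exp (- c * (v - u))) * indicator {u..t} v * (\<integral>\<^sup>+z. T n ?G u z v \<partial>Q x u)) =
        ?K u v * indicator {s..v} u * indicator {s..t} v * (\<integral>\<^sup>+z. T n ?G u z v \<partial>Q x u)"
        unfolding e[symmetric] i by (simp only: mult_ac)
    qed
    finally show ?thesis
      using True by (simp only: indicator_simps mult_1_right)
  next
    case False
    then have z: "indicator {s..v} u * indicator {s..t} v = (0 :: ennreal)" for v
      by (auto simp: indicator_def)
    have "?K u v * indicator {s..v} u * indicator {s..t} v = 0" for v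
      by (simp only: mult.assoc z mult_zero_right)
    then show ?thesis
      using False by (simp only: mult_zero_left nn_integral_const indicator_simps(2)[OF False] mult_zero_right)
  qed
  have ind[measurable]: "(\<lambda>w. indicator {s..b w} (a w) :: ennreal) \<in> borel_measurable W"
    if [measurable]: "a \<in> borel_measurable W" "b \<in> borel_measurable W" for a b :: "'w \<Rightarrow> real" and W :: "'w measure"
  proof -
    have "(\<lambda>w. if s \<le> a w \<and> a w \<le> b w then 1 else 0 :: ennreal) \<in> borel_measurable W"
      by measurable
    then show ?thesis
      by (simp add: indicator_def)
  qed
  have "F.T (Suc (Suc n)) ?H s (Some x) t =
    (\<integral>\<^sup>+u. \<integral>\<^sup>+v. ?K u v * indicator {s..v} u * indicator {s..t} v * (\<integral>\<^sup>+z. T n ?G u z v \<partial>Q x u) \<partial>lborel \<partial>lborel)"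
    unfolding F.T.simps(2)[of "Suc n"] inner ..
  also have "\<dots> = (\<integral>\<^sup>+v. \<integral>\<^sup>+u. ?K u v * indicator {s..v} u * indicator {s..t} v * (\<integral>\<^sup>+z. T n ?G u z v \<partial>Q x u) \<partial>lborel \<partial>lborel)"
    by (rule lborel_pair.Fubini'[symmetric]) measurable
  also have "\<dots> = (\<integral>\<^sup>+v\<in>{s..t}. ennreal (exp (- c * (v - s)) / f x) * T (Suc n) ?G s x v \<partial>lborel)"
  proof (intro nn_integral_cong)
    fix v
    have "(\<integral>\<^sup>+u. ?K u v * indicator {s..v} u * indicator {s..t} v * (\<integral>\<^sup>+z. T n ?G u z v \<partial>Q x u) \<partial>lborel) =
      (\<integral>\<^sup>+u. (ennreal (exp (- c * (v - s)) / f x) * indicator {s..t} v) *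
        (ennreal (stay x s u) * (\<integral>\<^sup>+z. T n ?G u z v \<partial>Q x u) * indicator {s..v} u) \<partial>lborel)"
      by (simp only: mult_ac)
    also have "\<dots> = (ennreal (exp (- c * (v - s)) / f x) * indicator {s..t} v) * T (Suc n) ?G s x v"
      unfolding T.simps by (rule nn_integral_cmult) measurable
    finally show "(\<integral>\<^sup>+u. ?K u v * indicator {s..v} u * indicator {s..t} v * (\<integral>\<^sup>+z. T n ?G u z v \<partial>Q x u) \<partial>lborel) =
      ennreal (exp (- c * (v - s)) / f x) * T (Suc n) ?G s x v * indicator {s..t} v"
      by (simp only: mult_ac)
  qed
  finally show ?case .
qed

lemma transform_mass:
  assumes x: "x \<in> space M" and "0 \<le> t"
  shows "(\<Sum>n. F.T n (\<lambda>_ _. 1) 0 (Some x) t) =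
    ennreal (exp (- c * t) / f x) * (\<Sum>n. T n (\<lambda>_ y. ennreal (f y)) 0 x t) +
    (\<integral>\<^sup>+v\<in>{0..t}. ennreal (exp (- c * v) / f x) * (\<Sum>n. T n (\<lambda>v y. ennreal (kill y v)) 0 x v) \<partial>lborel)"
proof -
  let ?H0 = "\<lambda>(_ :: real) p. if p = None then 0 else 1 :: ennreal"
  let ?H1 = "\<lambda>(_ :: real) p. if p = None then 1 else 0 :: ennreal"
  let ?G = "\<lambda>v y. ennreal (kill y v)"
  have Sx: "Some x \<in> space (adjoin M)"
    using x by (simp add: space_adjoin)
  note [measurable] = x
  have G: "(\<lambda>(v, y). ?G v y) \<in> borel_measurable (borel \<Otimes>\<^sub>M M)"
    by measurable
  have [measurable]: "(\<lambda>v. T n ?G 0 x v) \<in> borel_measurable borel" for n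
    by (rule measurable_T[OF _ _ _ G]) (simp_all add: x)
  have "F.T n (\<lambda>_ _. 1) 0 (Some x) t = F.T n ?H0 0 (Some x) t + F.T n ?H1 0 (Some x) t" for n
  proof -
    have "F.T n (\<lambda>_ _. 1) 0 (Some x) t = F.T n (\<lambda>t p. ?H0 t p + ?H1 t p) 0 (Some x) t"
      by (rule F.T_cong[OF _ Sx]) simp
    also have "\<dots> = F.T n ?H0 0 (Some x) t + F.T n ?H1 0 (Some x) t"
      by (rule F.T_add[OF measurable_fun_adjoin measurable_fun_adjoin Sx])
    finally show ?thesis .
  qed
  then have "(\<Sum>n. F.T n (\<lambda>_ _. 1) 0 (Some x) t) =
      (\<Sum>n. F.T n ?H0 0 (Some x) t) + (\<Sum>n. F.T n ?H1 0 (Some x) t)"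
    by (simp add: suminf_add)
  also have "(\<Sum>n. F.T n ?H0 0 (Some x) t) =
    ennreal (exp (- c * t) / f x) * (\<Sum>n. T n (\<lambda>_ y. ennreal (f y)) 0 x t)"
    using F_T_alive[OF x \<open>0 \<le> t\<close>] by simp
  \<comment> \<open>Without a jump the path is still at \<open>Some x\<close>, where
    \<open>?H1\<close> vanishes, so the term of index 0 drops out.\<close>
  also have "(\<Sum>n. F.T n ?H1 0 (Some x) t) = (\<Sum>n. F.T (Suc n) ?H1 0 (Some x) t)"
  proof -
    have "(\<lambda>n. F.T n ?H1 0 (Some x) t) sums ((\<Sum>n. F.T (Suc n) ?H1 0 (Some x) t) + F.T 0 ?H1 0 (Some x) t)"
      by (intro sums_Suc summable_sums) simp
    then show ?thesis
      by (simp add: sums_iff)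
  qed
  also have "\<dots> = (\<Sum>n. \<integral>\<^sup>+v. ennreal (exp (- c * v) / f x) * T n ?G 0 x v * indicator {0..t} v \<partial>lborel)"
    unfolding F_T_killed[OF x] by simp
  also have "\<dots> = (\<integral>\<^sup>+v. (\<Sum>n. ennreal (exp (- c * v) / f x) * T n ?G 0 x v * indicator {0..t} v) \<partial>lborel)"
    by (rule nn_integral_suminf[symmetric]) measurable
  finally show ?thesis
    by simp
qed

end

section \<open>Dynkin's formula\<close>

text \<open>Both parts are finite, so the extended difference is an ordinary Bochner integral.
  Almost everywhere agreement suffices, which matters because some expectations are finite only for
  almost all times.\<close>

lemma ext_integral_eq_integral:
  assumes "integrable N g" and "AE \<omega> in N. h \<omega> = ereal (g \<omega>)"
  shows "ext_integral N h = ereal (integral\<^sup>L N g)"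
proof -
  have 1: "(\<integral>\<^sup>+\<omega>. e2ennreal (h \<omega>) \<partial>N) = (\<integral>\<^sup>+\<omega>. ennreal (g \<omega>) \<partial>N)"
    using assms(2) by (intro nn_integral_cong_AE, eventually_elim) simp
  have 2: "(\<integral>\<^sup>+\<omega>. e2ennreal (- h \<omega>) \<partial>N) = (\<integral>\<^sup>+\<omega>. ennreal (- g \<omega>) \<partial>N)"
    using assms(2) by (intro nn_integral_cong_AE, eventually_elim) simp
  obtain a where a: "(\<integral>\<^sup>+\<omega>. ennreal (g \<omega>) \<partial>N) = ennreal a" "0 \<le> a"
    using assms(1) by (cases "\<integral>\<^sup>+\<omega>. ennreal (g \<omega>) \<partial>N") (auto simp: real_integrable_def)
  obtain b where b: "(\<integral>\<^sup>+\<omega>. ennreal (- g \<omega>) \<partial>N) = ennreal b" "0 \<le> b"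
    using assms(1) by (cases "\<integral>\<^sup>+\<omega>. ennreal (- g \<omega>) \<partial>N") (auto simp: real_integrable_def)
  show ?thesis
    unfolding ext_integral_def 1 2 using a b
    by (simp add: real_lebesgue_integral_def[OF assms(1)])
qed

text \<open>Formally both sides say \<phi>' = c \<phi> - \<gamma> with \<phi>(0) = w, the second
  after multiplication by the integrating factor exp(-c t). Integration by parts uses k = -c with W
  = \<phi> in one direction, and k = c with W = exp(-c s) \<phi>(s) in the other. Each needs the
  given identity at all earlier times, so the equivalence is between statements for all t.\<close>

lemma integral_equation_iff:
  fixes \<phi> \<gamma> :: "real \<Rightarrow> real"
  assumes \<phi>: "\<And>t. 0 \<le> t \<Longrightarrow> set_integrable lborel {0..t} \<phi>"
    and \<gamma>: "\<And>t. 0 \<le> t \<Longrightarrow> set_integrable lborel {0..t} \<gamma>"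
  shows "(\<forall>t\<ge>0. \<phi> t - w = (LINT s:{0..t}|lborel. c * \<phi> s - \<gamma> s)) \<longleftrightarrow>
    (\<forall>t\<ge>0. exp (- c * t) * \<phi> t + (LINT s:{0..t}|lborel. exp (- c * s) * \<gamma> s) = w)"
proof (intro iffI allI impI)
  fix t :: real assume t: "0 \<le> t"
  assume A: "\<forall>t\<ge>0. \<phi> t - w = (LINT s:{0..t}|lborel. c * \<phi> s - \<gamma> s)"
  have u: "set_integrable lborel {0..t} (\<lambda>s. c * \<phi> s - \<gamma> s)"
    using \<phi>[OF t] \<gamma>[OF t] by (intro set_integral_diff) auto
  have W: "\<phi> s = w + (LINT r:{0..s}|lborel. c * \<phi> r - \<gamma> r)" if "0 \<le> s" "s \<le> t" for s
    using A[rule_format, OF that(1)] by simp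
  have "(LINT s:{0..t}|lborel. - c * exp (- c * s) * \<phi> s) =
    exp (- c * t) * \<phi> t - w - (LINT s:{0..t}|lborel. exp (- c * s) * (c * \<phi> s - \<gamma> s))"
    using u t W by (rule integral_by_parts_exp)
  also have "(LINT s:{0..t}|lborel. exp (- c * s) * (c * \<phi> s - \<gamma> s)) =
    (LINT s:{0..t}|lborel. c * (exp (- c * s) * \<phi> s)) - (LINT s:{0..t}|lborel. exp (- c * s) * \<gamma> s)"
    using set_integrable_exp_mult[OF \<phi>[OF t], of "- c"] set_integrable_exp_mult[OF \<gamma>[OF t], of "- c"]
    by (subst set_integral_diff(2)[symmetric]) (auto simp: algebra_simps)
  also have "(LINT s:{0..t}|lborel. - c * exp (- c * s) * \<phi> s) = - (LINT s:{0..t}|lborel. c * (exp (- c * s) * \<phi> s))"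
    unfolding set_lebesgue_integral_def mult.assoc mult_minus_left scaleR_minus_right
    by (rule Bochner_Integration.integral_minus)
  finally show "exp (- c * t) * \<phi> t + (LINT s:{0..t}|lborel. exp (- c * s) * \<gamma> s) = w"
    by linarith
next
  fix t :: real assume t: "0 \<le> t"
  assume B: "\<forall>t\<ge>0. exp (- c * t) * \<phi> t + (LINT s:{0..t}|lborel. exp (- c * s) * \<gamma> s) = w"
  have u: "set_integrable lborel {0..t} (\<lambda>s. - (exp (- c * s) * \<gamma> s))"
    using set_integrable_exp_mult[OF \<gamma>[OF t], of "- c"] by (simp add: set_integrable_def)
  have W: "exp (- c * s) * \<phi> s = w + (LINT r:{0..s}|lborel. - (exp (- c * r) * \<gamma> r))" if "0 \<le> s" "s \<le> t" for s
    using B[rule_format, OF that(1)] by (simp add: set_lebesgue_integral_def)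
  have e: "exp (c * s) * exp (- c * s) = 1" for s
    by (simp add: exp_add[symmetric])
  have "(LINT s:{0..t}|lborel. c * exp (c * s) * (exp (- c * s) * \<phi> s)) =
    exp (c * t) * (exp (- c * t) * \<phi> t) - w - (LINT s:{0..t}|lborel. exp (c * s) * - (exp (- c * s) * \<gamma> s))"
    using u t W by (rule integral_by_parts_exp)
  moreover have "c * exp (c * s) * (exp (- c * s) * \<phi> s) = c * \<phi> s" for s
    using e[of s] by algebra
  moreover have "exp (c * s) * - (exp (- c * s) * \<gamma> s) = - \<gamma> s" for s
    using e[of s] by algebra
  moreover have "exp (c * t) * (exp (- c * t) * \<phi> t) = \<phi> t"
    using e[of t] by algebra
  ultimately have "(LINT s:{0..t}|lborel. c * \<phi> s) = \<phi> t - w + (LINT s:{0..t}|lborel. \<gamma> s)"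
    by (simp only:) (simp add: set_lebesgue_integral_def)
  moreover have "(LINT s:{0..t}|lborel. c * \<phi> s - \<gamma> s) =
    (LINT s:{0..t}|lborel. c * \<phi> s) - (LINT s:{0..t}|lborel. \<gamma> s)"
    using \<phi>[OF t] \<gamma>[OF t] by (intro set_integral_diff) auto
  ultimately show "\<phi> t - w = (LINT s:{0..t}|lborel. c * \<phi> s - \<gamma> s)"
    by simp
qed

text \<open>\<open>F t\<close>, \<open>G t\<close> and \<open>A t - B t\<close> stand for the expectations of \<open>f\<close>, of \<open>c f - q f\<close> and of
  \<open>q f\<close> at time \<open>t\<close>; the left-hand side of \<open>mass\<close> is the mass of the transformed transition function.\<close>

lemma dynkin_iff_mass:
  fixes F G A B :: "real \<Rightarrow> ennreal"
  assumes [measurable]: "F \<in> borel_measurable borel" "G \<in> borel_measurable borel"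
    and "0 < w" "0 \<le> c"
    and mass: "\<And>t. 0 \<le> t \<Longrightarrow> ennreal (exp (- c * t) / w) * F t +
      (\<integral>\<^sup>+v\<in>{0..t}. ennreal (exp (- c * v) / w) * G v \<partial>lborel) \<le> 1"
    and balance: "\<And>t. 0 \<le> t \<Longrightarrow> A t + G t = B t + ennreal c * F t"
    and A_le: "\<And>t. 0 \<le> t \<Longrightarrow> A t \<le> ennreal c * F t"
  shows "(\<forall>t\<ge>0. enn2ereal (F t) - ereal w =
      ext_integral (restrict_space lborel {0..t}) (\<lambda>s. enn2ereal (A s) - enn2ereal (B s))) \<longleftrightarrow>
    (\<forall>t\<ge>0. ennreal (exp (- c * t) / w) * F t +
      (\<integral>\<^sup>+v\<in>{0..t}. ennreal (exp (- c * v) / w) * G v \<partial>lborel) = 1)"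
proof -
  define \<phi> where "\<phi> t = enn2real (F t)" for t
  define \<gamma> where "\<gamma> t = enn2real (G t)" for t
  have [measurable]: "\<phi> \<in> borel_measurable borel" "\<gamma> \<in> borel_measurable borel"
    unfolding \<phi>_def \<gamma>_def by measurable
  have \<phi>_nonneg: "0 \<le> \<phi> t" for t
    by (simp add: \<phi>_def)
  \<comment> \<open>Only the first summand of the mass bound is used; it holds at every time, so
    \<open>F\<close> is finite everywhere.\<close>
  have F_le: "F t \<le> ennreal (exp (c * t) * w)" if "0 \<le> t" for t
  proof -
    have "ennreal (exp (c * t) * w) * (ennreal (exp (- c * t) / w) * F t) \<le> ennreal (exp (c * t) * w) * 1"
      using mass[OF that] by (intro mult_left_mono) (auto intro: order_trans[rotated])
    moreover have "ennreal (exp (c * t) * w) * ennreal (exp (- c * t) / w) = 1"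
      using \<open>0 < w\<close> by (simp add: ennreal_mult'[symmetric] exp_add[symmetric] field_simps)
    ultimately show ?thesis
      by (simp add: mult.assoc[symmetric])
  qed
  have F_eq: "F t = ennreal (\<phi> t)" if "0 \<le> t" for t
    using F_le[OF that] by (auto simp: \<phi>_def ennreal_enn2real_if top_unique)
  have \<phi>_le: "\<bar>\<phi> s\<bar> \<le> exp (c * t) * w" if "0 \<le> s" "s \<le> t" for s t
  proof -
    have "\<phi> s \<le> exp (c * s) * w"
      using F_le[OF that(1)] \<open>0 < w\<close> by (simp add: F_eq that)
    also have "\<dots> \<le> exp (c * t) * w"
      using that \<open>0 < w\<close> \<open>0 \<le> c\<close> by (auto intro!: mult_right_mono mult_left_mono)
    finally show ?thesis by (simp add: \<phi>_def)
  qed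
  have \<phi>_int: "set_integrable lborel {0..t} \<phi>" if "0 \<le> t" for t
    unfolding set_integrable_def
    by (rule integrableI_bounded_set_indicator[where B="exp (c * t) * w"])
       (use \<phi>_le in \<open>auto simp: emeasure_lborel_Icc_eq\<close>)
  have G_int: "(\<integral>\<^sup>+v\<in>{0..t}. G v \<partial>lborel) < top" if "0 \<le> t" for t
  proof -
    have "(\<integral>\<^sup>+v\<in>{0..t}. G v \<partial>lborel) \<le>
      (\<integral>\<^sup>+v. ennreal (exp (c * t) * w) * (ennreal (exp (- c * v) / w) * G v * indicator {0..t} v) \<partial>lborel)"
    proof (intro nn_integral_mono)
      fix v
      \<comment> \<open>For v \<le> t the factor exp(c t) outweighs exp(-c v), so the second summand
        of the mass bound controls the unweighted integral of \<open>G\<close>.\<close>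
      have "1 \<le> ennreal (exp (c * t) * w) * ennreal (exp (- c * v) / w)" if "v \<le> t"
      proof -
        have "1 \<le> exp (c * t) * w * (exp (- c * v) / w)"
          using \<open>0 < w\<close> \<open>0 \<le> c\<close> that by (simp add: exp_add[symmetric] mult_left_mono)
        then show ?thesis
          using \<open>0 < w\<close> by (simp add: ennreal_mult'[symmetric])
      qed
      from mult_right_mono[OF this, of "G v"]
      show "G v * indicator {0..t} v \<le> ennreal (exp (c * t) * w) * (ennreal (exp (- c * v) / w) * G v * indicator {0..t} v)"
        by (auto simp: mult.assoc split: split_indicator)
    qed
    also have "\<dots> = ennreal (exp (c * t) * w) * (\<integral>\<^sup>+v\<in>{0..t}. ennreal (exp (- c * v) / w) * G v \<partial>lborel)"
      by (rule nn_integral_cmult) measurable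
    also have "\<dots> \<le> ennreal (exp (c * t) * w) * 1"
      using mass[OF that] by (intro mult_left_mono) (auto intro: order_trans[rotated])
    also have "\<dots> < top"
      by simp
    finally show ?thesis .
  qed
  \<comment> \<open>In contrast to \<open>F\<close>, \<open>G\<close> is controlled only under the
    time integral and may be infinite on a null set of times.\<close>
  have G_eq: "AE v in lborel. v \<in> {0..t} \<longrightarrow> G v = ennreal (\<gamma> v)" if "0 \<le> t" for t
  proof -
    have "AE v in lborel. G v * indicator {0..t} v \<noteq> \<infinity>"
      by (rule nn_integral_PInf_AE) (use G_int[OF that] in auto)
    then show ?thesis
      by eventually_elim (auto simp: \<gamma>_def top.not_eq_extremum)
  qed
  have \<gamma>_int: "set_integrable lborel {0..t} \<gamma>" if "0 \<le> t" for t
    unfolding set_integrable_def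
  proof (rule integrableI_bounded)
    have "(\<integral>\<^sup>+v. ennreal (norm (indicator {0..t} v *\<^sub>R \<gamma> v)) \<partial>lborel) = (\<integral>\<^sup>+v\<in>{0..t}. G v \<partial>lborel)"
      using G_eq[OF that] by (intro nn_integral_cong_AE, eventually_elim) (auto simp: \<gamma>_def split: split_indicator)
    then show "(\<integral>\<^sup>+v. ennreal (norm (indicator {0..t} v *\<^sub>R \<gamma> v)) \<partial>lborel) < \<infinity>"
      using G_int[OF that] by simp
  qed measurable
  have left: "enn2ereal (F t) - ereal w =
      ext_integral (restrict_space lborel {0..t}) (\<lambda>s. enn2ereal (A s) - enn2ereal (B s)) \<longleftrightarrow>
    \<phi> t - w = (LINT s:{0..t}|lborel. c * \<phi> s - \<gamma> s)" if "0 \<le> t" for t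
  proof -
    have "set_integrable lborel {0..t} (\<lambda>s. c * \<phi> s - \<gamma> s)"
      using \<phi>_int[OF that] \<gamma>_int[OF that] by (intro set_integral_diff) auto
    then have int: "integrable (restrict_space lborel {0..t}) (\<lambda>s. c * \<phi> s - \<gamma> s)"
      by (simp add: set_integrable_def integrable_restrict_space)
    have "AE s in lborel. s \<in> {0..t} \<longrightarrow> enn2ereal (A s) - enn2ereal (B s) = ereal (c * \<phi> s - \<gamma> s)"
      using G_eq[OF that]
    proof eventually_elim
      case (elim s)
      show ?case
      proof
        assume s: "s \<in> {0..t}"
        then have G: "G s = ennreal (\<gamma> s)" and F: "F s = ennreal (\<phi> s)"
          using elim F_eq by auto
        have nn: "0 \<le> \<gamma> s" "0 \<le> \<phi> s"
          by (simp_all add: \<gamma>_def \<phi>_def)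
        \<comment> \<open>Finiteness passes from \<open>F\<close> to \<open>A\<close>, and then
          through the balance to \<open>B\<close>; only after that does the balance turn into a
          subtraction of reals.\<close>
        have "A s \<noteq> top"
          using A_le[of s] s by (auto simp: F top_unique ennreal_mult_eq_top_iff)
        then obtain a where a: "A s = ennreal a" "0 \<le> a"
          by (cases "A s") auto
        have bal: "ennreal (a + \<gamma> s) = B s + ennreal (c * \<phi> s)"
          using balance[of s] s a nn \<open>0 \<le> c\<close> by (simp add: F G ennreal_mult)
        then have "B s \<noteq> top"
          by (metis ennreal_add_eq_top ennreal_neq_top)
        then obtain b where b: "B s = ennreal b" "0 \<le> b"
          by (cases "B s") auto
        have "a + \<gamma> s = b + c * \<phi> s"
          using bal b a nn \<open>0 \<le> c\<close> by (simp add: ennreal_plus[symmetric] del: ennreal_plus)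
        then show "enn2ereal (A s) - enn2ereal (B s) = ereal (c * \<phi> s - \<gamma> s)"
          using a b by simp
      qed
    qed
    then have "AE s in restrict_space lborel {0..t}. enn2ereal (A s) - enn2ereal (B s) = ereal (c * \<phi> s - \<gamma> s)"
      by (subst AE_restrict_space_iff) auto
    note ext_integral_eq_integral[OF int this]
    moreover have "integral\<^sup>L (restrict_space lborel {0..t}) (\<lambda>s. c * \<phi> s - \<gamma> s) =
      (LINT s:{0..t}|lborel. c * \<phi> s - \<gamma> s)"
      by (simp add: integral_restrict_space set_lebesgue_integral_def)
    moreover have "enn2ereal (F t) = ereal (\<phi> t)"
      unfolding F_eq[OF that] by (rule enn2ereal_ennreal) (rule \<phi>_nonneg)
    ultimately show ?thesis
      by (simp only: ereal_minus(1) ereal.inject)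
  qed
  have right: "ennreal (exp (- c * t) / w) * F t +
      (\<integral>\<^sup>+v\<in>{0..t}. ennreal (exp (- c * v) / w) * G v \<partial>lborel) = 1 \<longleftrightarrow>
    exp (- c * t) * \<phi> t + (LINT s:{0..t}|lborel. exp (- c * s) * \<gamma> s) = w" if "0 \<le> t" for t
  proof -
    have int: "set_integrable lborel {0..t} (\<lambda>s. exp (- c * s) * \<gamma> s)"
      by (rule set_integrable_exp_mult[OF \<gamma>_int[OF that]])
    have "(\<integral>\<^sup>+v\<in>{0..t}. ennreal (exp (- c * v) / w) * G v \<partial>lborel) =
      (\<integral>\<^sup>+v. ennreal (1 / w * (indicator {0..t} v *\<^sub>R (exp (- c * v) * \<gamma> v))) \<partial>lborel)"
      using G_eq[OF that]
      by (intro nn_integral_cong_AE, eventually_elim)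
         (use \<open>0 < w\<close> in \<open>auto simp: ennreal_mult'[symmetric] split: split_indicator\<close>)
    also have "\<dots> = ennreal (LINT v|lborel. 1 / w * (indicator {0..t} v *\<^sub>R (exp (- c * v) * \<gamma> v)))"
      using int \<open>0 < w\<close>
      by (intro nn_integral_eq_integral) (auto simp: set_integrable_def \<gamma>_def)
    also have "\<dots> = ennreal ((LINT s:{0..t}|lborel. exp (- c * s) * \<gamma> s) / w)"
      by (simp add: set_lebesgue_integral_def)
    finally have I: "(\<integral>\<^sup>+v\<in>{0..t}. ennreal (exp (- c * v) / w) * G v \<partial>lborel) =
      ennreal ((LINT s:{0..t}|lborel. exp (- c * s) * \<gamma> s) / w)" .
    have nn: "0 \<le> (LINT s:{0..t}|lborel. exp (- c * s) * \<gamma> s)"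
      unfolding set_lebesgue_integral_def by (intro integral_nonneg_AE) (auto simp: \<gamma>_def)
    have "ennreal (exp (- c * t) / w) * F t + ennreal ((LINT s:{0..t}|lborel. exp (- c * s) * \<gamma> s) / w) =
      ennreal ((exp (- c * t) * \<phi> t + (LINT s:{0..t}|lborel. exp (- c * s) * \<gamma> s)) / w)"
      unfolding F_eq[OF that] using nn \<open>0 < w\<close> \<phi>_nonneg[of t]
      by (simp add: ennreal_mult'[symmetric] ennreal_plus[symmetric] add_divide_distrib del: ennreal_plus)
    then show ?thesis
      unfolding I using \<open>0 < w\<close> by (auto simp: ennreal_eq_1)
  qed
  show ?thesis
    using integral_equation_iff[of \<phi> \<gamma> w c] \<phi>_int \<gamma>_int left right by simp
qed

section \<open>The equivalence for a fixed initial state\<close>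

context drift_setting
begin

lemma dynkin_iff_transform_mass:
  assumes x: "x \<in> space M"
  shows "(\<forall>t\<ge>0. expect_at M q x t f - ereal (f x) =
      ext_integral (restrict_space lborel {0..t})
        (\<lambda>s. expect_at M q x s (\<lambda>y. q_integral M q f y s))) \<longleftrightarrow>
    (\<forall>t\<ge>0. (\<Sum>n. F.T n (\<lambda>_ _. 1) 0 (Some x) t) = 1)"
proof -
  interpret P: jump_process M q x
    by unfold_locales (fact x)
  interpret PF: jump_process "adjoin M" qf "Some x"
    by unfold_locales (simp add: space_adjoin x)
  let ?f = "\<lambda>(_ :: real) y. ennreal (f y)" and ?G = "\<lambda>v y. ennreal (kill y v)"
  \<comment> \<open>\<open>?A\<close> and \<open>?B\<close> are the positive and negative parts of q
    f, since \<open>ennreal\<close> sends negative reals to 0.\<close>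
  let ?A = "\<lambda>v y. ennreal (q_integral M q f y (max 0 v))" and ?B = "\<lambda>v y. ennreal (- q_integral M q f y (max 0 v))"
  define S where "S H t = (\<Sum>n. T n H 0 x t)" for H t
  have m: "(\<lambda>(v, y). ?f v y) \<in> borel_measurable (borel \<Otimes>\<^sub>M M)"
    "(\<lambda>(v, y). ?G v y) \<in> borel_measurable (borel \<Otimes>\<^sub>M M)"
    "(\<lambda>(v, y). ?A v y) \<in> borel_measurable (borel \<Otimes>\<^sub>M M)"
    "(\<lambda>(v, y). ?B v y) \<in> borel_measurable (borel \<Otimes>\<^sub>M M)"
    by measurable
  have S_meas: "S H \<in> borel_measurable borel" if "(\<lambda>(v, y). H v y) \<in> borel_measurable (borel \<Otimes>\<^sub>M M)" for H
    unfolding S_def[abs_def] by (intro borel_measurable_suminf_order measurable_T[OF _ _ _ that]) (auto simp: x)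
  have "T n (\<lambda>_ y. ennreal (- f y)) 0 x t = T n (\<lambda>_ _. 0) 0 x t" for n t
    by (intro T_cong[OF _ x]) (auto simp: ennreal_neg f_nonneg)
  then have exp_f: "expect_at M q x t f = enn2ereal (S ?f t)" if "0 \<le> t" for t
    using P.expect_at_eq[OF measurable_f that] by (simp add: S_def T_zero zero_ennreal.rep_eq)
  have exp_q: "expect_at M q x s (\<lambda>y. q_integral M q f y s) = enn2ereal (S ?A s) - enn2ereal (S ?B s)" if "0 \<le> s" for s
  proof -
    have "(\<lambda>y. q_integral M q f y (max 0 s)) \<in> borel_measurable M"
      by measurable
    then have "(\<lambda>y. q_integral M q f y s) \<in> borel_measurable M"
      using that by simp
    from P.expect_at_eq[OF this that]
    have "expect_at M q x s (\<lambda>y. q_integral M q f y s) =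
      enn2ereal (\<Sum>n. T n (\<lambda>_ y. ennreal (q_integral M q f y s)) 0 x s) -
      enn2ereal (\<Sum>n. T n (\<lambda>_ y. ennreal (- q_integral M q f y s)) 0 x s)" .
    also have "(\<lambda>n. T n (\<lambda>_ y. ennreal (q_integral M q f y s)) 0 x s) = (\<lambda>n. T n ?A 0 x s)"
      by (intro ext T_cong[OF _ x]) (simp add: that)
    also have "(\<lambda>n. T n (\<lambda>_ y. ennreal (- q_integral M q f y s)) 0 x s) = (\<lambda>n. T n ?B 0 x s)"
      by (intro ext T_cong[OF _ x]) (simp add: that)
    finally show ?thesis
      by (simp add: S_def)
  qed
  have mass: "(\<Sum>n. F.T n (\<lambda>_ _. 1) 0 (Some x) t) = ennreal (exp (- c * t) / f x) * S ?f t +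
    (\<integral>\<^sup>+v\<in>{0..t}. ennreal (exp (- c * v) / f x) * S ?G v \<partial>lborel)" if "0 \<le> t" for t
    unfolding S_def by (rule transform_mass[OF x that])
  have balance: "S ?A t + S ?G t = S ?B t + ennreal c * S ?f t" if "0 \<le> t" for t
  proof -
    have "T n ?A 0 x t + T n ?G 0 x t = T n ?B 0 x t + ennreal c * T n ?f 0 x t" for n
    proof -
      have "T n ?A 0 x t + T n ?G 0 x t = T n (\<lambda>v y. ?A v y + ?G v y) 0 x t"
        by (rule T_add[OF m(3,2) x, symmetric])
      also have "\<dots> = T n (\<lambda>v y. ?B v y + ennreal c * ?f v y) 0 x t"
      proof (rule T_cong[OF _ x])
        fix y assume y: "y \<in> space M"
        let ?g = "q_integral M q f y (max 0 t)"
        \<comment> \<open>(q f)^+ + (c f - q f) = (q f)^- + c f: the definition of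
          \<open>kill\<close> arranged without subtraction, so that it can be summed over path terms
          in \<open>ennreal\<close>.\<close>
        have "ennreal ?g + ennreal (c * f y - ?g) = ennreal (- ?g) + ennreal (c * f y)"
          using kill_nonneg[OF y, of t] f_nonneg[OF y] c_nonneg
          by (cases "0 \<le> ?g")
             (auto simp: kill_def ennreal_neg ennreal_plus[symmetric] simp del: ennreal_plus)
        then show "?A t y + ?G t y = ?B t y + ennreal c * ?f t y"
          using c_nonneg by (simp add: kill_def ennreal_mult')
      qed
      also have "\<dots> = T n ?B 0 x t + T n (\<lambda>v y. ennreal c * ?f v y) 0 x t"
        by (rule T_add[OF m(4) _ x]) measurable
      also have "T n (\<lambda>v y. ennreal c * ?f v y) 0 x t = ennreal c * T n ?f 0 x t"
        by (rule T_cmult[OF m(1) x])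
      finally show ?thesis .
    qed
    then show ?thesis
      unfolding S_def ennreal_suminf_cmult[symmetric]
      by (simp add: suminf_add del: ennreal_suminf_cmult)
  qed
  have A_le: "S ?A t \<le> ennreal c * S ?f t" if "0 \<le> t" for t
  proof -
    have "T n ?A 0 x t \<le> ennreal c * T n ?f 0 x t" for n
    proof -
      have "T n ?A 0 x t \<le> T n (\<lambda>v y. ennreal c * ?f v y) 0 x t"
        using q_integral_le[of _ t] that c_nonneg
        by (intro T_mono[OF _ x]) (auto simp: ennreal_mult'[symmetric] intro!: ennreal_leI)
      also have "\<dots> = ennreal c * T n ?f 0 x t"
        by (rule T_cmult[OF m(1) x])
      finally show ?thesis .
    qed
    then show ?thesis
      unfolding S_def ennreal_suminf_cmult[symmetric] by (intro suminf_le) auto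
  qed
  have "ext_integral (restrict_space lborel {0..t}) (\<lambda>s. expect_at M q x s (\<lambda>y. q_integral M q f y s)) =
    ext_integral (restrict_space lborel {0..t}) (\<lambda>s. enn2ereal (S ?A s) - enn2ereal (S ?B s))" for t
    unfolding ext_integral_def
    by (intro arg_cong2[where f="(-)"] arg_cong[where f=enn2ereal] nn_integral_cong)
       (auto simp: space_restrict_space exp_q)
  then have "?thesis \<longleftrightarrow>
    ((\<forall>t\<ge>0. enn2ereal (S ?f t) - ereal (f x) =
      ext_integral (restrict_space lborel {0..t}) (\<lambda>s. enn2ereal (S ?A s) - enn2ereal (S ?B s))) \<longleftrightarrow>
    (\<forall>t\<ge>0. ennreal (exp (- c * t) / f x) * S ?f t +
      (\<integral>\<^sup>+v\<in>{0..t}. ennreal (exp (- c * v) / f x) * S ?G v \<partial>lborel) = 1))"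
    by (simp add: exp_f mass)
  moreover have "\<dots>"
  proof (rule dynkin_iff_mass)
    show "ennreal (exp (- c * t) / f x) * S ?f t +
      (\<integral>\<^sup>+v\<in>{0..t}. ennreal (exp (- c * v) / f x) * S ?G v \<partial>lborel) \<le> 1" if "0 \<le> t" for t
      \<comment> \<open>The mass bound for q and f is read off from the jump process of q^f, whose
        surviving mass is a probability.\<close>
      using PF.sum_T_1_le[OF that] unfolding mass[OF that] .
  qed (use S_meas m f_pos[OF x] c_nonneg balance A_le in auto)
  ultimately show ?thesis
    by simp
qed

lemma trans_fun_transform:
  "x \<in> space M \<Longrightarrow> trans_fun (adjoin M) qf 0 (Some x) t (space (adjoin M)) = (\<Sum>n. F.T n (\<lambda>_ _. 1) 0 (Some x) t)"
  unfolding trans_fun_def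
  by (intro suminf_cong, subst F.trans_term_eq) (auto simp: space_adjoin intro!: F.T_cong)

text \<open>Nonexplosion also quantifies over the start in delta, where it is automatic: the term of
  index 0 alone has mass 1.\<close>

lemma nonexplosive_transform_iff:
  "nonexplosive (adjoin M) qf \<longleftrightarrow> (\<forall>x\<in>space M. \<forall>t\<ge>0. (\<Sum>n. F.T n (\<lambda>_ _. 1) 0 (Some x) t) = 1)"
proof -
  have "\<P>(\<omega> in jump_law (adjoin M) qf p. explosion_time \<omega> = \<infinity>) = 1 \<longleftrightarrow>
      (\<forall>t\<ge>0. (\<Sum>n. F.T n (\<lambda>_ _. 1) 0 p t) = 1)" if "p \<in> space (adjoin M)" for p
  proof -
    interpret PF: jump_process "adjoin M" qf p
      by unfold_locales (fact that)
    show ?thesis by (fact PF.prob_no_explosion_iff)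
  qed
  moreover have "(\<Sum>n. F.T n (\<lambda>_ _. 1) 0 None t) = 1" for t
    unfolding F_T_None by (subst suminf_single[of 0]) auto
  ultimately show ?thesis
    by (auto simp: nonexplosive_def space_adjoin)
qed

end

theorem theorem4p1:
  fixes S :: "'a::polish_space set" and M :: "'a measure" and q :: "'a rate"
    and c :: real and f :: "'a \<Rightarrow> real"
  assumes "S \<noteq> {}" and "S \<in> sets borel" and M: "M = restrict_space borel S"
    and "Q_function M q" and "0 \<le> c" and "drift_function M q c f"
  shows "((\<forall>x\<in>S. \<forall>t\<ge>0.
             expect_at M q x t f - ereal (f x) =
             ext_integral (restrict_space lborel {0..t})
               (\<lambda>s. expect_at M q x s (\<lambda>y. q_integral M q f y s)))
          \<longleftrightarrow>
          (\<forall>x\<in>S. \<forall>t\<ge>0.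
             trans_fun (adjoin M) (f_transform M q c f) 0 (Some x) t (space (adjoin M)) = 1))
       \<and>
         ((\<forall>x\<in>S. \<forall>t\<ge>0.
             trans_fun (adjoin M) (f_transform M q c f) 0 (Some x) t (space (adjoin M)) = 1)
          \<longleftrightarrow> nonexplosive (adjoin M) (f_transform M q c f))"
proof -
  from assms(1-4) obtain B where "separated_Q_function M q B"
    using separated_Q_function_restrict_borel by blast
  then interpret separated_Q_function M q B .
  interpret drift_setting M q c f
    by unfold_locales (fact singleton_sets off_diag_self assms)+
  have "space M = S"
    by (simp add: M space_restrict_space)
  then show ?thesis
    using dynkin_iff_transform_mass by (simp add: trans_fun_transform nonexplosive_transform_iff)
qed

end
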